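(* Let $M$ be an oriented $6$-manifold and let $\varphi\in\mathcal{A}^3_+(M)$ satisfy $d(\ast\varphi)=0$. If $\varphi$ is positive definite, then the $\mathrm{U}(3)$-structure $(J_\varphi,\eta_\varphi)$ is strictly quasi-integrable. If $\varphi$ is positive indefinite, then the $\mathrm{U}(1,2)$-structure $(J_\varphi,\eta_\varphi)$ is strictly quasi-integrable.
   Context: Let $V$ be a $6$-dimensional oriented real vector space. $A^3_+(V)\subset\Lambda^3(V^* )$ is the open $\mathrm{GL}(V)$-orbit of $\mathrm{Re}\bigl((v^1+iv^2)\wedge(v^3+iv^4)\wedge(v^5+iv^6)\bigr)$, $v^i$ a basis of $V^*$. For $\phi\in A^3_+(V)$ there are a unique $\ast\phi\in A^3_+(V)$ and a unique complex structure $J_\phi:V\to V$ such that $\phi\wedge{\ast\phi}>0$ and $\phi+i\,{\ast\phi}$ is a $(3,0)$-form for $J_\phi$. (The map $\phi\mapsto\ast\phi$ is not linear.) $\mathcal{A}^3_+(M)$ is the set of smooth real $3$-forms $\varphi$ on $M$ with $\varphi_x\in A^3_+(T_xM)$ for all $x$; each such $\varphi$ has an associated $3$-form $\ast\varphi$ and almost complex structure $J_\varphi$ on $M$, with respect to which types are taken. If $d(\ast\varphi)=0$, then $d\varphi=d(\varphi+i\,{\ast\varphi})=\pi$ is a real form of type $(2,2)$. $\varphi$ is positive definite if $\pi$ is, at each point, positive on all $J_\varphi$-complex subspaces of complex dimension $2$ (equivalently, $\pi$ is at each point of the form $\tfrac12\beta^2$ with $\beta$ a positive real $(1,1)$-form);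 it is positive indefinite if at each point $\pi=\tfrac12\beta^2$ with $\beta$ a nondegenerate real $(1,1)$-form of Hermitian signature $(1,2)$. In these cases there is a unique real $(1,1)$-form $\eta_\varphi$, positive (resp. of signature $(1,2)$), with $d\varphi=2\,\eta_\varphi{}^2$. For an almost complex structure $J$, $d=d^{2,-1}+\partial+\bar\partial+d^{-1,2}$ by type, and for a local $J$-linear coframing $\alpha=(\alpha^1,\alpha^2,\alpha^3)$ (a column of pointwise linearly independent $(1,0)$-forms), $N(\alpha)$ is the matrix function with $$d^{-1,2}\alpha=N(\alpha)\begin{pmatrix}\overline{\alpha^2\wedge\alpha^3}\\ \overline{\alpha^3\wedge\alpha^1}\\ \overline{\alpha^1\wedge\alpha^2}\end{pmatrix}.$$ A $\mathrm{U}(3)$- (resp. $\mathrm{U}(1,2)$-) structure is a pair $(J,\eta)$ with $\eta$ a real $(1,1)$-form that is positive (resp. nondegenerate of signature $(1,2)$). A $J$-linear coframing is $(J,\eta)$-unitary if $\eta=\tfrac{i}{2}(\alpha^1\wedge\overline{\alpha^1}\pm\alpha^2\wedge\overline{\alpha^2}\pm\alpha^3\wedge\overline{\alpha^3})$ with both signs $+$ (resp. both $-$). $(J,\eta)$ is quasi-integrable if for every local unitary coframing $N(\alpha)=\lambda I_3$ (resp. $N(\alpha)=\mathrm{diag}(\lambda,-\lambda,-\lambda)$) for some complex function $\lambda$; strictly quasi-integrable if moreover $\lambda$ is nowhere zero. *)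

theory Defs
  imports "HOL-Analysis.Analysis"
begin

type_synonym V = "real ^ 6"

text \<open>A form of degree k is a function of a sequence of vectors that only looks at the
  entries \<open>0, \<dots>, k - 1\<close>. The degree is therefore an explicit argument of the operations below.\<close>

type_synonym 'a form = "(nat \<Rightarrow> V) \<Rightarrow> 'a"

definition kform :: "nat \<Rightarrow> 'a::real_normed_vector form \<Rightarrow> bool" where
  "kform k \<omega> \<longleftrightarrow>
     (\<forall>v w. (\<forall>i<k. v i = w i) \<longrightarrow> \<omega> v = \<omega> w) \<and>
     (\<forall>i<k. \<forall>v. linear (\<lambda>x. \<omega> (v(i := x)))) \<and>
     (\<forall>i<k. \<forall>j<k. \<forall>v. i \<noteq> j \<longrightarrow> v i = v j \<longrightarrow> \<omega> v = 0)"

text \<open>The wedge product of a p-form and a q-form, normalised so that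
  \<open>(a \<and> b)(u, v) = a(u) b(v) - a(v) b(u)\<close> for 1-forms.\<close>

definition wedge :: "nat \<Rightarrow> nat \<Rightarrow> 'a::real_normed_field form \<Rightarrow> 'a form \<Rightarrow> 'a form" where
  "wedge p q \<alpha> \<beta> = (\<lambda>v. (\<Sum>\<sigma> | \<sigma> permutes {..<p + q}.
      of_int (sign \<sigma>) * \<alpha> (\<lambda>i. v (\<sigma> i)) * \<beta> (\<lambda>i. v (\<sigma> (p + i)))) / (fact p * fact q))"

definition covector :: "(V \<Rightarrow> 'a) \<Rightarrow> 'a form" where
  "covector a = (\<lambda>v. a (v 0))"

definition pullback :: "(V \<Rightarrow> V) \<Rightarrow> 'a form \<Rightarrow> 'a form" where
  "pullback g \<omega> = (\<lambda>v. \<omega> (\<lambda>i. g (v i)))"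

definition complex_form :: "real form \<Rightarrow> complex form" where
  "complex_form \<omega> = (\<lambda>v. complex_of_real (\<omega> v))"

definition cnj_form :: "complex form \<Rightarrow> complex form" where
  "cnj_form \<omega> = (\<lambda>v. cnj (\<omega> v))"

text \<open>V carries the orientation of the ordered standard basis. In the index type 6 the numeral
  6 denotes 0, so the coordinates \<open>x $ 1, \<dots>, x $ 6\<close> are pairwise distinct and exhaust V.\<close>

definition positive_top_form :: "real form \<Rightarrow> bool" where
  "positive_top_form \<omega> \<longleftrightarrow> \<omega> (\<lambda>i. axis (of_nat (i + 1)) 1) > 0"

definition dz :: "6 \<Rightarrow> 6 \<Rightarrow> complex form" where
  "dz j k = covector (\<lambda>x. Complex (x $ j) (x $ k))"

definition phi0 :: "real form" where
  "phi0 = (\<lambda>v. Re (wedge 2 1 (wedge 1 1 (dz 1 2) (dz 3 4)) (dz 5 6) v))"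

definition A3plus :: "real form set" where
  "A3plus = {pullback g phi0 | g. linear g \<and> bij g}"

definition complex_structure :: "(V \<Rightarrow> V) \<Rightarrow> bool" where
  "complex_structure J \<longleftrightarrow> linear J \<and> (\<forall>v. J (J v) = - v)"

definition covector10 :: "(V \<Rightarrow> V) \<Rightarrow> (V \<Rightarrow> complex) \<Rightarrow> bool" where
  "covector10 J a \<longleftrightarrow> linear a \<and> (\<forall>v. a (J v) = \<i> * a v)"

text \<open>The complex span of the wedge products of p covectors of type (1,0) and
  q complex conjugates of such covectors.\<close>

inductive of_type :: "(V \<Rightarrow> V) \<Rightarrow> nat \<Rightarrow> nat \<Rightarrow> complex form \<Rightarrow> bool" for J where
  scalar: "of_type J 0 0 (\<lambda>v. c)"
| add: "of_type J p q \<omega> \<Longrightarrow> of_type J p q \<omega>' \<Longrightarrow> of_type J p q (\<lambda>v. \<omega> v + \<omega>' v)"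
| wedge10: "covector10 J a \<Longrightarrow> of_type J p q \<omega> \<Longrightarrow>
    of_type J (Suc p) q (wedge 1 (p + q) (covector a) \<omega>)"
| wedge01: "covector10 J a \<Longrightarrow> of_type J p q \<omega> \<Longrightarrow>
    of_type J p (Suc q) (wedge 1 (p + q) (covector (\<lambda>v. cnj (a v))) \<omega>)"

definition type_component :: "(V \<Rightarrow> V) \<Rightarrow> nat \<Rightarrow> nat \<Rightarrow> complex form \<Rightarrow> complex form" where
  "type_component J p q \<omega> = (THE \<tau>. \<exists>f. (\<forall>r\<le>p + q. of_type J r (p + q - r) (f r)) \<and>
      \<omega> = (\<lambda>v. \<Sum>r\<le>p + q. f r v) \<and> \<tau> = f p)"

definition real_11 :: "(V \<Rightarrow> V) \<Rightarrow> real form \<Rightarrow> bool" where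
  "real_11 J \<eta> \<longleftrightarrow> of_type J 1 1 (complex_form \<eta>)"

definition vec2 :: "V \<Rightarrow> V \<Rightarrow> nat \<Rightarrow> V" where
  "vec2 u v = (\<lambda>_. 0)(0 := u, 1 := v)"

definition vec4 :: "V \<Rightarrow> V \<Rightarrow> V \<Rightarrow> V \<Rightarrow> nat \<Rightarrow> V" where
  "vec4 u v w x = (\<lambda>_. 0)(0 := u, 1 := v, 2 := w, 3 := x)"

definition positive_11 :: "(V \<Rightarrow> V) \<Rightarrow> real form \<Rightarrow> bool" where
  "positive_11 J \<eta> \<longleftrightarrow> real_11 J \<eta> \<and> (\<forall>v. v \<noteq> 0 \<longrightarrow> \<eta> (vec2 v (J v)) > 0)"

text \<open>A coframe consists of three complex linearly independent covectors of type (1,0).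
  The index type is 3, where the numeral 3 denotes 0.\<close>

definition coframe :: "(V \<Rightarrow> V) \<Rightarrow> (3 \<Rightarrow> complex form) \<Rightarrow> bool" where
  "coframe J \<alpha> \<longleftrightarrow> (\<forall>i. \<exists>a. covector10 J a \<and> \<alpha> i = covector a) \<and>
     (\<forall>c. (\<forall>v. (\<Sum>i\<in>UNIV. c i * \<alpha> i v) = 0) \<longrightarrow> (\<forall>i. c i = 0))"

text \<open>The diagonal (1, s, s); s = 1 gives U(3) and s = -1 gives U(1,2).\<close>

definition eps :: "real \<Rightarrow> 3 \<Rightarrow> real" where
  "eps s i = (if i = 1 then 1 else s)"

definition diagonalizes :: "real \<Rightarrow> (3 \<Rightarrow> complex form) \<Rightarrow> real form \<Rightarrow> bool" where
  "diagonalizes s \<alpha> \<eta> \<longleftrightarrow> complex_form \<eta> =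
     (\<lambda>v. \<i> / 2 * (\<Sum>i\<in>UNIV. of_real (eps s i) * wedge 1 1 (\<alpha> i) (cnj_form (\<alpha> i)) v))"

text \<open>Signature (1,2) is expressed by Sylvester's normal form of the associated
  Hermitian form; nondegeneracy is included.\<close>

definition signature12_11 :: "(V \<Rightarrow> V) \<Rightarrow> real form \<Rightarrow> bool" where
  "signature12_11 J \<eta> \<longleftrightarrow> real_11 J \<eta> \<and> (\<exists>\<alpha>. coframe J \<alpha> \<and> diagonalizes (-1) \<alpha> \<eta>)"

text \<open>A complex plane W is oriented by its bases \<open>(u, J u, w, J w)\<close>.\<close>

definition positive_on_complex_planes :: "(V \<Rightarrow> V) \<Rightarrow> real form \<Rightarrow> bool" where
  "positive_on_complex_planes J \<pi> \<longleftrightarrow>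
     (\<forall>W. subspace W \<and> J ` W \<subseteq> W \<and> dim W = 4 \<longrightarrow>
        (\<forall>u w. span {u, J u, w, J w} = W \<longrightarrow> \<pi> (vec4 u (J u) w (J w)) > 0))"

definition associated :: "real form \<Rightarrow> real form \<times> (V \<Rightarrow> V) \<Rightarrow> bool" where
  "associated \<phi> = (\<lambda>(\<psi>, J). \<psi> \<in> A3plus \<and> complex_structure J \<and>
     positive_top_form (wedge 3 3 \<phi> \<psi>) \<and>
     of_type J 3 0 (\<lambda>v. complex_of_real (\<phi> v) + \<i> * complex_of_real (\<psi> v)))"

definition star_form :: "real form \<Rightarrow> real form" where
  "star_form \<phi> = fst (THE x. associated \<phi> x)"

definition J_form :: "real form \<Rightarrow> V \<Rightarrow> V" where
  "J_form \<phi> = snd (THE x. associated \<phi> x)"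

primrec Ck_on :: "nat \<Rightarrow> ('a::real_normed_vector \<Rightarrow> 'b::real_normed_vector) \<Rightarrow> 'a set \<Rightarrow> bool" where
  "Ck_on 0 f S \<longleftrightarrow> continuous_on S f"
| "Ck_on (Suc k) f S \<longleftrightarrow> (\<forall>x\<in>S. f differentiable (at x)) \<and>
     (\<forall>v. Ck_on k (\<lambda>x. frechet_derivative f (at x) v) S)"

definition smooth_on :: "('a::real_normed_vector \<Rightarrow> 'b::real_normed_vector) \<Rightarrow> 'a set \<Rightarrow> bool" where
  "smooth_on f S \<longleftrightarrow> (\<forall>k. Ck_on k f S)"

type_synonym 'm chart = "'m set \<times> ('m \<Rightarrow> V)"

abbreviation cdom :: "'m chart \<Rightarrow> 'm set" where "cdom \<equiv> fst"
abbreviation cmap :: "'m chart \<Rightarrow> 'm \<Rightarrow> V" where "cmap \<equiv> snd"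

definition cinv :: "'m chart \<Rightarrow> V \<Rightarrow> 'm" where
  "cinv c = inv_into (cdom c) (cmap c)"

definition is_chart :: "'m::topological_space chart \<Rightarrow> bool" where
  "is_chart c \<longleftrightarrow> open (cdom c) \<and> open (cmap c ` cdom c) \<and>
     homeomorphism (cdom c) (cmap c ` cdom c) (cmap c) (cinv c)"

definition transition :: "'m chart \<Rightarrow> 'm chart \<Rightarrow> V \<Rightarrow> V" where
  "transition c c' = cmap c' \<circ> cinv c"

definition transition_deriv :: "'m chart \<Rightarrow> 'm chart \<Rightarrow> 'm \<Rightarrow> V \<Rightarrow> V" where
  "transition_deriv c c' p = frechet_derivative (transition c c') (at (cmap c p))"

definition oriented_atlas :: "'m::topological_space chart set \<Rightarrow> bool" where
  "oriented_atlas A \<longleftrightarrow> (\<forall>c\<in>A. is_chart c) \<and> (\<Union>c\<in>A. cdom c) = UNIV \<and>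
     (\<forall>c\<in>A. \<forall>c'\<in>A. smooth_on (transition c c') (cmap c ` (cdom c \<inter> cdom c')) \<and>
        (\<forall>p\<in>cdom c \<inter> cdom c'. det (matrix (transition_deriv c c' p)) > 0))"

text \<open>Tensor fields are given by their components in the charts of the atlas: the chart c
  identifies the tangent space at p with V, and \<open>\<omega> c p\<close> is the value at p under this
  identification. Components in different charts are related by the transition maps.\<close>

type_synonym ('m, 'a) form_field = "'m chart \<Rightarrow> 'm \<Rightarrow> 'a form"

definition local_rep :: "('m, 'a) form_field \<Rightarrow> 'm chart \<Rightarrow> V \<Rightarrow> 'a form" where
  "local_rep \<omega> c = (\<lambda>x. \<omega> c (cinv c x))"

definition smooth_form :: "'m::topological_space chart set \<Rightarrow> nat \<Rightarrow> 'm set \<Rightarrow>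
    ('m, 'a::real_normed_vector) form_field \<Rightarrow> bool" where
  "smooth_form A k W \<omega> \<longleftrightarrow>
     (\<forall>c\<in>A. \<forall>p\<in>W \<inter> cdom c. kform k (\<omega> c p)) \<and>
     (\<forall>c\<in>A. \<forall>c'\<in>A. \<forall>p\<in>W \<inter> cdom c \<inter> cdom c'.
        \<omega> c p = pullback (transition_deriv c c' p) (\<omega> c' p)) \<and>
     (\<forall>c\<in>A. \<forall>v. smooth_on (\<lambda>x. local_rep \<omega> c x v) (cmap c ` (W \<inter> cdom c)))"

definition omit :: "nat \<Rightarrow> (nat \<Rightarrow> V) \<Rightarrow> nat \<Rightarrow> V" where
  "omit i v = (\<lambda>j. if j < i then v j else v (Suc j))"

definition ext_deriv :: "nat \<Rightarrow> (V \<Rightarrow> 'a::real_normed_vector form) \<Rightarrow> V \<Rightarrow> 'a form" where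
  "ext_deriv k \<omega> x = (\<lambda>v. \<Sum>i\<le>k. (-1) ^ i *\<^sub>R
     frechet_derivative (\<lambda>y. \<omega> y (omit i v)) (at x) (v i))"

definition exterior_d :: "nat \<Rightarrow> ('m, 'a::real_normed_vector) form_field \<Rightarrow> ('m, 'a) form_field" where
  "exterior_d k \<omega> = (\<lambda>c p. ext_deriv k (local_rep \<omega> c) (cmap c p))"

type_synonym 'm endo_field = "'m chart \<Rightarrow> 'm \<Rightarrow> V \<Rightarrow> V"

definition local_coframing :: "'m::topological_space chart set \<Rightarrow> 'm endo_field \<Rightarrow> 'm set \<Rightarrow>
    (3 \<Rightarrow> ('m, complex) form_field) \<Rightarrow> bool" where
  "local_coframing A J W \<alpha> \<longleftrightarrow> open W \<and> (\<forall>i. smooth_form A 1 W (\<alpha> i)) \<and>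
     (\<forall>c\<in>A. \<forall>p\<in>W \<inter> cdom c. coframe (J c p) (\<lambda>i. \<alpha> i c p))"

definition unitary_coframing :: "real \<Rightarrow> 'm::topological_space chart set \<Rightarrow> 'm endo_field \<Rightarrow>
    ('m, real) form_field \<Rightarrow> 'm set \<Rightarrow> (3 \<Rightarrow> ('m, complex) form_field) \<Rightarrow> bool" where
  "unitary_coframing s A J \<eta> W \<alpha> \<longleftrightarrow> local_coframing A J W \<alpha> \<and>
     (\<forall>c\<in>A. \<forall>p\<in>W \<inter> cdom c. diagonalizes s (\<lambda>i. \<alpha> i c p) (\<eta> c p))"

text \<open>The indices \<open>j + 1\<close>, \<open>j + 2\<close> are cyclic (modulo 3), which gives the conjugates of
  \<open>\<alpha>\<^sub>2 \<and> \<alpha>\<^sub>3\<close>, \<open>\<alpha>\<^sub>3 \<and> \<alpha>\<^sub>1\<close>, \<open>\<alpha>\<^sub>1 \<and> \<alpha>\<^sub>2\<close> for j = 1, 2, 3. On forms of type (1,0) the operator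
  \<open>d\<^sup>-\<^sup>1\<^sup>,\<^sup>2\<close> is the (0,2)-component of the exterior derivative.\<close>

definition N_matrix :: "'m chart set \<Rightarrow> 'm endo_field \<Rightarrow>
    (3 \<Rightarrow> ('m, complex) form_field) \<Rightarrow> 'm \<Rightarrow> complex ^ 3 ^ 3" where
  "N_matrix A J \<alpha> p = (THE N. \<forall>c\<in>A. p \<in> cdom c \<longrightarrow>
     (\<forall>i. type_component (J c p) 0 2 (exterior_d 1 (\<alpha> i) c p) =
        (\<lambda>v. \<Sum>j\<in>UNIV. N $ i $ j * cnj_form (wedge 1 1 (\<alpha> (j + 1) c p) (\<alpha> (j + 2) c p)) v)))"

definition N_normal_form :: "real \<Rightarrow> 'm chart set \<Rightarrow> 'm endo_field \<Rightarrow>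
    (3 \<Rightarrow> ('m, complex) form_field) \<Rightarrow> 'm set \<Rightarrow> ('m \<Rightarrow> complex) \<Rightarrow> bool" where
  "N_normal_form s A J \<alpha> W \<mu> \<longleftrightarrow> (\<forall>p\<in>W. N_matrix A J \<alpha> p =
     (\<chi> i j. if i = j then of_real (eps s i) * \<mu> p else 0))"

definition quasi_integrable :: "real \<Rightarrow> 'm::topological_space chart set \<Rightarrow> 'm endo_field \<Rightarrow>
    ('m, real) form_field \<Rightarrow> bool" where
  "quasi_integrable s A J \<eta> \<longleftrightarrow>
     (\<forall>W \<alpha>. unitary_coframing s A J \<eta> W \<alpha> \<longrightarrow> (\<exists>\<mu>. N_normal_form s A J \<alpha> W \<mu>))"

definition strictly_quasi_integrable :: "real \<Rightarrow> 'm::topological_space chart set \<Rightarrow>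
    'm endo_field \<Rightarrow> ('m, real) form_field \<Rightarrow> bool" where
  "strictly_quasi_integrable s A J \<eta> \<longleftrightarrow> quasi_integrable s A J \<eta> \<and>
     (\<forall>W \<alpha> \<mu>. unitary_coframing s A J \<eta> W \<alpha> \<longrightarrow> N_normal_form s A J \<alpha> W \<mu> \<longrightarrow>
        (\<forall>p\<in>W. \<mu> p \<noteq> 0))"

definition A3plus_fields :: "'m::topological_space chart set \<Rightarrow> ('m, real) form_field set" where
  "A3plus_fields A = {\<phi>. smooth_form A 3 UNIV \<phi> \<and> (\<forall>c\<in>A. \<forall>p\<in>cdom c. \<phi> c p \<in> A3plus)}"

definition star :: "('m, real) form_field \<Rightarrow> ('m, real) form_field" where
  "star \<phi> = (\<lambda>c p. star_form (\<phi> c p))"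

definition J_of :: "('m, real) form_field \<Rightarrow> 'm endo_field" where
  "J_of \<phi> = (\<lambda>c p. J_form (\<phi> c p))"

definition closed_form :: "'m chart set \<Rightarrow> nat \<Rightarrow> ('m, 'a::real_normed_vector) form_field \<Rightarrow> bool" where
  "closed_form A k \<omega> \<longleftrightarrow> (\<forall>c\<in>A. \<forall>p\<in>cdom c. exterior_d k \<omega> c p = (\<lambda>v. 0))"

definition positive_definite :: "'m chart set \<Rightarrow> ('m, real) form_field \<Rightarrow> bool" where
  "positive_definite A \<phi> \<longleftrightarrow>
     (\<forall>c\<in>A. \<forall>p\<in>cdom c. positive_on_complex_planes (J_of \<phi> c p) (exterior_d 3 \<phi> c p))"

definition positive_indefinite :: "'m chart set \<Rightarrow> ('m, real) form_field \<Rightarrow> bool" where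
  "positive_indefinite A \<phi> \<longleftrightarrow> (\<forall>c\<in>A. \<forall>p\<in>cdom c.
     \<exists>\<beta>. signature12_11 (J_of \<phi> c p) \<beta> \<and> exterior_d 3 \<phi> c p = (\<lambda>v. 1 / 2 * wedge 2 2 \<beta> \<beta> v))"

definition eta_definite :: "('m, real) form_field \<Rightarrow> ('m, real) form_field" where
  "eta_definite \<phi> = (\<lambda>c p. THE \<eta>. positive_11 (J_of \<phi> c p) \<eta> \<and>
     exterior_d 3 \<phi> c p = (\<lambda>v. 2 * wedge 2 2 \<eta> \<eta> v))"

definition eta_indefinite :: "('m, real) form_field \<Rightarrow> ('m, real) form_field" where
  "eta_indefinite \<phi> = (\<lambda>c p. THE \<eta>. signature12_11 (J_of \<phi> c p) \<eta> \<and>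
     exterior_d 3 \<phi> c p = (\<lambda>v. 2 * wedge 2 2 \<eta> \<eta> v))"

end

theory Submission
  imports Defs
begin

text \<open>Write \<open>\<phi> + \<i> *\<phi> = f \<alpha>\<^sub>1 \<and> \<alpha>\<^sub>2 \<and> \<alpha>\<^sub>3\<close> with a nowhere vanishing function f, for a unitary coframing \<open>\<alpha>\<close>.
  If two arguments of type (0,1) are inserted into the exterior derivative of the right hand side,
  only the terms with the (0,2)-part of \<open>d\<alpha>\<^sub>i\<close> survive: the result is f times the sum of
  \<open>(d\<^sup>-\<^sup>1\<^sup>,\<^sup>2 \<alpha>\<^sub>i) \<otimes> \<alpha>\<^sub>j \<and> \<alpha>\<^sub>k\<close> over the cyclic permutations (i, j, k). As \<open>*\<phi>\<close> is closed, the
  derivative of the left hand side is \<open>d\<phi> = 2 \<eta>\<^sup>2\<close>, and inserting the same arguments there gives the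
  corresponding sum with the conjugate of \<open>\<plusminus> \<alpha>\<^sub>j \<and> \<alpha>\<^sub>k\<close> in place of \<open>d\<^sup>-\<^sup>1\<^sup>,\<^sup>2 \<alpha>\<^sub>i\<close>. Comparing coefficients,
  \<open>N(\<alpha>) = f\<^sup>-\<^sup>1 diag(1, \<plusminus>1, \<plusminus>1)\<close>. In a coframe, squaring a real (1,1)-form is the passage from a Hermitian
  matrix to its cofactor matrix, which is injective up to sign; this gives existence and
  uniqueness of \<open>\<eta>\<close>.\<close>

text \<open>In complex dimension three a four-form only has components of type (3,1), (2,2) and
  (1,3). Inserting two (0,1)-vectors detects the last two, and for a real form the first is the
  conjugate of the third, so the insertion determines the form. This is why one contraction serves
  both to compare d\<phi> with 2 \<eta>^2 and to construct \<eta>. In the definite case, positivity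
  on complex planes has to be turned into positivity of a Hermitian matrix. Every vector of C^3 is a
  cross product, so complex planes test the matrix in all directions; a positive definite P is then
  the cofactor matrix of det(P)^(-1/2) times \<open>cofac P\<close>. In the indefinite case \<eta>
  is half of the given \<beta>, and the sign is settled by signature: -\<eta> has signature (2,1).
  The signs in N(\<alpha>) are those of \<eta> because diag(1, s, s) with s^2 = 1 is its own
  cofactor matrix. Since \<open>star_form\<close> and \<open>J_form\<close> are pointwise
  descriptions, the regularity of f is not given at the outset; it has to be established before the
  product rule applies.\<close>

section \<open>Wedge products of low degree\<close>

text \<open>Cyclic shifts by 1 and 2 in the index type 3 lead to numerals up to 7 when they are
  iterated, as in cofactors of cofactors.\<close>

lemma numeral_type_3 [simp]: "(4::3) = 1" "(5::3) = 2" "(6::3) = 3" "(7::3) = 1"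
  by simp_all

lemma sum_permutes_2:
  "(\<Sum>\<sigma> | \<sigma> permutes {..<2::nat}. of_int (sign \<sigma>) * f (\<sigma> 0) (\<sigma> 1)) =
     f 0 1 - (f 1 0 :: 'a::comm_ring_1)"
proof -
  have *: "{..<2::nat} = insert 0 {1}" by auto
  show ?thesis
    unfolding *
    apply (subst sum_over_permutations_insert, simp, simp)
    unfolding permutes_sing
    by (simp add: sign_swap_id transpose_def)
qed

lemma sum_permutes_3:
  "(\<Sum>\<sigma> | \<sigma> permutes {..<3::nat}. of_int (sign \<sigma>) * f (\<sigma> 0) (\<sigma> 1) (\<sigma> 2)) =
     f 0 1 2 + f 1 2 0 + f 2 0 1 - f 0 2 1 - f 1 0 2 - (f 2 1 0 :: 'a::comm_ring_1)"
proof -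
  have *: "{..<3::nat} = insert 0 (insert 1 {2})" by auto
  show ?thesis
    unfolding *
    apply (subst sum_over_permutations_insert, simp, simp)
    apply (subst sum_over_permutations_insert, simp, simp)
    unfolding permutes_sing
    by (simp add: sign_swap_id permutation_swap_id sign_compose permutation_compose transpose_def)
qed

lemma sum_permutes_4:
  "(\<Sum>\<sigma> | \<sigma> permutes {..<4::nat}. of_int (sign \<sigma>) * f (\<sigma> 0) (\<sigma> 1) (\<sigma> 2) (\<sigma> 3)) =
     f 0 1 2 3 + f 0 2 3 1 + f 0 3 1 2 - f 0 1 3 2 - f 0 2 1 3 - f 0 3 2 1
   - (f 1 0 2 3 + f 1 2 3 0 + f 1 3 0 2 - f 1 0 3 2 - f 1 2 0 3 - f 1 3 2 0)
   + (f 2 0 1 3 + f 2 1 3 0 + f 2 3 0 1 - f 2 0 3 1 - f 2 1 0 3 - f 2 3 1 0)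
   - (f 3 0 1 2 + f 3 1 2 0 + f 3 2 0 1 - f 3 0 2 1 - f 3 1 0 2 - (f 3 2 1 0 :: 'a::comm_ring_1))"
proof -
  have *: "{..<4::nat} = insert 0 (insert 1 (insert 2 {3}))" by auto
  show ?thesis
    unfolding *
    apply (subst sum_over_permutations_insert, simp, simp)
    apply (subst sum_over_permutations_insert, simp, simp)
    apply (subst sum_over_permutations_insert, simp, simp)
    unfolding permutes_sing
    by (simp add: sign_swap_id permutation_swap_id sign_compose permutation_compose transpose_def)
qed

lemma wedge_1_0: "wedge 1 0 (covector a) (\<lambda>v. c) = covector (\<lambda>x. a x * c)"
proof -
  have *: "{..<1::nat} = {0}" by auto
  show ?thesis
    unfolding wedge_def covector_def by (simp add: * permutes_sing del: One_nat_def)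
qed

lemma wedge_1_1: "wedge 1 1 (\<lambda>v. a (v 0)) (\<lambda>v. b (v 0)) =
    (\<lambda>v. a (v 0) * b (v 1) - a (v 1) * b (v 0))"
proof
  fix v
  show "wedge 1 1 (\<lambda>v. a (v 0)) (\<lambda>v. b (v 0)) v = a (v 0) * b (v 1) - a (v 1) * b (v 0)"
    using sum_permutes_2[of "\<lambda>i j. a (v i) * b (v j)"]
    by (simp add: wedge_def mult.assoc numeral_2_eq_2)
qed

text \<open>The six terms of the permutation sum agree in pairs because F is antisymmetric; the
  factor 1/2! leaves one term for each of the three shuffles.\<close>

lemma wedge_1_2:
  assumes "\<And>x y. F x y = - F y x"
  shows "wedge 1 2 (\<lambda>v. a (v 0)) (\<lambda>v. F (v 0) (v 1)) =
    (\<lambda>v. a (v 0) * F (v 1) (v 2) - a (v 1) * F (v 0) (v 2) + a (v 2) * F (v 0) (v 1))"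
proof
  fix v
  show "wedge 1 2 (\<lambda>v. a (v 0)) (\<lambda>v. F (v 0) (v 1)) v =
     a (v 0) * F (v 1) (v 2) - a (v 1) * F (v 0) (v 2) + a (v 2) * F (v 0) (v 1)"
    using sum_permutes_3[of "\<lambda>i j k. a (v i) * F (v j) (v k)"]
      assms[of "v 2" "v 1"] assms[of "v 2" "v 0"] assms[of "v 1" "v 0"]
    by (simp add: wedge_def mult.assoc numeral_2_eq_2 numeral_3_eq_3 field_simps)
qed

lemma wedge_2_1:
  assumes "\<And>x y. F x y = - F y x"
  shows "wedge 2 1 (\<lambda>v. F (v 0) (v 1)) (\<lambda>v. a (v 0)) =
    (\<lambda>v. a (v 0) * F (v 1) (v 2) - a (v 1) * F (v 0) (v 2) + a (v 2) * F (v 0) (v 1))"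
proof
  fix v
  show "wedge 2 1 (\<lambda>v. F (v 0) (v 1)) (\<lambda>v. a (v 0)) v =
     a (v 0) * F (v 1) (v 2) - a (v 1) * F (v 0) (v 2) + a (v 2) * F (v 0) (v 1)"
    using sum_permutes_3[of "\<lambda>i j k. F (v i) (v j) * a (v k)"]
      assms[of "v 2" "v 1"] assms[of "v 2" "v 0"] assms[of "v 1" "v 0"]
    by (simp add: wedge_def mult.assoc numeral_2_eq_2 numeral_3_eq_3 field_simps)
qed

text \<open>Antisymmetry and the factor 1/(2! 2!) reduce the 24 terms to six shuffles. Both factors
  being the same form, these agree in pairs once more, whence the 2.\<close>

lemma wedge_2_2:
  assumes "\<And>x y. F x y = - F y x"
  shows "wedge 2 2 (\<lambda>v. F (v 0) (v 1)) (\<lambda>v. F (v 0) (v 1)) =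
    (\<lambda>v. 2 * (F (v 0) (v 1) * F (v 2) (v 3) - F (v 0) (v 2) * F (v 1) (v 3) + F (v 0) (v 3) * F (v 1) (v 2)))"
proof
  fix v
  have 4: "2 + 2 = (4::nat)" by auto
  show "wedge 2 2 (\<lambda>v. F (v 0) (v 1)) (\<lambda>v. F (v 0) (v 1)) v =
     2 * (F (v 0) (v 1) * F (v 2) (v 3) - F (v 0) (v 2) * F (v 1) (v 3) + F (v 0) (v 3) * F (v 1) (v 2))"
    using sum_permutes_4[of "\<lambda>i j k l. F (v i) (v j) * F (v k) (v l)"]
      assms[of "v 1" "v 0"] assms[of "v 2" "v 0"] assms[of "v 3" "v 0"] assms[of "v 2" "v 1"] assms[of "v 3" "v 1"] assms[of "v 3" "v 2"]
    by (simp add: wedge_def mult.assoc 4 fact_2 eval_nat_numeral field_simps)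
qed

section \<open>Three by three matrices\<close>

text \<open>The cyclic indices absorb the checkerboard signs. This is the untransposed cofactor
  matrix, so that it acts on cross products as in \<open>cross_fun_cofac\<close>.\<close>

definition cofac :: "(3 \<Rightarrow> 3 \<Rightarrow> 'a::comm_ring_1) \<Rightarrow> 3 \<Rightarrow> 3 \<Rightarrow> 'a" where
  "cofac P i j = P (i + 1) (j + 1) * P (i + 2) (j + 2) - P (i + 1) (j + 2) * P (i + 2) (j + 1)"

definition det_fun :: "(3 \<Rightarrow> 3 \<Rightarrow> 'a::comm_ring_1) \<Rightarrow> 'a" where
  "det_fun P = (\<Sum>j\<in>UNIV. P 1 j * cofac P 1 j)"

text \<open>The case n = 3 of adj(adj P) = det(P)^(n-2) P; the two missing transpositions cancel
  each other.\<close>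

lemma cofac_cofac: "cofac (cofac P) i j = det_fun P * P i j"
proof -
  have "\<forall>i j. cofac (cofac P) i j = det_fun P * P i j"
    by (simp add: forall_3 cofac_def det_fun_def sum_3) (simp add: algebra_simps)
  then show ?thesis by blast
qed

lemma det_fun_cofac: "det_fun (cofac P) = (det_fun P)\<^sup>2"
proof -
  have "det_fun (cofac P) = (\<Sum>j\<in>UNIV. cofac P 1 j * (det_fun P * P 1 j))"
    unfolding det_fun_def[of "cofac P"] by (simp add: cofac_cofac)
  also have "\<dots> = det_fun P * (\<Sum>j\<in>UNIV. P 1 j * cofac P 1 j)"
    by (simp add: sum_3 algebra_simps)
  finally show ?thesis by (simp add: det_fun_def power2_eq_square)
qed

lemma cofac_scale: "cofac (\<lambda>i j. c * P i j) i j = c\<^sup>2 * cofac P i j"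
  by (simp add: cofac_def algebra_simps power2_eq_square)

text \<open>Taking cofactors once more gives det(P) P = det(Q) Q, and the determinants have equal
  squares by \<open>det_fun_cofac\<close>. Dividing by det(P) leaves only a sign.\<close>

lemma cofac_inject_up_to_sign:
  fixes P Q :: "3 \<Rightarrow> 3 \<Rightarrow> 'a::field"
  assumes eq: "cofac P = cofac Q" and nz: "det_fun P \<noteq> 0"
  shows "P = Q \<or> P = (\<lambda>i j. - Q i j)"
proof -
  have *: "det_fun P * P i j = det_fun Q * Q i j" for i j
    using cofac_cofac[of P i j] cofac_cofac[of Q i j] eq by simp
  have "(det_fun P)\<^sup>2 = (det_fun Q)\<^sup>2"
    using det_fun_cofac[of P] det_fun_cofac[of Q] eq by simp
  then consider "det_fun Q = det_fun P" | "det_fun Q = - det_fun P"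
    by (metis power2_eq_iff)
  then show ?thesis
  proof cases
    case 1
    then have "P i j = Q i j" for i j using *[of i j] nz by simp
    then show ?thesis by blast
  next
    case 2
    then have "P i j = - Q i j" for i j
      using *[of i j] nz by (metis minus_mult_commute mult_cancel_left)
    then show ?thesis by blast
  qed
qed

definition hermitian_form :: "(3 \<Rightarrow> 3 \<Rightarrow> complex) \<Rightarrow> (3 \<Rightarrow> complex) \<Rightarrow> (3 \<Rightarrow> complex) \<Rightarrow> complex" where
  "hermitian_form P c d = (\<Sum>i\<in>UNIV. \<Sum>j\<in>UNIV. P i j * c i * cnj (d j))"

definition posdef :: "(3 \<Rightarrow> 3 \<Rightarrow> complex) \<Rightarrow> bool" where
  "posdef P \<longleftrightarrow> (\<forall>i j. P j i = cnj (P i j)) \<and> (\<forall>c. c \<noteq> (\<lambda>_. 0) \<longrightarrow> Re (hermitian_form P c c) > 0)"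

definition cross_fun :: "(3 \<Rightarrow> 'a::comm_ring_1) \<Rightarrow> (3 \<Rightarrow> 'a) \<Rightarrow> 3 \<Rightarrow> 'a" where
  "cross_fun c d i = c (i + 1) * d (i + 2) - c (i + 2) * d (i + 1)"

text \<open>Bivectors in dimension three are decomposable. The witnesses span the plane of all d
  with \<Sum> c i * d i = 0 (no conjugation), normalised by means of a nonzero coordinate of
  c.\<close>

lemma cross_fun_surj:
  fixes c :: "3 \<Rightarrow> 'a::field"
  shows "\<exists>d e. cross_fun d e = c"
proof -
  consider "c 3 \<noteq> 0" | "c 2 \<noteq> 0" | "c 1 \<noteq> 0" | "c = (\<lambda>_. 0)"
    by (metis (full_types) exhaust_3 ext)
  then show ?thesis
  proof cases
    case 1
    then show ?thesis
      by (intro exI[of _ "(\<lambda>_. 0)(1 := c 3, 3 := - c 1)"] exI[of _ "(\<lambda>_. 0)(2 := 1, 3 := - (c 2 / c 3))"])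
        (simp add: fun_eq_iff forall_3 cross_fun_def)
  next
    case 2
    then show ?thesis
      by (intro exI[of _ "(\<lambda>_. 0)(3 := c 2, 2 := - c 3)"] exI[of _ "(\<lambda>_. 0)(1 := 1, 2 := - (c 1 / c 2))"])
        (simp add: fun_eq_iff forall_3 cross_fun_def)
  next
    case 3
    then show ?thesis
      by (intro exI[of _ "(\<lambda>_. 0)(2 := c 1, 1 := - c 2)"] exI[of _ "(\<lambda>_. 0)(3 := 1, 1 := - (c 3 / c 1))"])
        (simp add: fun_eq_iff forall_3 cross_fun_def)
  next
    case 4
    then show ?thesis
      by (intro exI[of _ "(\<lambda>_. 0)"]) (simp add: fun_eq_iff cross_fun_def)
  qed
qed

text \<open>The two by two minors of P are the entries of its second exterior power; this is its
  functoriality, or the Cauchy-Binet formula for the matrix with columns c and d.\<close>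

lemma cross_fun_cofac:
  "cross_fun (\<lambda>i. \<Sum>j\<in>UNIV. P i j * c j) (\<lambda>i. \<Sum>j\<in>UNIV. P i j * d j) i =
     (\<Sum>j\<in>UNIV. cofac P i j * cross_fun c d j)"
  by (simp add: cross_fun_def cofac_def sum_3) (simp add: algebra_simps)

lemma lagrange_cross_fun:
  "(\<Sum>i\<in>UNIV. cross_fun c d i * cross_fun p q i) =
     (\<Sum>i\<in>UNIV. c i * p i) * (\<Sum>i\<in>UNIV. d i * q i) - (\<Sum>i\<in>UNIV. c i * q i) * (\<Sum>i\<in>UNIV. d i * p i)"
  by (simp add: cross_fun_def sum_3) (simp add: algebra_simps)

text \<open>Applying P to the conjugate of the second argument, which is q, turns the Hermitian form
  into a bilinear pairing, to which the bilinear Lagrange identity applies.\<close>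

lemma hermitian_form_cofac_cross:
  "hermitian_form (cofac P) (cross_fun c d) (cross_fun c d) =
     hermitian_form P c c * hermitian_form P d d - hermitian_form P c d * hermitian_form P d c"
proof -
  define q where "q = (\<lambda>d i. \<Sum>j\<in>UNIV. P i j * cnj (d j))"
  have form: "hermitian_form P c d = (\<Sum>i\<in>UNIV. c i * q d i)" for c d
    by (simp add: hermitian_form_def q_def sum_distrib_left mult_ac)
  have "cnj (cross_fun c d j) = cross_fun (\<lambda>i. cnj (c i)) (\<lambda>i. cnj (d i)) j" for j
    by (simp add: cross_fun_def)
  then have "hermitian_form (cofac P) (cross_fun c d) (cross_fun c d) =
      (\<Sum>i\<in>UNIV. cross_fun c d i * cross_fun (q c) (q d) i)"
    unfolding q_def cross_fun_cofac
    by (simp add: hermitian_form_def sum_distrib_left mult_ac)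
  then show ?thesis by (simp add: lagrange_cross_fun form)
qed

lemma hermitian_form_cnj:
  assumes "\<And>i j. P j i = cnj (P i j)"
  shows "cnj (hermitian_form P c d) = hermitian_form P d c"
  unfolding hermitian_form_def
  by (subst sum.swap) (simp add: assms[symmetric] mult.commute mult.left_commute)

lemma hermitian_form_combine:
  "hermitian_form P (\<lambda>i. s * d i - t * c i) (\<lambda>i. s * d i - t * c i) =
    s * cnj s * hermitian_form P d d - s * cnj t * hermitian_form P d c
    - t * cnj s * hermitian_form P c d + t * cnj t * hermitian_form P c c"
  by (simp add: hermitian_form_def sum_3) (simp add: algebra_simps)

text \<open>On a cross product of c and d the form of the cofactor matrix is the Gram determinant of c and d,
  which is positive by the strict Cauchy-Schwarz inequality.\<close>

lemma posdef_cofac: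
  assumes "posdef P"
  shows "posdef (cofac P)"
proof -
  have herm: "P j i = cnj (P i j)" for i j using assms unfolding posdef_def by blast
  have pos: "Re (hermitian_form P c c) > 0" if "c \<noteq> (\<lambda>_. 0)" for c
    using assms that unfolding posdef_def by blast
  have real: "Im (hermitian_form P c c) = 0" for c
    using arg_cong[OF hermitian_form_cnj[of P c c, OF herm], of Im] by simp
  have "Re (hermitian_form (cofac P) v v) > 0" if "v \<noteq> (\<lambda>_. 0)" for v
  proof -
    obtain c d where v: "v = cross_fun c d" using cross_fun_surj[of v] by metis
    have c: "c \<noteq> (\<lambda>_. 0)" using that v by (auto simp: cross_fun_def)
    define s t where "s = hermitian_form P c c" and "t = hermitian_form P d c"
    have t': "cnj t = hermitian_form P c d" unfolding t_def by (rule hermitian_form_cnj[of P d c, OF herm])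
    have s: "Im s = 0" "Re s > 0" using real pos[OF c] by (auto simp: s_def)
    then have s': "cnj s = s" by (simp add: complex_eq_iff)
    \<comment> \<open>One Gram-Schmidt step without division: u is s times the component of d
      orthogonal to c, so its value is s times the Gram determinant of c and d.\<close>
    define u where "u = (\<lambda>i. s * d i - t * c i)"
    have "u \<noteq> (\<lambda>_. 0)"
    proof
      assume "u = (\<lambda>_. 0)"
      then have 0: "s * d i = t * c i" for i by (metis (no_types) eq_iff_diff_eq_0 u_def)
      have "s * v i = 0" for i
      proof -
        have "s * v i = c (i + 1) * (s * d (i + 2)) - c (i + 2) * (s * d (i + 1))"
          by (simp add: v cross_fun_def algebra_simps)
        then show ?thesis by (simp add: 0)
      qed
      moreover have "s \<noteq> 0" using s by auto
      ultimately show False using that by auto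
    qed
    then have "Re (hermitian_form P u u) > 0" by (rule pos)
    also have "hermitian_form P u u = s * (hermitian_form P d d * s - t * cnj t)"
      unfolding u_def hermitian_form_combine t'[symmetric] s' t_def[symmetric] s_def[symmetric]
      by (simp add: algebra_simps)
    also have "hermitian_form P d d * s - t * cnj t = hermitian_form (cofac P) v v"
      unfolding v hermitian_form_cofac_cross t'[symmetric] t_def[symmetric] s_def[symmetric]
      by (simp add: algebra_simps)
    finally show ?thesis using s by (simp add: zero_less_mult_iff)
  qed
  moreover have "cofac P j i = cnj (cofac P i j)" for i j
    by (simp add: cofac_def herm[symmetric] mult.commute)
  ultimately show ?thesis unfolding posdef_def by blast
qed

text \<open>No eigenvalues are used: \<open>cofac\<close> preserves positivity, and applying it
  twice multiplies P by its determinant. Comparing the entries at (1, 1), which are real and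
  positive for both matrices, gives the sign.\<close>

lemma posdef_det:
  assumes "posdef P"
  shows "Im (det_fun P) = 0" "Re (det_fun P) > 0"
proof -
  define c :: "3 \<Rightarrow> complex" where "c = (\<lambda>i. if i = 1 then 1 else 0)"
  have c: "c \<noteq> (\<lambda>_. 0)" unfolding c_def fun_eq_iff by auto
  have diag: "Re (Q 1 1) > 0 \<and> Im (Q 1 1) = 0" if "posdef Q" for Q
  proof -
    have "hermitian_form Q c c = Q 1 1" by (simp add: hermitian_form_def c_def sum_3)
    moreover have "Q 1 1 = cnj (Q 1 1)" using that unfolding posdef_def by blast
    then have "Im (Q 1 1) = - Im (Q 1 1)" by (metis cnj.simps(2))
    moreover have "Re (hermitian_form Q c c) > 0" using that c unfolding posdef_def by blast
    ultimately show ?thesis by simp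
  qed
  have "Re (det_fun P * P 1 1) > 0 \<and> Im (det_fun P * P 1 1) = 0"
    using diag[OF posdef_cofac[OF posdef_cofac[OF assms]]] by (simp add: cofac_cofac)
  then show "Re (det_fun P) > 0" "Im (det_fun P) = 0"
    using diag[OF assms] by (auto simp: zero_less_mult_iff)
qed

lemma posdef_eq_cofac:
  assumes "posdef P"
  obtains Q where "posdef Q" "cofac Q = P"
proof
  \<comment> \<open>\<open>cofac\<close> is quadratic, so the cofactor matrix of k times
    \<open>cofac P\<close> is k^2 det(P) P; this forces the value of k.\<close>
  define k where "k = 1 / sqrt (Re (det_fun P))"
  define Q where "Q = (\<lambda>i j. of_real k * cofac P i j)"
  note d = posdef_det[OF assms]
  have det: "det_fun P = of_real (Re (det_fun P))" using d by (simp add: complex_eq_iff)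
  have k: "k > 0" "k\<^sup>2 = 1 / Re (det_fun P)" using d by (auto simp: k_def power_divide)
  show "cofac Q = P"
  proof (intro ext)
    fix i j
    have "cofac Q i j = of_real (k\<^sup>2) * (of_real (Re (det_fun P)) * P i j)"
      unfolding Q_def cofac_scale cofac_cofac by (subst det) (simp add: mult.assoc)
    then show "cofac Q i j = P i j" using d(2) by (simp add: k)
  qed
  have *: "hermitian_form Q c c = of_real k * hermitian_form (cofac P) c c" for c
    by (simp add: hermitian_form_def Q_def sum_distrib_left mult.assoc)
  have "\<forall>i j. cofac P j i = cnj (cofac P i j)" using posdef_cofac[OF assms] unfolding posdef_def by blast
  then have "\<forall>i j. Q j i = cnj (Q i j)" unfolding Q_def by (metis complex_cnj_complex_of_real complex_cnj_mult)
  moreover have "\<forall>c. c \<noteq> (\<lambda>_. 0) \<longrightarrow> Re (hermitian_form Q c c) > 0"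
    using conjunct2[OF posdef_cofac[OF assms, unfolded posdef_def]] k(1) by (simp add: *)
  ultimately show "posdef Q" unfolding posdef_def by blast
qed

section \<open>Complex frames\<close>

text \<open>In the normalisation of \<open>wedge\<close> this is the product of the three covectors
  of a, and \<open>minor a i\<close> below is the product of the two covectors that follow a i in
  cyclic order.\<close>

definition det3 :: "(3 \<Rightarrow> V \<Rightarrow> complex) \<Rightarrow> V \<Rightarrow> V \<Rightarrow> V \<Rightarrow> complex" where
  "det3 a x y z = (\<Sum>i\<in>UNIV. a i x * cross_fun (\<lambda>i. a i y) (\<lambda>i. a i z) i)"

definition minor :: "(3 \<Rightarrow> V \<Rightarrow> complex) \<Rightarrow> 3 \<Rightarrow> V \<Rightarrow> V \<Rightarrow> complex" where
  "minor a i x y = cross_fun (\<lambda>i. a i x) (\<lambda>i. a i y) i"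

lemma det3_code: "det3 a x y z = a 1 x * (a 2 y * a 3 z - a 3 y * a 2 z)
   + a 2 x * (a 3 y * a 1 z - a 1 y * a 3 z) + a 3 x * (a 1 y * a 2 z - a 2 y * a 1 z)"
  by (simp add: det3_def cross_fun_def sum_3)

text \<open>The dual vectors e are part of the data because coefficients of forms are read off by
  inserting them. Through \<open>expand\<close> they generate V over the complex numbers, which
  replaces dimension counts in what follows.\<close>

locale complex_frame =
  fixes J :: "V \<Rightarrow> V" and a :: "3 \<Rightarrow> V \<Rightarrow> complex" and e :: "3 \<Rightarrow> V"
  assumes complex_structure: "complex_structure J"
    and covector10: "covector10 J (a i)"
    and dual: "a i (e j) = (if i = j then 1 else 0)"
    and expand: "x = (\<Sum>i\<in>UNIV. Re (a i x) *\<^sub>R e i + Im (a i x) *\<^sub>R J (e i))"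
begin

lemma linear_J: "linear J" and J_J [simp]: "J (J x) = - x"
  using complex_structure by (auto simp: complex_structure_def)

lemma linear_a: "linear (a i)" and a_J [simp]: "a i (J x) = \<i> * a i x"
  using covector10 by (auto simp: covector10_def)

lemmas J_simps [simp] = linear_add[OF linear_J] linear_scale[OF linear_J] linear_neg[OF linear_J] linear_diff[OF linear_J]
lemmas a_simps [simp] = linear_add[OF linear_a] linear_scale[OF linear_a] linear_neg[OF linear_a] linear_diff[OF linear_a]

lemma linear_expand:
  assumes "linear F" "\<And>x. F (J x) = \<i> * F x"
  shows "F x = (\<Sum>i\<in>UNIV. a i x * F (e i))"
proof -
  have "F x = (\<Sum>i\<in>UNIV. Re (a i x) *\<^sub>R F (e i) + Im (a i x) *\<^sub>R (\<i> * F (e i)))"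
    by (subst expand) (simp add: linear_sum[OF assms(1)] linear_add[OF assms(1)] linear_scale[OF assms(1)] assms(2))
  also have "\<dots> = (\<Sum>i\<in>UNIV. a i x * F (e i))"
    by (intro sum.cong) (auto simp: complex_eq_iff)
  finally show ?thesis .
qed

lemma antilinear_expand:
  assumes "linear F" "\<And>x. F (J x) = - \<i> * F x"
  shows "F x = (\<Sum>i\<in>UNIV. cnj (a i x) * F (e i))"
proof -
  have "cnj (F x) = (\<Sum>i\<in>UNIV. a i x * cnj (F (e i)))"
  proof (rule linear_expand)
    show "linear (\<lambda>x. cnj (F x))"
      using assms(1) by (simp add: linear_iff)
  qed (simp add: assms(2))
  then have "cnj (cnj (F x)) = cnj (\<Sum>i\<in>UNIV. a i x * cnj (F (e i)))" by simp
  then show ?thesis by simp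
qed

definition point :: "(3 \<Rightarrow> complex) \<Rightarrow> V" where
  "point c = (\<Sum>i\<in>UNIV. Re (c i) *\<^sub>R e i + Im (c i) *\<^sub>R J (e i))"

lemma a_point [simp]: "a i (point c) = c i"
proof -
  have "a i (point c) = (\<Sum>j\<in>UNIV. if i = j then c j else 0)"
    unfolding point_def linear_sum[OF linear_a] a_simps a_J dual
    by (intro sum.cong) (auto simp: complex_eq_iff)
  then show ?thesis by simp
qed

lemma point_a: "point (\<lambda>i. a i x) = x"
  unfolding point_def by (rule expand[symmetric])

lemma eqI:
  assumes "\<And>i. a i x = a i y"
  shows "x = y"
proof -
  have "(\<lambda>i. a i x) = (\<lambda>i. a i y)" using assms by blast
  then show ?thesis using point_a by metis
qed

lemma a_0 [simp]: "a i 0 = 0"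
  using linear_0[OF linear_a] .

lemma eq_0: "(\<And>i. a i x = 0) \<Longrightarrow> x = 0"
  by (rule eqI) simp

lemma cross_surj: "\<exists>x y. (\<lambda>i. minor a i x y) = c"
proof -
  obtain d e where "cross_fun d e = c" using cross_fun_surj by blast
  then show ?thesis
    by (intro exI[of _ "point d"] exI[of _ "point e"]) (auto simp: minor_def)
qed

lemma minor_e: "minor a i (e (k + 1)) (e (k + 2)) = (if i = k then 1 else 0)"
proof -
  have "\<forall>i k. minor a i (e (k + 1)) (e (k + 2)) = (if i = k then 1 else 0)"
    by (simp add: forall_3 minor_def cross_fun_def dual)
  then show ?thesis by blast
qed

lemma det3_e: "det3 a (e 1) (e 2) (e 3) = 1"
  by (simp add: det3_code dual)

end

text \<open>Regard a as a real linear map to C^3. A vector orthogonal to its range gives a real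
  relation, and testing it at x and at J x makes it a complex relation among the covectors; hence a
  is onto, and e consists of preimages of the unit vectors.\<close>

lemma complex_frameI:
  assumes J: "complex_structure J" and a: "\<And>i. covector10 J (a i)"
    and indep: "\<And>c. (\<And>x. (\<Sum>i\<in>UNIV. c i * a i x) = 0) \<Longrightarrow> c = (\<lambda>_. 0)"
  obtains e where "complex_frame J a e"
proof -
  have lJ: "linear J" and JJ: "\<And>x. J (J x) = - x" using J by (auto simp: complex_structure_def)
  have la: "\<And>i. linear (a i)" and aJ: "\<And>i x. a i (J x) = \<i> * a i x"
    using a by (auto simp: covector10_def)
  define f :: "V \<Rightarrow> complex^3" where "f = (\<lambda>x. \<chi> i. a i x)"
  have lf: "linear f"
    using la by (auto simp: f_def linear_iff vec_eq_iff)
  have "y = 0" if "y \<in> (range f)\<^sup>\<bottom>" for y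
  proof -
    have *: "inner (f x) y = Re (\<Sum>i\<in>UNIV. cnj (y $ i) * a i x)" for x
      by (simp add: inner_vec_def f_def inner_complex_def mult.commute)
    have 0: "inner (f x) y = 0" for x
      using that by (auto simp: orthogonal_comp_def orthogonal_def inner_commute)
    have "(\<Sum>i\<in>UNIV. cnj (y $ i) * a i x) = 0" for x
    proof -
      have "(\<Sum>i\<in>UNIV. cnj (y $ i) * a i (J x)) = \<i> * (\<Sum>i\<in>UNIV. cnj (y $ i) * a i x)"
        by (simp add: aJ sum_distrib_left mult.left_commute)
      then show ?thesis using 0[of x] 0[of "J x"] unfolding * by (simp add: complex_eq_iff)
    qed
    then have "(\<lambda>i. cnj (y $ i)) = (\<lambda>_. 0)" by (rule indep)
    then show ?thesis by (simp add: vec_eq_iff fun_eq_iff)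
  qed
  then have "(range f)\<^sup>\<bottom> = {0}"
    by (auto simp: orthogonal_comp_def orthogonal_def)
  then have "surj f"
    using orthogonal_comp_self[of "range f"] linear_subspace_image[OF lf subspace_UNIV]
    by (metis orthogonal_comp_null)
  \<comment> \<open>Source and target both have real dimension six.\<close>
  have "inj f"
    by (rule linear_surjective_imp_injective[OF lf \<open>surj f\<close>]) simp
  define e where "e = (\<lambda>j. inv f (axis j 1))"
  have fe: "a i (e j) = (if i = j then 1 else 0)" for i j
  proof -
    have "f (e j) $ i = axis j 1 $ i" unfolding e_def using \<open>surj f\<close> by (simp add: surj_f_inv_f)
    then show ?thesis by (auto simp: f_def axis_def)
  qed
  have "x = (\<Sum>i\<in>UNIV. Re (a i x) *\<^sub>R e i + Im (a i x) *\<^sub>R J (e i))" for x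
  proof -
    have "a k (\<Sum>i\<in>UNIV. Re (a i x) *\<^sub>R e i + Im (a i x) *\<^sub>R J (e i)) = a k x" for k
    proof -
      have "a k (\<Sum>i\<in>UNIV. Re (a i x) *\<^sub>R e i + Im (a i x) *\<^sub>R J (e i)) =
         (\<Sum>i\<in>UNIV. if k = i then a i x else 0)"
        unfolding linear_sum[OF la] linear_add[OF la] linear_scale[OF la] aJ fe
        by (intro sum.cong) (auto simp: complex_eq_iff)
      then show ?thesis by simp
    qed
    then have "f (\<Sum>i\<in>UNIV. Re (a i x) *\<^sub>R e i + Im (a i x) *\<^sub>R J (e i)) = f x"
      by (simp add: f_def)
    from injD[OF \<open>inj f\<close> this] show ?thesis by (rule sym)
  qed
  then have "complex_frame J a e"
    using J a fe by unfold_locales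
  then show ?thesis by (rule that)
qed

lemma coframe_complex_frame:
  assumes "complex_structure J" "coframe J \<alpha>"
  obtains a e where "complex_frame J a e" "\<And>i. \<alpha> i = covector (a i)"
proof -
  obtain a where a: "\<And>i. covector10 J (a i)" "\<And>i. \<alpha> i = covector (a i)"
    using assms(2) unfolding coframe_def by metis
  have "c = (\<lambda>_. 0)" if "\<And>x. (\<Sum>i\<in>UNIV. c i * a i x) = 0" for c
  proof -
    have "\<forall>v. (\<Sum>i\<in>UNIV. c i * \<alpha> i v) = 0" using that by (simp add: a(2) covector_def)
    then show ?thesis using assms(2) unfolding coframe_def by blast
  qed
  with a show ?thesis using complex_frameI[OF assms(1)] that by metis
qed

section \<open>Forms of given type\<close>

lemma covector10_scale: "covector10 J a \<Longrightarrow> covector10 J (\<lambda>x. k * a x)"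
  by (auto simp: covector10_def linear_iff algebra_simps)

text \<open>The inversion lemmas keep the degrees as variables with side equations, so that rule
  induction applies; in positive degree, the wedge cases appeal to the inversion lemma of the factor
  of one degree less.\<close>

lemma of_type_00: "of_type J p q \<omega> \<Longrightarrow> p = 0 \<Longrightarrow> q = 0 \<Longrightarrow> \<exists>c. \<omega> = (\<lambda>v. c)"
  by (induction rule: of_type.induct) auto

lemma of_type_10: "of_type J p q \<omega> \<Longrightarrow> p = 1 \<Longrightarrow> q = 0 \<Longrightarrow> \<exists>a. covector10 J a \<and> \<omega> = covector a"
proof (induction rule: of_type.induct)
  case (add p q \<omega> \<omega>')
  then obtain a b where "covector10 J a" "covector10 J b" "\<omega> = covector a" "\<omega>' = covector b" by auto
  then have "covector10 J (\<lambda>x. a x + b x)" "(\<lambda>v. \<omega> v + \<omega>' v) = covector (\<lambda>x. a x + b x)"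
    by (auto simp: covector10_def covector_def linear_iff algebra_simps)
  then show ?case by blast
next
  case (wedge10 a p q \<omega>)
  then obtain c where "\<omega> = (\<lambda>v. c)" using of_type_00[of J 0 0 \<omega>] by auto
  then have "wedge 1 (p + q) (covector a) \<omega> = covector (\<lambda>x. a x * c)"
    using wedge10 wedge_1_0[of a c] by simp
  then show ?case using covector10_scale[OF wedge10(1), of c] by (auto simp: mult.commute)
qed simp_all

lemma of_type_01: "of_type J p q \<omega> \<Longrightarrow> p = 0 \<Longrightarrow> q = 1 \<Longrightarrow>
    \<exists>a. covector10 J a \<and> \<omega> = covector (\<lambda>x. cnj (a x))"
proof (induction rule: of_type.induct)
  case (add p q \<omega> \<omega>')
  then obtain a b where "covector10 J a" "covector10 J b" "\<omega> = covector (\<lambda>x. cnj (a x))" "\<omega>' = covector (\<lambda>x. cnj (b x))" by auto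
  then have "covector10 J (\<lambda>x. a x + b x)" "(\<lambda>v. \<omega> v + \<omega>' v) = covector (\<lambda>x. cnj (a x + b x))"
    by (auto simp: covector10_def covector_def linear_iff algebra_simps)
  then show ?case by blast
next
  case (wedge01 a p q \<omega>)
  then obtain c where "\<omega> = (\<lambda>v. c)" using of_type_00[of J 0 0 \<omega>] by auto
  then have "wedge 1 (p + q) (covector (\<lambda>v. cnj (a v))) \<omega> = covector (\<lambda>x. cnj (cnj c * a x))"
    using wedge01 wedge_1_0[of "\<lambda>x. cnj (a x)" c] by (simp add: mult.commute)
  with covector10_scale[OF wedge01(1), of "cnj c"] show ?case by blast
next
  case (scalar c)
  from scalar(2) show ?case by (rule zero_neq_one[THEN notE])
next
  case (wedge10 a p q \<omega>)
  from wedge10(4) show ?case by (rule Suc_neq_Zero)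
qed

text \<open>Two-forms are handled as curried functions, so that linearity in a slot can be stated
  without updating a sequence.\<close>

definition alternating2 :: "(V \<Rightarrow> V \<Rightarrow> 'a::real_normed_vector) \<Rightarrow> bool" where
  "alternating2 F \<longleftrightarrow> bilinear F \<and> (\<forall>x. F x x = 0)"

lemma alternating2_commute:
  assumes "alternating2 F"
  shows "F x y = - F y x"
proof -
  have F: "bilinear F" "\<And>x. F x x = 0" using assms by (auto simp: alternating2_def)
  show ?thesis
    using F(2)[of "x + y"] F(2)[of x] F(2)[of y]
    by (simp add: bilinear_ladd[OF F(1)] bilinear_radd[OF F(1)] eq_neg_iff_add_eq_0 add.commute)
qed

lemma alternating2_add: "alternating2 F \<Longrightarrow> alternating2 G \<Longrightarrow> alternating2 (\<lambda>x y. F x y + G x y)"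
  by (auto simp: alternating2_def bilinear_def linear_iff scaleR_add_right)

lemma alternating2_wedge:
  fixes a b :: "V \<Rightarrow> complex"
  assumes "linear a" "linear b"
  shows "alternating2 (\<lambda>x y. a x * b y - a y * b x)"
  using assms by (auto simp: alternating2_def bilinear_def linear_iff algebra_simps)

lemma linear_cnj_comp: "linear a \<Longrightarrow> linear (\<lambda>x. cnj (a x))"
  by (simp add: linear_iff)

lemma wedge_covector: "wedge 1 1 (covector a) (covector b) = (\<lambda>v. a (v 0) * b (v 1) - a (v 1) * b (v 0))"
  unfolding covector_def by (rule wedge_1_1)

lemma of_type_20: "of_type J p q \<omega> \<Longrightarrow> p = 2 \<Longrightarrow> q = 0 \<Longrightarrow>
    \<exists>F. alternating2 F \<and> (\<forall>x y. F (J x) y = \<i> * F x y) \<and> \<omega> = (\<lambda>v. F (v 0) (v 1))"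
proof (induction rule: of_type.induct)
  case (add p q \<omega> \<omega>')
  then obtain F G where "alternating2 F" "\<forall>x y. F (J x) y = \<i> * F x y" "\<omega> = (\<lambda>v. F (v 0) (v 1))"
    "alternating2 G" "\<forall>x y. G (J x) y = \<i> * G x y" "\<omega>' = (\<lambda>v. G (v 0) (v 1))" by auto
  then show ?case by (intro exI[of _ "\<lambda>x y. F x y + G x y"]) (auto intro: alternating2_add simp: algebra_simps)
next
  case (wedge10 a p q \<omega>)
  then obtain b where b: "\<omega> = covector b" "covector10 J b" using of_type_10[of J p q \<omega>] by auto
  with wedge10 have "p + q = 1" by simp
  with b have "wedge 1 (p + q) (covector a) \<omega> = (\<lambda>v. a (v 0) * b (v 1) - a (v 1) * b (v 0))"
    by (simp only: wedge_covector)
  with b wedge10(1) show ?case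
    by (intro exI[of _ "\<lambda>x y. a x * b y - a y * b x"])
      (auto simp: covector10_def algebra_simps intro!: alternating2_wedge)
qed simp_all

lemma of_type_02: "of_type J p q \<omega> \<Longrightarrow> p = 0 \<Longrightarrow> q = 2 \<Longrightarrow>
    \<exists>F. alternating2 F \<and> (\<forall>x y. F (J x) y = - \<i> * F x y) \<and> \<omega> = (\<lambda>v. F (v 0) (v 1))"
proof (induction rule: of_type.induct)
  case (add p q \<omega> \<omega>')
  then obtain F G where "alternating2 F" "\<forall>x y. F (J x) y = - \<i> * F x y" "\<omega> = (\<lambda>v. F (v 0) (v 1))"
    "alternating2 G" "\<forall>x y. G (J x) y = - \<i> * G x y" "\<omega>' = (\<lambda>v. G (v 0) (v 1))" by auto
  then show ?case by (intro exI[of _ "\<lambda>x y. F x y + G x y"]) (auto intro: alternating2_add simp: algebra_simps)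
next
  case (wedge01 a p q \<omega>)
  then obtain b where b: "\<omega> = covector (\<lambda>x. cnj (b x))" "covector10 J b" using of_type_01[of J p q \<omega>] by auto
  with wedge01 have "p + q = 1" by simp
  with b have "wedge 1 (p + q) (covector (\<lambda>x. cnj (a x))) \<omega> =
      (\<lambda>v. cnj (a (v 0)) * cnj (b (v 1)) - cnj (a (v 1)) * cnj (b (v 0)))"
    by (simp only: wedge_covector)
  with b wedge01(1) show ?case
    by (intro exI[of _ "\<lambda>x y. cnj (a x) * cnj (b y) - cnj (a y) * cnj (b x)"])
      (auto simp: covector10_def algebra_simps intro!: alternating2_wedge linear_cnj_comp)
qed simp_all

lemma i_times_i_times: "\<i> * x * (\<i> * y) = - (x * y)"
  by (simp add: algebra_simps)

lemma of_type_11: "of_type J p q \<omega> \<Longrightarrow> p = 1 \<Longrightarrow> q = 1 \<Longrightarrow>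
    \<exists>F. alternating2 F \<and> (\<forall>x y. F (J x) (J y) = F x y) \<and> \<omega> = (\<lambda>v. F (v 0) (v 1))"
proof (induction rule: of_type.induct)
  case (add p q \<omega> \<omega>')
  then obtain F G where "alternating2 F" "\<forall>x y. F (J x) (J y) = F x y" "\<omega> = (\<lambda>v. F (v 0) (v 1))"
    "alternating2 G" "\<forall>x y. G (J x) (J y) = G x y" "\<omega>' = (\<lambda>v. G (v 0) (v 1))" by auto
  then show ?case by (intro exI[of _ "\<lambda>x y. F x y + G x y"]) (auto intro: alternating2_add simp: algebra_simps)
next
  case (wedge01 a p q \<omega>)
  then obtain b where b: "\<omega> = covector b" "covector10 J b" using of_type_10[of J p q \<omega>] by auto
  with wedge01 have "p + q = 1" by simp
  with b have "wedge 1 (p + q) (covector (\<lambda>x. cnj (a x))) \<omega> =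
      (\<lambda>v. cnj (a (v 0)) * b (v 1) - cnj (a (v 1)) * b (v 0))"
    by (simp only: wedge_covector)
  moreover have "alternating2 (\<lambda>x y. cnj (a x) * b y - cnj (a y) * b x)"
    using b wedge01(1) by (intro alternating2_wedge linear_cnj_comp) (auto simp: covector10_def)
  ultimately show ?case using b wedge01(1)
    by (intro exI[of _ "\<lambda>x y. cnj (a x) * b y - cnj (a y) * b x"]) (auto simp: covector10_def i_times_i_times)
next
  case (wedge10 a p q \<omega>)
  then obtain b where b: "\<omega> = covector (\<lambda>x. cnj (b x))" "covector10 J b" using of_type_01[of J p q \<omega>] by auto
  with wedge10 have "p + q = 1" by simp
  with b have "wedge 1 (p + q) (covector a) \<omega> =
      (\<lambda>v. a (v 0) * cnj (b (v 1)) - a (v 1) * cnj (b (v 0)))"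
    by (simp only: wedge_covector)
  moreover have "alternating2 (\<lambda>x y. a x * cnj (b y) - a y * cnj (b x))"
    using b wedge10(1) by (intro alternating2_wedge linear_cnj_comp) (auto simp: covector10_def)
  ultimately show ?case using b wedge10(1)
    by (intro exI[of _ "\<lambda>x y. a x * cnj (b y) - a y * cnj (b x)"]) (auto simp: covector10_def i_times_i_times)
next
  case (scalar c)
  from scalar(2) show ?case by (rule zero_neq_one[THEN notE])
qed

text \<open>The two properties kept here are those that pin down the complex structure in
  \<open>associated_Re_det3_unique\<close>. The second one holds because the form is alternating and
  complex linear in each slot.\<close>

lemma of_type_30: "of_type J p q \<omega> \<Longrightarrow> p = 3 \<Longrightarrow> q = 0 \<Longrightarrow>
    \<exists>F. (\<forall>x y z. F (J x) y z = \<i> * F x y z) \<and> (\<forall>x z. F x (J x) z = 0) \<and>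
      \<omega> = (\<lambda>v. F (v 0) (v 1) (v 2))"
proof (induction rule: of_type.induct)
  case (add p q \<omega> \<omega>')
  then obtain F G where "\<forall>x y z. F (J x) y z = \<i> * F x y z" "\<forall>x z. F x (J x) z = 0"
     "\<omega> = (\<lambda>v. F (v 0) (v 1) (v 2))"
    "\<forall>x y z. G (J x) y z = \<i> * G x y z" "\<forall>x z. G x (J x) z = 0" "\<omega>' = (\<lambda>v. G (v 0) (v 1) (v 2))"
    by auto
  then show ?case
    by (intro exI[of _ "\<lambda>x y z. F x y z + G x y z"])
      (auto simp: distrib_left)
next
  case (wedge10 a p q \<omega>)
  then obtain F where F: "alternating2 F" "\<forall>x y. F (J x) y = \<i> * F x y" "\<omega> = (\<lambda>v. F (v 0) (v 1))"
    using of_type_20[of J p q \<omega>] by auto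
  note anti = alternating2_commute[OF F(1)]
  have J: "F x (J x) = 0" for x
    using F(2) anti[of x "J x"] F(1) by (simp add: alternating2_def)
  have "p + q = 2" using wedge10 by simp
  then have "wedge 1 (p + q) (covector a) \<omega> = (\<lambda>v. a (v 0) * F (v 1) (v 2) - a (v 1) * F (v 0) (v 2) + a (v 2) * F (v 0) (v 1))"
    using wedge_1_2[of F a] anti F(3) unfolding covector_def by metis
  moreover have "a (J x) * F y z - a y * F (J x) z + a z * F (J x) y =
      \<i> * (a x * F y z - a y * F x z + a z * F x y)" for x y z
    using F(2) wedge10(1) by (simp add: covector10_def algebra_simps)
  moreover have "a x * F (J x) z - a (J x) * F x z + a z * F x (J x) = 0" for x z
    using F(2) J wedge10(1) by (simp add: covector10_def)
  ultimately show ?case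
    by (intro exI[of _ "\<lambda>x y z. a x * F y z - a y * F x z + a z * F x y"]) auto
qed simp_all

lemma of_type_20I: "covector10 J a \<Longrightarrow> covector10 J b \<Longrightarrow>
    of_type J 2 0 (\<lambda>v. a (v 0) * b (v 1) - a (v 1) * b (v 0))"
  using of_type.wedge10[OF _ of_type.wedge10[OF _ of_type.scalar[of _ 1]], of J a b]
  by (simp add: wedge_1_0[unfolded One_nat_def] wedge_covector[unfolded One_nat_def] numeral_2_eq_2)

lemma of_type_11I: "covector10 J a \<Longrightarrow> covector10 J b \<Longrightarrow>
    of_type J 1 1 (\<lambda>v. a (v 0) * cnj (b (v 1)) - a (v 1) * cnj (b (v 0)))"
  using of_type.wedge10[OF _ of_type.wedge01[OF _ of_type.scalar[of _ 1]], of J a b]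
  by (simp add: wedge_1_0[unfolded One_nat_def] wedge_covector[unfolded One_nat_def])

lemma of_type_02I: "covector10 J a \<Longrightarrow> covector10 J b \<Longrightarrow>
    of_type J 0 2 (\<lambda>v. cnj (a (v 0)) * cnj (b (v 1)) - cnj (a (v 1)) * cnj (b (v 0)))"
  using of_type.wedge01[OF _ of_type.wedge01[OF _ of_type.scalar[of _ 1]], of J a b]
  by (simp add: wedge_1_0[unfolded One_nat_def] wedge_covector[unfolded One_nat_def] numeral_2_eq_2)

lemma of_type_30I:
  assumes "\<And>i. covector10 J (a i)"
  shows "of_type J 3 0 (\<lambda>v. det3 a (v 0) (v 1) (v 2))"
proof -
  define F where "F = (\<lambda>x y. a 2 x * a 3 y - a 2 y * a 3 x)"
  have "F x y = - F y x" for x y by (simp add: F_def)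
  then have "wedge 1 2 (covector (a 1)) (\<lambda>v. F (v 0) (v 1)) =
      (\<lambda>v. a 1 (v 0) * F (v 1) (v 2) - a 1 (v 1) * F (v 0) (v 2) + a 1 (v 2) * F (v 0) (v 1))"
    unfolding covector_def by (rule wedge_1_2)
  also have "\<dots> = (\<lambda>v. det3 a (v 0) (v 1) (v 2))"
    by (simp add: det3_code F_def algebra_simps)
  finally have "wedge 1 (2 + 0) (covector (a 1)) (\<lambda>v. F (v 0) (v 1)) = (\<lambda>v. det3 a (v 0) (v 1) (v 2))"
    by simp
  then show ?thesis
    using of_type.wedge10[OF assms[of 1] of_type_20I[OF assms[of 2] assms[of 3]]]
    by (simp add: F_def numeral_3_eq_3 numeral_2_eq_2)
qed

lemma of_type_sum:
  assumes "of_type J p q (\<lambda>v. 0)" "\<And>i. i \<in> S \<Longrightarrow> of_type J p q (f i)"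
  shows "of_type J p q (\<lambda>v. \<Sum>i\<in>S. f i v)"
  using assms(2)
  by (induction S rule: infinite_finite_induct) (auto intro: assms(1) of_type.add)

section \<open>The pairing of three-forms on V\<close>

text \<open>Matches positions in a sequence with coordinates in the convention of
  \<open>positive_top_form\<close>; position 5 goes to 6, which is 0 in the index type.\<close>

definition basis_index :: "nat \<Rightarrow> 6" where
  "basis_index i = of_nat (i + 1)"

lemma UNIV_6: "(UNIV :: 6 set) = {1, 2, 3, 4, 5, 6}"
proof -
  have "card {1, 2, 3, 4, 5, 6 :: 6} = card (UNIV :: 6 set)" by simp
  then show ?thesis by (metis card_subset_eq finite subset_UNIV)
qed

lemma sum_6: "(\<Sum>i\<in>UNIV. f i) = f 1 + f 2 + f 3 + f 4 + f 5 + (f (6::6) :: 'a::comm_monoid_add)"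
  unfolding UNIV_6 by (simp add: add.assoc)

lemma lessThan_6: "{..<6::nat} = {0, 1, 2, 3, 4, 5}"
  by (simp add: eval_nat_numeral lessThan_Suc insert_commute)

lemma bij_basis_index: "bij_betw basis_index {..<6} UNIV"
proof (rule bij_betw_imageI)
  show "inj_on basis_index {..<6}"
    by (simp add: lessThan_6 basis_index_def)
  show "basis_index ` {..<6} = UNIV"
    by (simp add: lessThan_6 UNIV_6 basis_index_def insert_commute)
qed

lemma prod_lessThan_6: "prod f {..<6::nat} = f 0 * f 1 * f 2 * f 3 * f 4 * (f 5 :: 'a::comm_monoid_mult)"
  by (simp add: lessThan_6 mult.assoc)

text \<open>A top-degree wedge product is a sum of 720 terms. Instead of expanding it, conjugation
  by \<open>basis_index\<close> carries it over to the Leibniz formula on the index type.\<close>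

lemma sum_permutes_6:
  fixes A :: "'a::comm_ring_1^6^6"
  shows "(\<Sum>\<sigma> | \<sigma> permutes {..<6::nat}. of_int (sign \<sigma>) * (\<Prod>k<6. A $ basis_index k $ basis_index (\<sigma> k))) = det A"
  unfolding det_def
proof (rule sum.reindex_bij_witness[of _ "map_permutation UNIV (inv_into {..<6} basis_index)" "map_permutation {..<6} basis_index"])
  have inj: "inj_on basis_index {..<6}" using bij_basis_index by (simp add: bij_betw_def)
  fix \<sigma> :: "nat \<Rightarrow> nat" assume "\<sigma> \<in> {\<sigma>. \<sigma> permutes {..<6}}"
  then have \<sigma>: "\<sigma> permutes {..<6}" by simp
  show "map_permutation UNIV (inv_into {..<6} basis_index) (map_permutation {..<6} basis_index \<sigma>) = \<sigma>"
    by (rule map_permutation_compose_inv[OF bij_basis_index \<sigma>]) (rule inv_into_f_f[OF inj])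
  show "map_permutation {..<6} basis_index \<sigma> \<in> {p. p permutes UNIV}"
    using map_permutation_permutes[OF bij_basis_index \<sigma>] by simp
  have "(\<Prod>i\<in>UNIV. A $ i $ map_permutation {..<6} basis_index \<sigma> i) =
      (\<Prod>k<6. A $ basis_index k $ map_permutation {..<6} basis_index \<sigma> (basis_index k))"
    by (rule prod.reindex_bij_betw[OF bij_basis_index, symmetric])
  also have "\<dots> = (\<Prod>k<6. A $ basis_index k $ basis_index (\<sigma> k))"
    by (simp add: map_permutation_apply[OF inj])
  finally show "of_int (sign (map_permutation {..<6} basis_index \<sigma>)) *
      (\<Prod>i\<in>UNIV. A $ i $ map_permutation {..<6} basis_index \<sigma> i) =
     of_int (sign \<sigma>) * (\<Prod>k<6. A $ basis_index k $ basis_index (\<sigma> k))"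
    by (simp add: sign_map_permutation[OF inj \<sigma>])
next
  have inv: "bij_betw (inv_into {..<6} basis_index) UNIV {..<6}"
    by (rule bij_betw_inv_into[OF bij_basis_index])
  fix p :: "6 \<Rightarrow> 6" assume "p \<in> {p. p permutes UNIV}"
  then have p: "p permutes UNIV" by simp
  show "map_permutation UNIV (inv_into {..<6} basis_index) p \<in> {\<sigma>. \<sigma> permutes {..<6}}"
    using map_permutation_permutes[OF inv p] by simp
  show "map_permutation {..<6} basis_index (map_permutation UNIV (inv_into {..<6} basis_index) p) = p"
    by (rule map_permutation_compose_inv[OF inv p]) (rule bij_betw_inv_into_right[OF bij_basis_index])
qed

lemma sum_sign_transpose:
  fixes F :: "(nat \<Rightarrow> nat) \<Rightarrow> 'a::comm_ring_1"
  assumes "x \<noteq> y" "x < n" "y < n"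
  shows "(\<Sum>\<sigma> | \<sigma> permutes {..<n}. of_int (sign \<sigma>) * F \<sigma>) =
     - (\<Sum>\<sigma> | \<sigma> permutes {..<n}. of_int (sign \<sigma>) * F (\<sigma> \<circ> Transposition.transpose x y))"
proof -
  have t: "Transposition.transpose x y permutes {..<n}" using assms by (intro permutes_swap_id) auto
  have "(\<Sum>\<sigma> | \<sigma> permutes {..<n}. of_int (sign \<sigma>) * F \<sigma>) =
      (\<Sum>\<sigma> | \<sigma> permutes {..<n}. of_int (sign (\<sigma> \<circ> Transposition.transpose x y)) * F (\<sigma> \<circ> Transposition.transpose x y))"
    by (rule sum_permutations_compose_right[OF t])
  also have "\<dots> = (\<Sum>\<sigma> | \<sigma> permutes {..<n}. - (of_int (sign \<sigma>) * F (\<sigma> \<circ> Transposition.transpose x y)))"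
  proof (rule sum.cong[OF refl])
    fix \<sigma> assume "\<sigma> \<in> {\<sigma>. \<sigma> permutes {..<n}}"
    then have "permutation \<sigma>" by (auto intro: permutes_imp_permutation[of "{..<n}"])
    then have "sign (\<sigma> \<circ> Transposition.transpose x y) = - sign \<sigma>"
      using assms(1) by (simp add: sign_compose permutation_swap_id sign_swap_id)
    then show "of_int (sign (\<sigma> \<circ> Transposition.transpose x y)) * F (\<sigma> \<circ> Transposition.transpose x y) =
        - (of_int (sign \<sigma>) * F (\<sigma> \<circ> Transposition.transpose x y))" by simp
  qed
  finally show ?thesis by (simp add: sum_negf)
qed

text \<open>The six products in \<open>det3\<close> differ by permutations of the first three
  positions. Reindexing by transpositions, which do not touch R, makes all six signed sums equal.
  The factor 6 later cancels a 3! in \<open>wedge\<close>.\<close>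

lemma sum_sign_det3_left:
  fixes a :: "3 \<Rightarrow> V \<Rightarrow> complex"
  shows "(\<Sum>\<sigma> | \<sigma> permutes {..<6::nat}. of_int (sign \<sigma>) *
       (det3 a (v (\<sigma> 0)) (v (\<sigma> 1)) (v (\<sigma> 2)) * R (\<sigma> 3) (\<sigma> 4) (\<sigma> 5))) =
     6 * (\<Sum>\<sigma> | \<sigma> permutes {..<6::nat}. of_int (sign \<sigma>) *
       (a 1 (v (\<sigma> 0)) * a 2 (v (\<sigma> 1)) * a 3 (v (\<sigma> 2)) * R (\<sigma> 3) (\<sigma> 4) (\<sigma> 5)))"
proof -
  define X where "X = (\<lambda>i j k. \<Sum>\<sigma> | \<sigma> permutes {..<6::nat}. of_int (sign \<sigma>) *
       (a 1 (v (\<sigma> i)) * a 2 (v (\<sigma> j)) * a 3 (v (\<sigma> k)) * R (\<sigma> 3) (\<sigma> 4) (\<sigma> 5)))"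
  have swap: "X i j k = - X (Transposition.transpose x y i) (Transposition.transpose x y j) (Transposition.transpose x y k)"
    if "x \<noteq> y" "x < 3" "y < 3" for x y i j k :: nat
    unfolding X_def using that by (subst sum_sign_transpose[of x y]) (auto simp: Transposition.transpose_def)
  have "X 1 0 2 = - X 0 1 2" "X 0 2 1 = - X 0 1 2" "X 2 1 0 = - X 0 1 2"
    using swap[of 0 1 1 0 2] swap[of 1 2 0 2 1] swap[of 0 2 2 1 0] by (auto simp: Transposition.transpose_def)
  moreover have "X 1 2 0 = - X 0 2 1" "X 2 0 1 = - X 2 1 0"
    using swap[of 0 1 1 2 0] swap[of 0 1 2 0 1] by (auto simp: Transposition.transpose_def)
  moreover have "(\<Sum>\<sigma> | \<sigma> permutes {..<6::nat}. of_int (sign \<sigma>) *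
       (det3 a (v (\<sigma> 0)) (v (\<sigma> 1)) (v (\<sigma> 2)) * R (\<sigma> 3) (\<sigma> 4) (\<sigma> 5))) =
     X 0 1 2 - X 0 2 1 + X 2 0 1 - X 1 0 2 + X 1 2 0 - X 2 1 0"
    unfolding X_def sum.distrib[symmetric] sum_subtractf[symmetric]
    by (rule sum.cong) (simp_all add: det3_code algebra_simps)
  ultimately have "(\<Sum>\<sigma> | \<sigma> permutes {..<6::nat}. of_int (sign \<sigma>) *
       (det3 a (v (\<sigma> 0)) (v (\<sigma> 1)) (v (\<sigma> 2)) * R (\<sigma> 3) (\<sigma> 4) (\<sigma> 5))) = 6 * X 0 1 2" by simp
  then show ?thesis by (simp only: X_def)
qed

lemma sum_sign_det3_right:
  fixes b :: "3 \<Rightarrow> V \<Rightarrow> complex"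
  shows "(\<Sum>\<sigma> | \<sigma> permutes {..<6::nat}. of_int (sign \<sigma>) *
       (R (\<sigma> 0) (\<sigma> 1) (\<sigma> 2) * det3 b (v (\<sigma> 3)) (v (\<sigma> 4)) (v (\<sigma> 5)))) =
     6 * (\<Sum>\<sigma> | \<sigma> permutes {..<6::nat}. of_int (sign \<sigma>) *
       (R (\<sigma> 0) (\<sigma> 1) (\<sigma> 2) * (b 1 (v (\<sigma> 3)) * b 2 (v (\<sigma> 4)) * b 3 (v (\<sigma> 5)))))"
proof -
  define X where "X = (\<lambda>i j k. \<Sum>\<sigma> | \<sigma> permutes {..<6::nat}. of_int (sign \<sigma>) *
       (R (\<sigma> 0) (\<sigma> 1) (\<sigma> 2) * (b 1 (v (\<sigma> i)) * b 2 (v (\<sigma> j)) * b 3 (v (\<sigma> k)))))"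
  have swap: "X i j k = - X (Transposition.transpose x y i) (Transposition.transpose x y j) (Transposition.transpose x y k)"
    if "x \<noteq> y" "x < 6" "y < 6" "2 < x" "2 < y" for x y i j k :: nat
    unfolding X_def using that by (subst sum_sign_transpose[of x y]) (auto simp: Transposition.transpose_def)
  have "X 4 3 5 = - X 3 4 5" "X 3 5 4 = - X 3 4 5" "X 5 4 3 = - X 3 4 5"
    using swap[of 3 4 4 3 5] swap[of 4 5 3 5 4] swap[of 3 5 5 4 3] by (auto simp: Transposition.transpose_def)
  moreover have "X 4 5 3 = - X 3 5 4" "X 5 3 4 = - X 5 4 3"
    using swap[of 3 4 4 5 3] swap[of 3 4 5 3 4] by (auto simp: Transposition.transpose_def)
  moreover have "(\<Sum>\<sigma> | \<sigma> permutes {..<6::nat}. of_int (sign \<sigma>) *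
       (R (\<sigma> 0) (\<sigma> 1) (\<sigma> 2) * det3 b (v (\<sigma> 3)) (v (\<sigma> 4)) (v (\<sigma> 5)))) =
     X 3 4 5 - X 3 5 4 + X 5 3 4 - X 4 3 5 + X 4 5 3 - X 5 4 3"
    unfolding X_def sum.distrib[symmetric] sum_subtractf[symmetric]
    by (rule sum.cong) (simp_all add: det3_code algebra_simps)
  ultimately have "(\<Sum>\<sigma> | \<sigma> permutes {..<6::nat}. of_int (sign \<sigma>) *
       (R (\<sigma> 0) (\<sigma> 1) (\<sigma> 2) * det3 b (v (\<sigma> 3)) (v (\<sigma> 4)) (v (\<sigma> 5)))) = 6 * X 3 4 5" by simp
  then show ?thesis by (simp only: X_def)
qed

text \<open>Exchanging the two blocks of three positions is a product of three transpositions, hence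
  odd. In particular the square of a three-form vanishes.\<close>

lemma wedge_3_3_antisym:
  fixes F G :: "V \<Rightarrow> V \<Rightarrow> V \<Rightarrow> 'a::real_normed_field"
  shows "wedge 3 3 (\<lambda>v. F (v 0) (v 1) (v 2)) (\<lambda>v. G (v 0) (v 1) (v 2)) v =
    - wedge 3 3 (\<lambda>v. G (v 0) (v 1) (v 2)) (\<lambda>v. F (v 0) (v 1) (v 2)) v"
proof -
  define H where "H = (\<lambda>\<sigma>::nat \<Rightarrow> nat. F (v (\<sigma> 0)) (v (\<sigma> 1)) (v (\<sigma> 2)) * G (v (\<sigma> 3)) (v (\<sigma> 4)) (v (\<sigma> 5)))"
  have "(\<Sum>\<sigma> | \<sigma> permutes {..<6::nat}. of_int (sign \<sigma>) * H \<sigma>) =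
      - (\<Sum>\<sigma> | \<sigma> permutes {..<6::nat}. of_int (sign \<sigma>) * H (\<sigma> \<circ> Transposition.transpose 2 5 \<circ> Transposition.transpose 1 4 \<circ> Transposition.transpose 0 3))"
    using sum_sign_transpose[of 0 3 6 H]
      sum_sign_transpose[of 1 4 6 "\<lambda>\<sigma>. H (\<sigma> \<circ> Transposition.transpose 0 3)"]
      sum_sign_transpose[of 2 5 6 "\<lambda>\<sigma>. H (\<sigma> \<circ> Transposition.transpose 1 4 \<circ> Transposition.transpose 0 3)"]
    by simp
  also have "(\<lambda>\<sigma>. H (\<sigma> \<circ> Transposition.transpose 2 5 \<circ> Transposition.transpose 1 4 \<circ> Transposition.transpose 0 3)) =
      (\<lambda>\<sigma>. G (v (\<sigma> 0)) (v (\<sigma> 1)) (v (\<sigma> 2)) * F (v (\<sigma> 3)) (v (\<sigma> 4)) (v (\<sigma> 5)))"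
    by (simp add: H_def Transposition.transpose_def mult.commute)
  finally show ?thesis by (simp add: wedge_def H_def mult.assoc)
qed

lemma wedge_det3_det3:
  fixes a b :: "3 \<Rightarrow> V \<Rightarrow> complex"
  shows "wedge 3 3 (\<lambda>v. det3 a (v 0) (v 1) (v 2)) (\<lambda>v. det3 b (v 0) (v 1) (v 2)) v =
    (\<Sum>\<sigma> | \<sigma> permutes {..<6::nat}. of_int (sign \<sigma>) *
       (a 1 (v (\<sigma> 0)) * a 2 (v (\<sigma> 1)) * a 3 (v (\<sigma> 2)) * (b 1 (v (\<sigma> 3)) * b 2 (v (\<sigma> 4)) * b 3 (v (\<sigma> 5)))))"
  using sum_sign_det3_left[of a v "\<lambda>i j k. det3 b (v i) (v j) (v k)"]
    sum_sign_det3_right[of "\<lambda>i j k. a 1 (v i) * a 2 (v j) * a 3 (v k)" b v]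
  by (simp add: wedge_def mult.assoc fact_numeral)

text \<open>The value is the determinant of the covectors a 1, a 2, a 3 and their conjugates in the
  standard basis. A relation among these rows extends to all of V; evaluating it at
  \<open>e i\<close> and \<open>J (e i)\<close> separates the coefficients of \<open>a i\<close> and
  its conjugate.\<close>

lemma (in complex_frame) wedge_det3_cnj_nonzero:
  "wedge 3 3 (\<lambda>v. det3 a (v 0) (v 1) (v 2)) (\<lambda>v. cnj (det3 a (v 0) (v 1) (v 2)))
     (\<lambda>i. axis (of_nat (i + 1)) 1) \<noteq> 0"
proof -
  define \<theta> :: "6 \<Rightarrow> V \<Rightarrow> complex" where
    "\<theta> = (\<lambda>i. if i = 1 then a 1 else if i = 2 then a 2 else if i = 3 then a 3
      else if i = 4 then (\<lambda>x. cnj (a 1 x)) else if i = 5 then (\<lambda>x. cnj (a 2 x)) else (\<lambda>x. cnj (a 3 x)))"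
  have lin: "linear (\<theta> i)" for i
    using linear_a linear_cnj_comp by (auto simp: \<theta>_def)
  define A :: "complex^6^6" where "A = (\<chi> i j. \<theta> i (axis j 1))"
  define b where "b = (\<lambda>i x. cnj (a i x))"
  have b: "cnj (det3 a x y z) = det3 b x y z" for x y z
    by (simp add: det3_code b_def)
  have "wedge 3 3 (\<lambda>v. det3 a (v 0) (v 1) (v 2)) (\<lambda>v. cnj (det3 a (v 0) (v 1) (v 2)))
     (\<lambda>i. axis (of_nat (i + 1)) 1) = det A"
    unfolding b wedge_det3_det3 sum_permutes_6[symmetric]
    by (simp add: prod_lessThan_6 A_def \<theta>_def b_def basis_index_def mult.assoc)
  moreover have "det A \<noteq> 0"
    unfolding invertible_det_nz[symmetric] invertible_right_inverse matrix_right_invertible_independent_rows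
  proof (intro allI impI)
    fix c :: "6 \<Rightarrow> complex" and i :: 6 assume "(\<Sum>i\<in>UNIV. c i *s row i A) = 0"
    then have basis: "(\<Sum>i\<in>UNIV. c i * \<theta> i (axis j 1)) = 0" for j
      by (simp add: vec_eq_iff row_def A_def)
    have zero: "(\<Sum>i\<in>UNIV. c i * \<theta> i x) = 0" for x
    proof -
      have "\<theta> i x = (\<Sum>j\<in>UNIV. (x $ j) *\<^sub>R \<theta> i (axis j 1))" for i
      proof -
        have "\<theta> i x = \<theta> i (\<Sum>j\<in>UNIV. (x $ j) *\<^sub>R axis j 1)"
          by (simp only: basis_expansion[of x, unfolded scalar_mult_eq_scaleR])
        then show ?thesis by (simp only: linear_sum[OF lin] linear_scale[OF lin])
      qed
      then have "(\<Sum>i\<in>UNIV. c i * \<theta> i x) = (\<Sum>i\<in>UNIV. \<Sum>j\<in>UNIV. (x $ j) *\<^sub>R (c i * \<theta> i (axis j 1)))"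
        by (simp add: sum_distrib_left)
      also have "\<dots> = (\<Sum>j\<in>UNIV. (x $ j) *\<^sub>R (\<Sum>i\<in>UNIV. c i * \<theta> i (axis j 1)))"
        by (subst sum.swap) (simp add: scaleR_sum_right)
      finally show ?thesis by (simp add: basis)
    qed
    have expanded: "c 1 * a 1 x + c 2 * a 2 x + c 3 * a 3 x + c 4 * cnj (a 1 x) + c 5 * cnj (a 2 x) + c 6 * cnj (a 3 x) = 0" for x
      using zero[of x] unfolding sum_6 by (simp add: \<theta>_def)
    have sol: "x = 0 \<and> y = 0" if "x + y = 0" "x * \<i> - y * \<i> = 0" for x y :: complex
      using that by (simp add: left_diff_distrib[symmetric])
    have "c 1 = 0 \<and> c 4 = 0" "c 2 = 0 \<and> c 5 = 0" "c 3 = 0 \<and> c 6 = 0"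
      using expanded[of "e 1"] expanded[of "J (e 1)"] expanded[of "e 2"] expanded[of "J (e 2)"]
        expanded[of "e 3"] expanded[of "J (e 3)"]
      by (auto simp: dual intro!: sol)
    moreover have "i \<in> {1, 2, 3, 4, 5, 6}" using UNIV_6 by blast
    ultimately show "c i = 0" by auto
  qed
  ultimately show ?thesis by simp
qed

text \<open>With real part P and imaginary part Q, the squares of P and Q vanish and the two mixed
  products are opposite, so the product of the form with its conjugate is -2 i times the product of
  P and Q.\<close>

lemma (in complex_frame) wedge_Re_Im_det3_nonzero:
  "wedge 3 3 (\<lambda>v. Re (det3 a (v 0) (v 1) (v 2))) (\<lambda>v. Im (det3 a (v 0) (v 1) (v 2)))
     (\<lambda>i. axis (of_nat (i + 1)) 1) \<noteq> 0" (is "?W \<noteq> 0")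
proof
  define P where "P = (\<lambda>x y z. Re (det3 a x y z))"
  define Q where "Q = (\<lambda>x y z. Im (det3 a x y z))"
  define E where "E = (\<lambda>i::nat. axis (of_nat (i + 1)) 1 :: V)"
  let ?f = "\<lambda>F v. F (v (0::nat)) (v 1) (v 2)"
  define S where "S = (\<lambda>F G :: V \<Rightarrow> V \<Rightarrow> V \<Rightarrow> real. \<Sum>\<sigma> | \<sigma> permutes {..<6}.
     of_int (sign \<sigma>) * F (E (\<sigma> 0)) (E (\<sigma> 1)) (E (\<sigma> 2)) * G (E (\<sigma> 3)) (E (\<sigma> 4)) (E (\<sigma> 5)))"
  have W: "wedge 3 3 (?f F) (?f G) E = S F G / 36" for F G :: "V \<Rightarrow> V \<Rightarrow> V \<Rightarrow> real"
    by (simp add: wedge_def S_def fact_numeral)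
  assume "?W = 0"
  then have PQ: "S P Q = 0" using W[of P Q] by (simp add: P_def Q_def E_def)
  have QP: "S Q P = 0" using wedge_3_3_antisym[of Q P E] W[of P Q] W[of Q P] PQ by simp
  have PP: "S P P = 0" using wedge_3_3_antisym[of P P E] W[of P P] by simp
  have QQ: "S Q Q = 0" using wedge_3_3_antisym[of Q Q E] W[of Q Q] by simp
  have "wedge 3 3 (?f (det3 a)) (\<lambda>v. cnj (?f (det3 a) v)) E =
     Complex (S P P + S Q Q) (S Q P - S P Q) / 36"
    by (simp add: wedge_def fact_numeral S_def P_def Q_def complex_eq_iff sum.distrib[symmetric]
       sum_subtractf[symmetric] algebra_simps)
  also have "\<dots> = 0" by (simp add: PQ QP PP QQ complex_eq_iff)
  finally show False using wedge_det3_cnj_nonzero by (simp add: E_def)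
qed

section \<open>The complex structure of a form in A3plus\<close>

definition standard_frame :: "3 \<Rightarrow> V \<Rightarrow> complex" where
  "standard_frame i x = (if i = 1 then Complex (x $ 1) (x $ 2)
     else if i = 2 then Complex (x $ 3) (x $ 4) else Complex (x $ 5) (x $ 6))"

lemma phi0_det3: "phi0 = (\<lambda>v. Re (det3 standard_frame (v 0) (v 1) (v 2)))"
proof -
  define F where "F = (\<lambda>x y. standard_frame 1 x * standard_frame 2 y - standard_frame 1 y * standard_frame 2 x)"
  have dz: "dz 1 2 = covector (standard_frame 1)" "dz 3 4 = covector (standard_frame 2)" "dz 5 6 = covector (standard_frame 3)"
    by (simp_all add: dz_def standard_frame_def covector_def)
  have w: "wedge 1 1 (dz 1 2) (dz 3 4) = (\<lambda>v. F (v 0) (v 1))"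
    unfolding dz F_def by (rule wedge_covector)
  have "F x y = - F y x" for x y by (simp add: F_def)
  then have "wedge 2 1 (\<lambda>v. F (v 0) (v 1)) (\<lambda>v. standard_frame 3 (v 0)) =
    (\<lambda>v. standard_frame 3 (v 0) * F (v 1) (v 2) - standard_frame 3 (v 1) * F (v 0) (v 2) + standard_frame 3 (v 2) * F (v 0) (v 1))"
    by (rule wedge_2_1)
  also have "\<dots> = (\<lambda>v. det3 standard_frame (v 0) (v 1) (v 2))"
    by (simp add: F_def det3_code algebra_simps)
  finally show ?thesis
    unfolding phi0_def w dz(3) covector_def by simp
qed

lemma linear_standard_frame: "linear (standard_frame i)"
  by (auto simp: linear_iff standard_frame_def complex_eq_iff)

lemma exhaust_6: "j = 1 \<or> j = 2 \<or> j = 3 \<or> j = 4 \<or> j = 5 \<or> j = (6::6)"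
proof -
  have "j \<in> {1, 2, 3, 4, 5, 6}" using UNIV_6 by blast
  then show ?thesis by simp
qed

lemma standard_frame_surj: "\<exists>x. \<forall>i. standard_frame i x = c i"
proof
  let ?x = "(\<chi> j. if j = 1 then Re (c 1) else if j = 2 then Im (c 1) else if j = 3 then Re (c 2)
     else if j = 4 then Im (c 2) else if j = 5 then Re (c 3) else Im (c 3)) :: V"
  show "\<forall>i. standard_frame i ?x = c i"
    by (simp add: forall_3 standard_frame_def complex_eq_iff)
qed

lemma standard_frame_eqD:
  assumes "\<And>i. standard_frame i x = standard_frame i y"
  shows "x = y"
proof -
  have "x $ j = y $ j" for j
    using assms[of 1] assms[of 2] assms[of 3] exhaust_6[of j] by (auto simp: standard_frame_def)
  then show ?thesis by (simp add: vec_eq_iff)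
qed

text \<open>\<open>standard_frame\<close> identifies V with C^3 over the reals; g is a followed by
  the inverse of this identification, and real linearity of a is enough for it.\<close>

lemma A3plusI:
  assumes lin: "\<And>i. linear (a i)" and inj: "\<And>x. (\<And>i. a i x = 0) \<Longrightarrow> x = 0"
  shows "(\<lambda>v. Re (det3 a (v 0) (v 1) (v 2))) \<in> A3plus"
proof -
  define g where "g = (\<lambda>x. SOME y. \<forall>i. standard_frame i y = a i x)"
  have g: "standard_frame i (g x) = a i x" for i x
    unfolding g_def using someI_ex[OF standard_frame_surj[of "\<lambda>i. a i x"]] by blast
  have "linear g"
    by (rule linearI; rule standard_frame_eqD)
      (simp_all only: g linear_add[OF linear_standard_frame] linear_scale[OF linear_standard_frame]
         linear_add[OF lin] linear_scale[OF lin])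
  moreover have "inj g"
  proof (subst linear_injective_0[OF \<open>linear g\<close>], intro allI impI)
    fix x assume "g x = 0"
    then have "a i x = 0" for i
      using g[of i x] linear_0[OF linear_standard_frame] by simp
    then show "x = 0" by (rule inj)
  qed
  ultimately have "bij g"
    using linear_injective_imp_surjective by (auto simp: bij_def)
  moreover have "(\<lambda>v. Re (det3 a (v 0) (v 1) (v 2))) = pullback g phi0"
    by (simp add: pullback_def phi0_det3 det3_code g)
  ultimately show ?thesis using \<open>linear g\<close> by (auto simp: A3plus_def)
qed

text \<open>The frame is \<open>standard_frame\<close> transported by g. It is a real isomorphism
  onto C^3, so multiplication by i on C^3 pulls back to a well-defined J.\<close>

lemma A3plusE:
  assumes "\<phi> \<in> A3plus"
  obtains J a e where "complex_frame J a e" "\<phi> = (\<lambda>v. Re (det3 a (v 0) (v 1) (v 2)))"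
proof -
  obtain g where g: "linear g" "bij g" "\<phi> = pullback g phi0"
    using assms by (auto simp: A3plus_def)
  define a where "a = (\<lambda>i x. standard_frame i (g x))"
  have lin: "linear (a i)" for i
    unfolding a_def using linear_compose[OF g(1) linear_standard_frame] by (simp add: o_def)
  have surj: "\<exists>x. \<forall>i. a i x = c i" for c
  proof -
    obtain y where "\<forall>i. standard_frame i y = c i" using standard_frame_surj by blast
    then have "\<forall>i. a i (inv g y) = c i" using g(2) by (simp add: a_def bij_is_surj surj_f_inv_f)
    then show ?thesis by blast
  qed
  have eqD: "x = y" if "\<And>i. a i x = a i y" for x y
  proof -
    have "g x = g y" by (rule standard_frame_eqD) (use that in \<open>simp add: a_def\<close>)
    then show ?thesis using g(2) by (simp add: bij_is_inj inj_eq)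
  qed
  define J where "J = (\<lambda>x. SOME y. \<forall>i. a i y = \<i> * a i x)"
  have J: "a i (J x) = \<i> * a i x" for i x
    unfolding J_def using someI_ex[OF surj[of "\<lambda>i. \<i> * a i x"]] by blast
  have "linear J"
    by (rule linearI; rule eqD)
      (simp_all only: J linear_add[OF lin] linear_scale[OF lin] distrib_left mult_scaleR_right)
  moreover have "J (J x) = - x" for x
    by (rule eqD) (simp add: J linear_neg[OF lin] mult.assoc[symmetric])
  ultimately have "complex_structure J" by (simp add: complex_structure_def)
  moreover have "covector10 J (a i)" for i by (simp add: covector10_def lin J)
  moreover have "c = (\<lambda>_. 0)" if "\<And>x. (\<Sum>i\<in>UNIV. c i * a i x) = 0" for c
  proof
    fix k
    obtain x where "\<forall>i. a i x = (if i = k then 1 else 0)"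
      using surj[of "\<lambda>i. if i = k then 1 else 0"] by blast
    then have "(\<Sum>i\<in>UNIV. c i * a i x) = (\<Sum>i\<in>UNIV. if i = k then c i else 0)"
      by (intro sum.cong) auto
    then show "c k = 0" using that[of x] by simp
  qed
  ultimately obtain e where "complex_frame J a e" by (rule complex_frameI)
  moreover have "\<phi> = (\<lambda>v. Re (det3 a (v 0) (v 1) (v 2)))"
    by (simp add: g(3) pullback_def phi0_det3 a_def det3_code)
  ultimately show ?thesis by (rule that)
qed

lemma (in complex_frame) det3_J1 [simp]: "det3 a (J x) y z = \<i> * det3 a x y z"
  and det3_J2 [simp]: "det3 a x (J y) z = \<i> * det3 a x y z"
  and det3_J3 [simp]: "det3 a x y (J z) = \<i> * det3 a x y z"
  by (simp_all add: det3_code algebra_simps)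

lemma (in complex_frame) complex_frame_conj: "complex_frame (\<lambda>x. - J x) (\<lambda>i x. cnj (a i x)) e"
proof
  show "complex_structure (\<lambda>x. - J x)"
    using linear_compose_neg[OF linear_J] by (simp add: complex_structure_def)
  show "covector10 (\<lambda>x. - J x) (\<lambda>x. cnj (a i x))" for i
    using linear_cnj_comp[OF linear_a] by (simp add: covector10_def)
  show "cnj (a i (e j)) = (if i = j then 1 else 0)" for i j by (simp add: dual)
  show "x = (\<Sum>i\<in>UNIV. Re (cnj (a i x)) *\<^sub>R e i + Im (cnj (a i x)) *\<^sub>R - J (e i))" for x
    using expand[of x] by simp
qed

lemma wedge_minus_right: "wedge p q \<alpha> (\<lambda>v. - \<beta> v) v = - wedge p q \<alpha> \<beta> v"
  by (simp add: wedge_def sum_negf)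

text \<open>Conjugating the frame replaces J by -J, keeps the real part of the determinant and
  changes the sign of its imaginary part; as the pairing is nonzero, exactly one of the two frames
  has the right orientation.\<close>

lemma A3plus_positive_frame:
  assumes "\<phi> \<in> A3plus"
  obtains J a e where "complex_frame J a e" "\<phi> = (\<lambda>v. Re (det3 a (v 0) (v 1) (v 2)))"
    "positive_top_form (wedge 3 3 \<phi> (\<lambda>v. Im (det3 a (v 0) (v 1) (v 2))))"
proof -
  obtain J a e where a: "complex_frame J a e" "\<phi> = (\<lambda>v. Re (det3 a (v 0) (v 1) (v 2)))"
    using A3plusE[OF assms] by metis
  interpret complex_frame J a e by (rule a(1))
  let ?b = "\<lambda>i x. cnj (a i x)"
  have b: "det3 ?b x y z = cnj (det3 a x y z)" for x y z by (simp add: det3_code)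
  consider "positive_top_form (wedge 3 3 \<phi> (\<lambda>v. Im (det3 a (v 0) (v 1) (v 2))))"
    | "positive_top_form (wedge 3 3 \<phi> (\<lambda>v. Im (det3 ?b (v 0) (v 1) (v 2))))"
    using wedge_Re_Im_det3_nonzero
    unfolding positive_top_form_def b a(2)[symmetric] cnj.sel wedge_minus_right by linarith
  then show ?thesis
  proof cases
    case 1
    then show ?thesis using a that by blast
  next
    case 2
    show ?thesis
      by (rule that[OF complex_frame_conj _ 2]) (simp add: b a(2))
  qed
qed

lemma (in complex_frame) associated_Re_det3:
  assumes "positive_top_form (wedge 3 3 (\<lambda>v. Re (det3 a (v 0) (v 1) (v 2))) (\<lambda>v. Im (det3 a (v 0) (v 1) (v 2))))"
  shows "associated (\<lambda>v. Re (det3 a (v 0) (v 1) (v 2))) ((\<lambda>v. Im (det3 a (v 0) (v 1) (v 2))), J)"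
proof -
  \<comment> \<open>Multiplying one covector by -i turns the imaginary part of the determinant into
    a real part, as membership in \<open>A3plus\<close> requires.\<close>
  define b where "b = (\<lambda>i x. if i = 1 then - \<i> * a i x else a i x)"
  have "(\<lambda>v. Re (det3 b (v 0) (v 1) (v 2))) \<in> A3plus"
  proof (rule A3plusI)
    show "linear (b i)" for i using linear_a by (auto simp: b_def linear_iff algebra_simps)
    show "x = 0" if "\<And>i. b i x = 0" for x
    proof (rule eq_0)
      show "a i x = 0" for i using that[of i] by (simp add: b_def split: if_splits)
    qed
  qed
  moreover have "Re (det3 b x y z) = Im (det3 a x y z)" for x y z
    by (simp add: b_def det3_code algebra_simps)
  moreover have "complex_of_real (Re z) + \<i> * complex_of_real (Im z) = z" for z
    by (simp add: complex_eq_iff)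
  ultimately show ?thesis
    using assms complex_structure of_type_30I[OF covector10] by (simp add: associated_def)
qed

text \<open>\<open>J' x\<close> lies in the kernel of the contraction of the form with x, which is the J-complex line
  through x. A linear map that preserves every complex line is multiplication by a constant,
  so \<open>J' = \<plusminus>J\<close>, and the orientation decides the sign.\<close>

lemma (in complex_frame) associated_Re_det3_unique:
  assumes pos: "positive_top_form (wedge 3 3 (\<lambda>v. Re (det3 a (v 0) (v 1) (v 2))) (\<lambda>v. Im (det3 a (v 0) (v 1) (v 2))))"
    and assoc: "associated (\<lambda>v. Re (det3 a (v 0) (v 1) (v 2))) (\<psi>, J')"
  shows "\<psi> = (\<lambda>v. Im (det3 a (v 0) (v 1) (v 2)))" "J' = J"
proof -
  have J': "linear J'" "\<And>x. J' (J' x) = - x"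
    using assoc by (auto simp: associated_def complex_structure_def)
  have pos': "positive_top_form (wedge 3 3 (\<lambda>v. Re (det3 a (v 0) (v 1) (v 2))) \<psi>)"
    using assoc by (simp add: associated_def)
  obtain F where F: "\<And>x y z. F (J' x) y z = \<i> * F x y z" "\<And>x z. F x (J' x) z = 0"
    "(\<lambda>v. complex_of_real (Re (det3 a (v 0) (v 1) (v 2))) + \<i> * complex_of_real (\<psi> v)) = (\<lambda>v. F (v 0) (v 1) (v 2))"
    using of_type_30[of J' 3 0] assoc by (force simp: associated_def)
  have Fv: "F (v 0) (v 1) (v 2) = Complex (Re (det3 a (v 0) (v 1) (v 2))) (\<psi> v)" for v
    using fun_cong[OF F(3), of v] by (simp add: complex_eq_iff)
  have Re_F: "Re (F x y z) = Re (det3 a x y z)" for x y z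
    using Fv[of "(\<lambda>_. 0)(0 := x, 1 := y, 2 := z)"] by simp
  define b where "b = (\<lambda>i x. a i (J' x))"
  have lin_b: "linear (b i)" for i
    unfolding b_def using linear_compose[OF J'(1) linear_a] by (simp add: o_def)
  \<comment> \<open>The real parts of F and of the determinant coincide. Taking J z for z exhibits
    the imaginary part of the determinant as well.\<close>
  have "det3 a x (J' x) z = 0" for x z
    using Re_F[of x "J' x" z] Re_F[of x "J' x" "J z"] F(2) by (simp add: complex_eq_iff)
  then have 0: "det3 a x (J' x) (e k) = 0" for x k .
  have ab: "a i x * b j x = a j x * b i x" for i j x
  proof -
    have "\<forall>i j. a i x * b j x = a j x * b i x"
      using 0[of x 1] 0[of x 2] 0[of x 3] by (simp add: forall_3 det3_code dual b_def)
    then show ?thesis by blast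
  qed
  \<comment> \<open>\<open>ab\<close> says that J' x lies on the J-complex line of x. Its
    polarisation at two different axes forces the multipliers along these axes to agree.\<close>
  have polar: "a i x * b j y + a i y * b j x = a j x * b i y + a j y * b i x" for i j x y
    using ab[of i "x + y" j] ab[of i x j] ab[of i y j]
    by (simp add: linear_add[OF lin_b] distrib_left distrib_right add.commute)
  have off: "b j (e i) = 0" "b j (J (e i)) = 0" if "i \<noteq> j" for i j
    using ab[of i "e i" j] ab[of i "J (e i)" j] that by (simp_all add: dual)
  have diag: "b j (e j) = b i (e i)" "b j (J (e j)) = \<i> * b i (e i)" if "i \<noteq> j" for i j
    using polar[of i "e i" j "e j"] polar[of i "e i" j "J (e j)"] off[OF that] off[OF that[symmetric]] that
    by (simp_all add: dual)
  define l where "l = b 1 (e 1)"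
  have l: "b j (e j) = l \<and> b j (J (e j)) = \<i> * l" for j
  proof -
    have "\<forall>j. b j (e j) = l \<and> b j (J (e j)) = \<i> * l"
      using diag[of 1 2] diag[of 1 3] diag[of 2 1] by (simp add: forall_3 l_def)
    then show ?thesis by blast
  qed
  have bl: "b j x = l * a j x" for j x
  proof -
    have "b j x = (\<Sum>i\<in>UNIV. if i = j then l * a j x else 0)"
      by (subst expand[of x], subst linear_sum[OF lin_b], rule sum.cong)
       (auto simp: linear_add[OF lin_b] linear_scale[OF lin_b] off l complex_eq_iff algebra_simps)
    then show ?thesis by simp
  qed
  have "b 1 (J' (e 1)) = - a 1 (e 1)" unfolding b_def J'(2) by simp
  then have "l * l = - 1" using bl[of 1 "J' (e 1)"] bl[of 1 "e 1"] by (simp add: b_def dual)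
  then have "(l - \<i>) * (l + \<i>) = 0" by (simp add: algebra_simps)
  then consider "l = \<i>" | "l = - \<i>" by (auto simp: eq_neg_iff_add_eq_0)
  then have "\<psi> = (\<lambda>v. Im (det3 a (v 0) (v 1) (v 2))) \<and> J' = J"
  proof cases
    case 1
    have eq: "J' x = J x" for x by (rule eqI) (use bl 1 in \<open>simp add: b_def\<close>)
    have "Im (F x y z) = Im (det3 a x y z)" for x y z
      using Re_F[of "J' x" y z] F(1) by (simp add: eq)
    then have "\<psi> v = Im (det3 a (v 0) (v 1) (v 2))" for v using Fv[of v] by (metis complex.sel(2))
    then show ?thesis using eq by auto
  next
    case 2
    have eq: "J' x = - J x" for x by (rule eqI) (use bl 2 in \<open>simp add: b_def\<close>)
    have m: "det3 a (- x) y z = - det3 a x y z" for x y z by (simp add: det3_code algebra_simps)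
    have "Im (F x y z) = - Im (det3 a x y z)" for x y z
      using Re_F[of "J' x" y z] F(1) by (simp add: eq m)
    then have "\<psi> v = - Im (det3 a (v 0) (v 1) (v 2))" for v using Fv[of v] by (metis complex.sel(2))
    then have "\<psi> = (\<lambda>v. - Im (det3 a (v 0) (v 1) (v 2)))" by blast
    then show ?thesis using pos pos' by (simp add: positive_top_form_def wedge_minus_right)
  qed
  then show "\<psi> = (\<lambda>v. Im (det3 a (v 0) (v 1) (v 2)))" "J' = J" by auto
qed

text \<open>Evaluates the description operators behind \<open>star_form\<close> and
  \<open>J_form\<close>; afterwards both are accessible through an adapted frame.\<close>

theorem A3plus_frame:
  assumes "\<phi> \<in> A3plus"
  obtains a e where "complex_frame (J_form \<phi>) a e"
    "\<And>v. \<phi> v = Re (det3 a (v 0) (v 1) (v 2))" "\<And>v. star_form \<phi> v = Im (det3 a (v 0) (v 1) (v 2))"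
proof -
  obtain J a e where a: "complex_frame J a e" "\<phi> = (\<lambda>v. Re (det3 a (v 0) (v 1) (v 2)))"
    "positive_top_form (wedge 3 3 \<phi> (\<lambda>v. Im (det3 a (v 0) (v 1) (v 2))))"
    by (rule A3plus_positive_frame[OF assms])
  interpret complex_frame J a e by (rule a(1))
  have "(THE x. associated \<phi> x) = ((\<lambda>v. Im (det3 a (v 0) (v 1) (v 2))), J)"
  proof (rule the_equality)
    show "associated \<phi> ((\<lambda>v. Im (det3 a (v 0) (v 1) (v 2))), J)"
      unfolding a(2) by (rule associated_Re_det3) (use a(3) in \<open>simp add: a(2)\<close>)
    fix x assume "associated \<phi> x"
    then show "x = ((\<lambda>v. Im (det3 a (v 0) (v 1) (v 2))), J)"
      using associated_Re_det3_unique[of "fst x" "snd x"] a(3) unfolding a(2) by (cases x) auto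
  qed
  then have "J_form \<phi> = J" "star_form \<phi> = (\<lambda>v. Im (det3 a (v 0) (v 1) (v 2)))"
    by (simp_all add: J_form_def star_form_def)
  then show ?thesis using that[of a e] a by simp
qed

section \<open>The (0,2)-part of a two-form\<close>

definition wedge22 :: "(V \<Rightarrow> V \<Rightarrow> complex) \<Rightarrow> (V \<Rightarrow> V \<Rightarrow> complex) \<Rightarrow> V \<Rightarrow> V \<Rightarrow> V \<Rightarrow> V \<Rightarrow> complex" where
  "wedge22 D C x y z w = D x y * C z w - D x z * C y w + D x w * C y z
     + D y z * C x w - D y w * C x z + D z w * C x y"

definition wedge13 :: "(V \<Rightarrow> complex) \<Rightarrow> (V \<Rightarrow> V \<Rightarrow> V \<Rightarrow> complex) \<Rightarrow> V \<Rightarrow> V \<Rightarrow> V \<Rightarrow> V \<Rightarrow> complex" where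
  "wedge13 p T x y z w = p x * T y z w - p y * T x z w + p z * T x y w - p w * T x y z"

text \<open>Only sign rules are recorded: adjacent transpositions generate all permutations, and the
  rule for -x serves J (J x) = -x. In this form the property is easily carried from a complex-valued
  formula to the real function that it embeds.\<close>

definition alternating4 :: "(V \<Rightarrow> V \<Rightarrow> V \<Rightarrow> V \<Rightarrow> 'a::ring) \<Rightarrow> bool" where
  "alternating4 P \<longleftrightarrow> (\<forall>x y z w. P x y z w + P y x z w = 0 \<and> P x y z w + P x z y w = 0 \<and>
     P x y z w + P x y w z = 0 \<and> P (- x) y z w = - P x y z w)"

context complex_frame begin

text \<open>D, extended complex bilinearly, at the (0,1)-parts (x + i J x)/2 and (y + i J
  y)/2.\<close>

definition part02 :: "(V \<Rightarrow> V \<Rightarrow> complex) \<Rightarrow> V \<Rightarrow> V \<Rightarrow> complex" where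
  "part02 D x y = (D x y - D (J x) (J y) + \<i> * (D (J x) y + D x (J y))) / 4"

text \<open>Up to the factor 4, \<open>contract02 G\<close> is G with the projection \<open>(1 + \<i>J)/2\<close> to vectors of type (0,1)
  applied to its first two arguments.\<close>

definition contract02 :: "(V \<Rightarrow> V \<Rightarrow> V \<Rightarrow> V \<Rightarrow> complex) \<Rightarrow> V \<Rightarrow> V \<Rightarrow> V \<Rightarrow> V \<Rightarrow> complex" where
  "contract02 G x y z w = G x y z w - G (J x) (J y) z w + \<i> * (G (J x) y z w + G x (J y) z w)"

lemma minor_J [simp]: "minor a i (J x) y = \<i> * minor a i x y" "minor a i x (J y) = \<i> * minor a i x y"
  by (simp_all add: minor_def cross_fun_def algebra_simps)

text \<open>In each term at least one of the two (0,1)-arguments enters \<open>det3\<close>, which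
  is of type (3,0) and vanishes there.\<close>

lemma contract02_wedge13: "contract02 (wedge13 p (det3 a)) x y z w = 0"
  by (simp add: contract02_def wedge13_def algebra_simps)

text \<open>A \<open>minor\<close> has type (2,0), so the only surviving term is the one in which D
  receives both (0,1)-arguments.\<close>

lemma contract02_wedge22:
  "contract02 (wedge22 D (minor a i)) x y z w = 4 * part02 D x y * minor a i z w"
  by (simp add: contract02_def wedge22_def part02_def algebra_simps)

text \<open>For real P the hypothesis says that J may be moved between any two slots at the cost of a sign;
  a round trip through three slots then returns the value with the opposite sign.\<close>

lemma alternating4_zero:
  fixes P :: "V \<Rightarrow> V \<Rightarrow> V \<Rightarrow> V \<Rightarrow> real"
  assumes P: "alternating4 P"
    and 0: "\<And>x y z w. contract02 (\<lambda>x y z w. complex_of_real (P x y z w)) x y z w = 0"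
  shows "P x y z w = 0"
proof -
  have s12: "P x y z w = - P y x z w" and s23: "P x y z w = - P x z y w" and neg: "P (- x) y z w = - P x y z w" for x y z w
    using P unfolding alternating4_def by (metis eq_neg_iff_add_eq_0)+
  have 1: "P (J x) y z w = - P x (J y) z w" for x y z w
    using arg_cong[OF 0[of x y z w], of Im] by (simp add: contract02_def)
  have 2: "P (J x) y z w = - P x y (J z) w" for x y z w
    using 1[of x z y w] s23[of "J x" y z w] s23[of x y "J z" w] by simp
  have 3: "P x (J y) z w = - P x y (J z) w" for x y z w
    using 2[of y x z w] s12[of x "J y" z w] s12[of x y "J z" w] by simp
  have "P (J x) y z w = 0" for x y z w
    using 1[of x y z w] 2[of x y z w] 3[of x y z w] by simp
  from this[of "J x" y z w] show ?thesis by (simp add: neg)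
qed

lemma alternating2_part02:
  assumes "alternating2 D"
  shows "alternating2 (part02 D)" "part02 D (J x) y = - \<i> * part02 D x y"
proof -
  note b = assms[unfolded alternating2_def, THEN conjunct1]
  note lin = bilinear_ladd[OF b] bilinear_radd[OF b] bilinear_lmul[OF b] bilinear_rmul[OF b]
    bilinear_lneg[OF b] bilinear_rneg[OF b]
  have diag: "D x x = 0" for x using assms by (simp add: alternating2_def)
  have "part02 D x x = 0" for x
    using alternating2_commute[OF assms, of "J x" x] by (simp add: part02_def diag)
  then show "alternating2 (part02 D)"
    by (auto simp: alternating2_def bilinear_def linear_iff part02_def lin scaleR_conv_of_real[where 'a=complex]
        add_divide_distrib diff_divide_distrib algebra_simps)
  show "part02 D (J x) y = - \<i> * part02 D x y"
    by (simp add: part02_def lin field_simps)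
qed

lemma alternating2_20_expand:
  assumes F: "alternating2 F" "\<And>x y. F (J x) y = \<i> * F x y"
  shows "F x y = (\<Sum>i\<in>UNIV. \<Sum>j\<in>UNIV. a i x * a j y * F (e i) (e j))"
proof -
  have lin: "linear (\<lambda>x. F x y)" "linear (F x)" for x y
    using F(1) by (auto simp: alternating2_def bilinear_def)
  have J2: "F x (J y) = \<i> * F x y" for x y
    using F(2)[of y x] alternating2_commute[OF F(1), of x "J y"] alternating2_commute[OF F(1), of x y] by simp
  have "F x y = (\<Sum>i\<in>UNIV. a i x * F (e i) y)"
    by (rule linear_expand[OF lin(1)]) (rule F(2))
  also have "\<dots> = (\<Sum>i\<in>UNIV. a i x * (\<Sum>j\<in>UNIV. a j y * F (e i) (e j)))"
    by (intro sum.cong refl arg_cong2[of _ _ _ _ "(*)"] linear_expand[OF lin(2)] J2)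
  finally show ?thesis by (simp add: sum_distrib_left mult.assoc)
qed

lemma alternating2_02_expand:
  assumes F: "alternating2 F" "\<And>x y. F (J x) y = - \<i> * F x y"
  shows "F x y = (\<Sum>i\<in>UNIV. \<Sum>j\<in>UNIV. cnj (a i x) * cnj (a j y) * F (e i) (e j))"
proof -
  have lin: "linear (\<lambda>x. F x y)" "linear (F x)" for x y
    using F(1) by (auto simp: alternating2_def bilinear_def)
  have J2: "F x (J y) = - \<i> * F x y" for x y
    using F(2)[of y x] alternating2_commute[OF F(1), of x "J y"] alternating2_commute[OF F(1), of x y] by simp
  have "F x y = (\<Sum>i\<in>UNIV. cnj (a i x) * F (e i) y)"
    by (rule antilinear_expand[OF lin(1)]) (rule F(2))
  also have "\<dots> = (\<Sum>i\<in>UNIV. cnj (a i x) * (\<Sum>j\<in>UNIV. cnj (a j y) * F (e i) (e j)))"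
    by (intro sum.cong refl arg_cong2[of _ _ _ _ "(*)"] antilinear_expand[OF lin(2)] J2)
  finally show ?thesis by (simp add: sum_distrib_left mult.assoc)
qed

lemma alternating2_02_minor:
  assumes F: "alternating2 F" "\<And>x y. F (J x) y = - \<i> * F x y"
  shows "F x y = (\<Sum>j\<in>UNIV. F (e (j + 1)) (e (j + 2)) * cnj (minor a j x y))"
proof -
  have "F (e i) (e i) = 0" for i using F(1) by (simp add: alternating2_def)
  then show ?thesis
    using alternating2_commute[OF F(1), of "e 2" "e 1"] alternating2_commute[OF F(1), of "e 3" "e 1"]
      alternating2_commute[OF F(1), of "e 3" "e 2"]
    by (subst alternating2_02_expand[OF F]) (simp add: sum_3 minor_def cross_fun_def algebra_simps)
qed

text \<open>S is the component of F that is linear in the first and antilinear in the second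
  argument; its antisymmetrisation F x y = S x y - S y x returns F.\<close>

lemma alternating2_11_expand:
  assumes F: "alternating2 F" "\<And>x y. F (J x) (J y) = F x y"
  defines "S \<equiv> \<lambda>x y. (F x y - \<i> * F (J x) y) / 2"
  shows "F x y = (\<Sum>i\<in>UNIV. \<Sum>j\<in>UNIV. S (e i) (e j) * (a i x * cnj (a j y) - a i y * cnj (a j x)))"
proof -
  note b = F(1)[unfolded alternating2_def, THEN conjunct1]
  note lin = bilinear_ladd[OF b] bilinear_radd[OF b] bilinear_lmul[OF b] bilinear_rmul[OF b]
    bilinear_lneg[OF b] bilinear_rneg[OF b]
  have J2: "F x (J y) = - F (J x) y" for x y
    using F(2)[of x "J y"] by (simp add: lin)
  have linS: "linear (\<lambda>x. S x y)" "linear (S x)" for x y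
    by (auto simp: S_def linear_iff lin scaleR_conv_of_real[where 'a=complex] add_divide_distrib diff_divide_distrib algebra_simps)
  have S1: "S (J x) y = \<i> * S x y" for x y
    by (simp add: S_def lin field_simps)
  have S2: "S x (J y) = - \<i> * S x y" for x y
    by (simp add: S_def J2 lin field_simps)
  have S: "S x y = (\<Sum>i\<in>UNIV. \<Sum>j\<in>UNIV. S (e i) (e j) * (a i x * cnj (a j y)))" for x y
  proof -
    have "S x y = (\<Sum>i\<in>UNIV. a i x * S (e i) y)"
      by (rule linear_expand[OF linS(1)]) (rule S1)
    also have "\<dots> = (\<Sum>i\<in>UNIV. a i x * (\<Sum>j\<in>UNIV. cnj (a j y) * S (e i) (e j)))"
      by (intro sum.cong refl arg_cong2[of _ _ _ _ "(*)"] antilinear_expand[OF linS(2)] S2)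
    finally show ?thesis by (simp add: sum_distrib_left mult_ac)
  qed
  have "F x y = S x y - S y x"
    using alternating2_commute[OF F(1), of y x] alternating2_commute[OF F(1), of "J y" x] J2[of x y]
    by (simp add: S_def field_simps)
  also have "\<dots> = (\<Sum>i\<in>UNIV. \<Sum>j\<in>UNIV. S (e i) (e j) * (a i x * cnj (a j y) - a i y * cnj (a j x)))"
    by (subst (1 2) S) (simp add: sum_subtractf right_diff_distrib)
  finally show ?thesis .
qed

text \<open>The expansion in products a i x * a j y is halved and antisymmetrised, so that each
  summand becomes a wedge of two (1,0)-covectors.\<close>

lemma of_type_20_eq:
  assumes F: "alternating2 F" "\<And>x y. F (J x) y = \<i> * F x y"
  shows "of_type J 2 0 (\<lambda>v. F (v 0) (v 1))"
proof -
  have "F x y = (\<Sum>i\<in>UNIV. \<Sum>j\<in>UNIV. (F (e i) (e j) / 2 * a i x) * a j y - (F (e i) (e j) / 2 * a i y) * a j x)" for x y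
  proof -
    have "F x y = (F x y - F y x) / 2" using alternating2_commute[OF F(1), of y x] by simp
    also have "\<dots> = (\<Sum>i\<in>UNIV. \<Sum>j\<in>UNIV. (F (e i) (e j) / 2 * a i x) * a j y - (F (e i) (e j) / 2 * a i y) * a j x)"
      by (subst alternating2_20_expand[OF F, of x y], subst alternating2_20_expand[OF F, of y x])
        (simp add: sum_subtractf sum_divide_distrib diff_divide_distrib mult_ac)
    finally show ?thesis .
  qed
  then have *: "(\<lambda>v. F (v 0) (v 1)) = (\<lambda>v. \<Sum>i\<in>UNIV. \<Sum>j\<in>UNIV.
      (F (e i) (e j) / 2 * a i (v 0)) * a j (v 1) - (F (e i) (e j) / 2 * a i (v 1)) * a j (v 0))"
    by (intro ext)
  \<comment> \<open>The rules of \<open>of_type\<close> provide the zero form of positive degree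
    only indirectly, here as a wedge with a zero covector; sums need it as their start.\<close>
  have 0: "of_type J 2 0 (\<lambda>v. 0)"
    using of_type_20I[OF covector10_scale[of J "a 1" 0] covector10[of 1], OF covector10] by simp
  show ?thesis
    unfolding * by (intro of_type_sum 0 of_type_20I covector10_scale covector10)
qed

lemma of_type_02_eq:
  assumes F: "alternating2 F" "\<And>x y. F (J x) y = - \<i> * F x y"
  shows "of_type J 0 2 (\<lambda>v. F (v 0) (v 1))"
proof -
  have "F x y = (\<Sum>i\<in>UNIV. \<Sum>j\<in>UNIV. cnj (cnj (F (e i) (e j) / 2) * a i x) * cnj (a j y)
      - cnj (cnj (F (e i) (e j) / 2) * a i y) * cnj (a j x))" for x y
  proof -
    have "F x y = (F x y - F y x) / 2" using alternating2_commute[OF F(1), of y x] by simp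
    also have "\<dots> = (\<Sum>i\<in>UNIV. \<Sum>j\<in>UNIV. cnj (cnj (F (e i) (e j) / 2) * a i x) * cnj (a j y)
      - cnj (cnj (F (e i) (e j) / 2) * a i y) * cnj (a j x))"
      by (subst alternating2_02_expand[OF F, of x y], subst alternating2_02_expand[OF F, of y x])
        (simp add: sum_subtractf sum_divide_distrib diff_divide_distrib mult_ac)
    finally show ?thesis .
  qed
  then have *: "(\<lambda>v. F (v 0) (v 1)) = (\<lambda>v. \<Sum>i\<in>UNIV. \<Sum>j\<in>UNIV.
      cnj (cnj (F (e i) (e j) / 2) * a i (v 0)) * cnj (a j (v 1))
      - cnj (cnj (F (e i) (e j) / 2) * a i (v 1)) * cnj (a j (v 0)))"
    by (intro ext)
  have 0: "of_type J 0 2 (\<lambda>v. 0)"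
    using of_type_02I[OF covector10_scale[of J "a 1" 0] covector10[of 1], OF covector10] by simp
  show ?thesis
    unfolding * by (intro of_type_sum 0 of_type_02I covector10_scale covector10)
qed

lemma of_type_11_sum:
  "of_type J 1 1 (\<lambda>v. \<Sum>i\<in>UNIV. \<Sum>j\<in>UNIV. H i j * (a i (v 0) * cnj (a j (v 1)) - a i (v 1) * cnj (a j (v 0))))"
proof -
  have *: "H i j * (a i x * cnj (a j y) - a i y * cnj (a j x)) =
      (H i j * a i x) * cnj (a j y) - (H i j * a i y) * cnj (a j x)" for i j x y
    by (simp add: algebra_simps)
  have 0: "of_type J 1 1 (\<lambda>v. 0)"
    using of_type_11I[OF covector10_scale[of J "a 1" 0] covector10[of 1], OF covector10] by simp
  show ?thesis
    unfolding * by (intro of_type_sum 0 of_type_11I covector10_scale covector10)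
qed

lemma of_type_11_eq:
  assumes F: "alternating2 F" "\<And>x y. F (J x) (J y) = F x y"
  shows "of_type J 1 1 (\<lambda>v. F (v 0) (v 1))"
  by (subst alternating2_11_expand[OF F]) (rule of_type_11_sum)

text \<open>Averaging over J splits D into pieces of type (0,2), (1,1) and (2,0), which gives
  existence. For uniqueness, \<open>part02\<close> fixes the (0,2)-piece of any such decomposition
  and annihilates the other two.\<close>

lemma type_component_02:
  assumes D: "alternating2 D"
  shows "type_component J 0 2 (\<lambda>v. D (v 0) (v 1)) = (\<lambda>v. part02 D (v 0) (v 1))"
  unfolding type_component_def
proof (rule the_equality)
  note b = D[unfolded alternating2_def, THEN conjunct1]
  note lin = bilinear_ladd[OF b] bilinear_radd[OF b] bilinear_lmul[OF b] bilinear_rmul[OF b]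
    bilinear_lneg[OF b] bilinear_rneg[OF b]
  have diag: "D x x = 0" for x using D by (simp add: alternating2_def)
  define D1 where "D1 = (\<lambda>x y. (D x y + D (J x) (J y)) / 2)"
  define D2 where "D2 = (\<lambda>x y. (D x y - D (J x) (J y) - \<i> * (D (J x) y + D x (J y))) / 4)"
  have "bilinear D1"
    by (simp add: bilinear_def linear_iff D1_def lin scaleR_conv_of_real[where 'a=complex] field_simps)
  moreover have "bilinear D2"
    by (simp add: bilinear_def linear_iff D2_def lin scaleR_conv_of_real[where 'a=complex] field_simps)
  moreover have "D1 x x = 0" "D2 x x = 0" for x
    using alternating2_commute[OF D, of "J x" x] by (simp_all add: D1_def D2_def diag)
  ultimately have "alternating2 D1" "alternating2 D2"
    by (simp_all add: alternating2_def)
  moreover have "D1 (J x) (J y) = D1 x y" "D2 (J x) y = \<i> * D2 x y" for x y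
    by (simp_all add: D1_def D2_def lin field_simps)
  moreover have "part02 D x y + D1 x y + D2 x y = D x y" for x y
    by (simp add: part02_def D1_def D2_def field_simps)
  ultimately show "\<exists>f. (\<forall>r\<le>0 + 2. of_type J r (0 + 2 - r) (f r)) \<and>
      (\<lambda>v. D (v 0) (v 1)) = (\<lambda>v. \<Sum>r\<le>0 + 2. f r v) \<and> (\<lambda>v. part02 D (v 0) (v 1)) = f 0"
    using of_type_02_eq[OF alternating2_part02[OF D]] of_type_11_eq[of D1] of_type_20_eq[of D2]
    by (intro exI[of _ "\<lambda>r. if r = 0 then (\<lambda>v. part02 D (v 0) (v 1))
         else if r = 1 then (\<lambda>v. D1 (v 0) (v 1)) else (\<lambda>v. D2 (v 0) (v 1))"])
       (auto simp: le_Suc_eq numeral_2_eq_2)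
next
  fix \<tau> assume "\<exists>f. (\<forall>r\<le>0 + 2. of_type J r (0 + 2 - r) (f r)) \<and>
      (\<lambda>v. D (v 0) (v 1)) = (\<lambda>v. \<Sum>r\<le>0 + 2. f r v) \<and> \<tau> = f 0"
  then obtain f where f: "\<And>r. r \<le> 2 \<Longrightarrow> of_type J r (2 - r) (f r)"
    "(\<lambda>v. D (v 0) (v 1)) = (\<lambda>v. \<Sum>r\<le>2. f r v)" "\<tau> = f 0" unfolding add_0 by blast
  obtain F0 where F0: "alternating2 F0" "\<And>x y. F0 (J x) y = - \<i> * F0 x y" "f 0 = (\<lambda>v. F0 (v 0) (v 1))"
    using of_type_02[of J 0 2 "f 0"] f(1)[of 0] by auto
  obtain F1 where F1: "alternating2 F1" "\<And>x y. F1 (J x) (J y) = F1 x y" "f 1 = (\<lambda>v. F1 (v 0) (v 1))"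
    using of_type_11[of J 1 1 "f 1"] f(1)[of 1] by auto
  obtain F2 where F2: "alternating2 F2" "\<And>x y. F2 (J x) y = \<i> * F2 x y" "f 2 = (\<lambda>v. F2 (v 0) (v 1))"
    using of_type_20[of J 2 0 "f 2"] f(1)[of 2] by auto
  have D_eq: "D x y = F0 x y + F1 x y + F2 x y" for x y
    using fun_cong[OF f(2), of "(\<lambda>_. y)(0 := x)"] F0(3) F1(3) F2(3) by (simp add: numeral_2_eq_2)
  have F0J: "F0 x (J y) = - \<i> * F0 x y" for x y
    using F0(2)[of y x] alternating2_commute[OF F0(1), of x "J y"] alternating2_commute[OF F0(1), of x y] by simp
  have F2J: "F2 x (J y) = \<i> * F2 x y" for x y
    using F2(2)[of y x] alternating2_commute[OF F2(1), of x "J y"] alternating2_commute[OF F2(1), of x y] by simp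
  have F1J: "F1 x (J y) = - F1 (J x) y" for x y
    using F1(2)[of x "J y"] F1(1) by (simp add: alternating2_def bilinear_rneg)
  have F1n: "F1 (- x) y = - F1 x y" for x y
    using F1(1) by (simp add: alternating2_def bilinear_lneg)
  have "part02 D x y = F0 x y" for x y
    by (simp add: part02_def D_eq F0(2) F0J F1(2) F1J F1n F2(2) F2J field_simps)
  then show "\<tau> = (\<lambda>v. part02 D (v 0) (v 1))" by (simp add: f(3) F0(3))
qed

end

section \<open>Squares of real (1,1)-forms\<close>

context complex_frame begin

text \<open>The factor i/2 is that of a unitary coframing; with it the form at (x, J x) is the value
  of the Hermitian form H on the coordinates of x.\<close>

definition herm_eval :: "(3 \<Rightarrow> 3 \<Rightarrow> complex) \<Rightarrow> V \<Rightarrow> V \<Rightarrow> complex" where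
  "herm_eval H x y = \<i> / 2 * (\<Sum>i\<in>UNIV. \<Sum>j\<in>UNIV. H i j * (a i x * cnj (a j y) - a i y * cnj (a j x)))"

definition has_matrix :: "real form \<Rightarrow> (3 \<Rightarrow> 3 \<Rightarrow> complex) \<Rightarrow> bool" where
  "has_matrix \<eta> H \<longleftrightarrow> (\<forall>v. complex_of_real (\<eta> v) = herm_eval H (v 0) (v 1))"

text \<open>This is 2 \<eta>^2: of the factor 4, one 2 is the constant in d\<phi> = 2 \<eta>^2 and
  the other comes from \<open>wedge_2_2\<close>.\<close>

definition herm_square :: "(3 \<Rightarrow> 3 \<Rightarrow> complex) \<Rightarrow> V \<Rightarrow> V \<Rightarrow> V \<Rightarrow> V \<Rightarrow> complex" where
  "herm_square H x y z w = 4 * (herm_eval H x y * herm_eval H z w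
     - herm_eval H x z * herm_eval H y w + herm_eval H x w * herm_eval H y z)"

lemma herm_eval_J: "herm_eval H (J x) (J y) = herm_eval H x y" "herm_eval H x (J y) = - herm_eval H (J x) y"
  by (simp_all add: herm_eval_def sum_3) (simp_all add: algebra_simps)

lemma herm_eval_minus: "herm_eval H (- x) y = - herm_eval H x y"
  by (simp add: herm_eval_def sum_3) (simp add: algebra_simps)

lemma herm_eval_commute: "herm_eval H x y = - herm_eval H y x"
proof -
  have "(\<Sum>i\<in>UNIV. \<Sum>j\<in>UNIV. H i j * (a i x * cnj (a j y) - a i y * cnj (a j x))) =
     - (\<Sum>i\<in>UNIV. \<Sum>j\<in>UNIV. H i j * (a i y * cnj (a j x) - a i x * cnj (a j y)))"
    unfolding sum_negf[symmetric] by (simp add: algebra_simps)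
  then show ?thesis by (simp add: herm_eval_def)
qed

text \<open>A (1,1)-form vanishes on two (0,1)-vectors, so the first product drops out and a two by
  two determinant in m remains, m being the form with a (0,1)-vector in its first slot. The Lagrange
  identity writes it in cross products, where H acts by its cofactors.\<close>

lemma contract02_herm_square:
  "contract02 (herm_square H) x y z w =
     4 * (\<Sum>i\<in>UNIV. (\<Sum>j\<in>UNIV. cofac H i j * cnj (minor a j x y)) * minor a i z w)"
proof -
  define m where "m = (\<lambda>x y. herm_eval H x y + \<i> * herm_eval H (J x) y)"
  define h where "h = (\<lambda>x i. \<Sum>j\<in>UNIV. H i j * cnj (a j x))"
  have m: "m x y = - \<i> * (\<Sum>i\<in>UNIV. h x i * a i y)" for x y
    by (simp add: m_def h_def herm_eval_def sum_distrib_left sum_distrib_right sum.distrib[symmetric]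
      sum_negf[symmetric] algebra_simps)
  have "contract02 (herm_square H) x y z w = 4 * (m x w * m y z - m x z * m y w)"
    by (simp add: contract02_def herm_square_def m_def herm_eval_J herm_eval_minus algebra_simps)
  also have "m x w * m y z - m x z * m y w =
      (\<Sum>i\<in>UNIV. h x i * a i z) * (\<Sum>i\<in>UNIV. h y i * a i w) - (\<Sum>i\<in>UNIV. h x i * a i w) * (\<Sum>i\<in>UNIV. h y i * a i z)"
    unfolding m by (simp add: algebra_simps)
  also have "\<dots> = (\<Sum>i\<in>UNIV. cross_fun (h x) (h y) i * minor a i z w)"
    unfolding minor_def lagrange_cross_fun ..
  also have "\<dots> = (\<Sum>i\<in>UNIV. (\<Sum>j\<in>UNIV. cofac H i j * cnj (minor a j x y)) * minor a i z w)"
  proof -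
    have "cross_fun (h x) (h y) i = (\<Sum>j\<in>UNIV. cofac H i j * cnj (minor a j x y))" for i
      unfolding h_def cross_fun_cofac by (simp add: minor_def cross_fun_def)
    then show ?thesis by simp
  qed
  finally show ?thesis .
qed

lemma minor_pairing_e:
  "(\<Sum>i\<in>UNIV. (\<Sum>j\<in>UNIV. M i j * cnj (minor a j (e (l + 1)) (e (l + 2)))) * minor a i (e (k + 1)) (e (k + 2))) = M k l"
proof -
  have "(\<Sum>j\<in>UNIV. M i j * cnj (minor a j (e (l + 1)) (e (l + 2)))) = M i l" for i
  proof -
    have "(\<Sum>j\<in>UNIV. M i j * cnj (minor a j (e (l + 1)) (e (l + 2)))) = (\<Sum>j\<in>UNIV. if j = l then M i j else 0)"
      unfolding minor_e by (intro sum.cong) auto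
    then show ?thesis by simp
  qed
  moreover have "(\<Sum>i\<in>UNIV. M i l * minor a i (e (k + 1)) (e (k + 2))) = (\<Sum>i\<in>UNIV. if i = k then M i l else 0)"
    unfolding minor_e by (intro sum.cong) auto
  ultimately show ?thesis by simp
qed

lemma has_matrix_wedge_square:
  assumes "has_matrix \<eta> H"
  shows "complex_of_real (2 * wedge 2 2 \<eta> \<eta> v) = herm_square H (v 0) (v 1) (v 2) (v 3)"
proof -
  define E where "E = (\<lambda>x y. Re (herm_eval H x y))"
  have \<eta>: "\<eta> = (\<lambda>v. E (v 0) (v 1))"
  proof
    fix v show "\<eta> v = E (v 0) (v 1)"
      using assms unfolding has_matrix_def E_def by (metis Re_complex_of_real)
  qed
  have E: "complex_of_real (E x y) = herm_eval H x y" for x y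
    using assms[unfolded has_matrix_def, rule_format, of "(\<lambda>_. y)(0 := x)"] by (simp add: \<eta>)
  have anti: "E x y = - E y x" for x y
    using herm_eval_commute[of H x y] by (simp add: E_def)
  have "wedge 2 2 \<eta> \<eta> v = 2 * (E (v 0) (v 1) * E (v 2) (v 3) - E (v 0) (v 2) * E (v 1) (v 3) + E (v 0) (v 3) * E (v 1) (v 2))"
    unfolding \<eta> by (simp only: wedge_2_2[of E, OF anti])
  then show ?thesis by (simp add: herm_square_def E)
qed

lemma wedge_square_cofac_eq:
  assumes "has_matrix \<eta> H" "has_matrix \<eta>' H'"
    and eq: "(\<lambda>v. 2 * wedge 2 2 \<eta> \<eta> v) = (\<lambda>v. 2 * wedge 2 2 \<eta>' \<eta>' v)"
  shows "cofac H = cofac H'"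
proof (intro ext)
  fix k l
  have "herm_square H x y z w = herm_square H' x y z w" for x y z w
    using has_matrix_wedge_square[OF assms(1), of "vec4 x y z w"]
      has_matrix_wedge_square[OF assms(2), of "vec4 x y z w"] fun_cong[OF eq, of "vec4 x y z w"]
    by (simp add: vec4_def)
  then have "herm_square H = herm_square H'" by blast
  then have "4 * cofac H k l = 4 * cofac H' k l"
    using contract02_herm_square[of H "e (l + 1)" "e (l + 2)" "e (k + 1)" "e (k + 2)"]
     contract02_herm_square[of H' "e (l + 1)" "e (l + 2)" "e (k + 1)" "e (k + 2)"]
    unfolding minor_pairing_e by simp
  then show "cofac H k l = cofac H' k l" by simp
qed

lemma real_11_has_matrix:
  assumes "real_11 J \<eta>"
  obtains H where "has_matrix \<eta> H"
proof -
  obtain F where F: "alternating2 F" "\<And>x y. F (J x) (J y) = F x y" "complex_form \<eta> = (\<lambda>v. F (v 0) (v 1))"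
    using of_type_11[of J 1 1 "complex_form \<eta>"] assms by (auto simp: real_11_def)
  define S where "S = (\<lambda>x y. (F x y - \<i> * F (J x) y) / 2)"
  \<comment> \<open>The factor -2 i is the inverse of the i/2 in \<open>herm_eval\<close>.\<close>
  have "has_matrix \<eta> (\<lambda>i j. - 2 * \<i> * S (e i) (e j))"
    unfolding has_matrix_def
  proof
    fix v
    have "complex_of_real (\<eta> v) = F (v 0) (v 1)" using fun_cong[OF F(3), of v] by (simp add: complex_form_def)
    also have "\<dots> = (\<Sum>i\<in>UNIV. \<Sum>j\<in>UNIV. S (e i) (e j) * (a i (v 0) * cnj (a j (v 1)) - a i (v 1) * cnj (a j (v 0))))"
      unfolding S_def by (rule alternating2_11_expand[OF F(1,2)])
    also have "\<dots> = herm_eval (\<lambda>i j. - 2 * \<i> * S (e i) (e j)) (v 0) (v 1)"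
      unfolding herm_eval_def sum_distrib_left by (intro sum.cong refl) simp
    finally show "complex_of_real (\<eta> v) = herm_eval (\<lambda>i j. - 2 * \<i> * S (e i) (e j)) (v 0) (v 1)" .
  qed
  then show ?thesis by (rule that)
qed

lemma has_matrix_real_11:
  assumes "has_matrix \<eta> H"
  shows "real_11 J \<eta>"
proof -
  have "complex_form \<eta> = (\<lambda>v. \<Sum>i\<in>UNIV. \<Sum>j\<in>UNIV. (\<i> / 2 * H i j) * (a i (v 0) * cnj (a j (v 1)) - a i (v 1) * cnj (a j (v 0))))"
    using assms by (simp add: complex_form_def has_matrix_def herm_eval_def sum_distrib_left mult.assoc)
  then show ?thesis unfolding real_11_def using of_type_11_sum[of "\<lambda>i j. \<i> / 2 * H i j"] by simp
qed

lemma wedge_square_inject_up_to_sign: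
  assumes "has_matrix \<eta> H" "det_fun H \<noteq> 0" "real_11 J \<eta>'"
    and eq: "(\<lambda>v. 2 * wedge 2 2 \<eta> \<eta> v) = (\<lambda>v. 2 * wedge 2 2 \<eta>' \<eta>' v)"
  shows "\<eta>' = \<eta> \<or> \<eta>' = (\<lambda>v. - \<eta> v)"
proof -
  obtain H' where H': "has_matrix \<eta>' H'" using real_11_has_matrix[OF assms(3)] .
  have "cofac H = cofac H'" by (rule wedge_square_cofac_eq[OF assms(1) H' eq])
  then have "H = H' \<or> H = (\<lambda>i j. - H' i j)" using cofac_inject_up_to_sign assms(2) by blast
  then show ?thesis
  proof
    assume "H = H'"
    then have "complex_of_real (\<eta>' v) = complex_of_real (\<eta> v)" for v
      using assms(1) H' by (simp add: has_matrix_def)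
    then show ?thesis by auto
  next
    assume "H = (\<lambda>i j. - H' i j)"
    then have "complex_of_real (\<eta> v) = - complex_of_real (\<eta>' v)" for v
      using assms(1) H' by (simp add: has_matrix_def herm_eval_def sum_negf)
    then have "\<eta> v = - \<eta>' v" for v by (metis of_real_eq_iff of_real_minus)
    then have "\<eta>' = (\<lambda>v. - \<eta> v)" by auto
    then show ?thesis by blast
  qed
qed

lemma has_matrix_diagonal:
  assumes "has_matrix \<eta> H"
  shows "\<eta> (vec2 x (J x)) = Re (hermitian_form H (\<lambda>i. a i x) (\<lambda>i. a i x))"
proof -
  have "complex_of_real (\<eta> (vec2 x (J x))) = herm_eval H x (J x)"
    using assms by (simp add: has_matrix_def vec2_def)
  also have "\<dots> = hermitian_form H (\<lambda>i. a i x) (\<lambda>i. a i x)"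
    unfolding herm_eval_def hermitian_form_def sum_distrib_left
    by (intro sum.cong refl) (simp add: algebra_simps)
  finally show ?thesis by (metis Re_complex_of_real)
qed

lemma diagonalizes_has_matrix:
  assumes "diagonalizes s (\<lambda>i. covector (a i)) \<eta>"
  shows "has_matrix \<eta> (\<lambda>i j. if i = j then of_real (eps s i) else 0)"
  unfolding has_matrix_def
proof
  fix v
  have "cnj_form (covector (a i)) = covector (\<lambda>x. cnj (a i x))" for i
    by (simp add: cnj_form_def covector_def)
  then have "complex_of_real (\<eta> v) = \<i> / 2 * (\<Sum>i\<in>UNIV. of_real (eps s i) *
      (a i (v 0) * cnj (a i (v 1)) - a i (v 1) * cnj (a i (v 0))))"
    using fun_cong[OF assms[unfolded diagonalizes_def], of v] by (simp add: complex_form_def wedge_covector[unfolded One_nat_def])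
  also have "\<dots> = herm_eval (\<lambda>i j. if i = j then of_real (eps s i) else 0) (v 0) (v 1)"
    by (simp add: herm_eval_def if_distrib[of "\<lambda>c. c * _"] cong: if_cong)
  finally show "complex_of_real (\<eta> v) = herm_eval (\<lambda>i j. if i = j then of_real (eps s i) else 0) (v 0) (v 1)" .
qed

text \<open>A real relation among the four vectors is a complex relation between the coordinate
  vectors of u and w; eliminating one of these by Cramer's rule multiplies each coefficient by the
  nonzero minor.\<close>

lemma complex_plane_dim:
  assumes nz: "minor a k u w \<noteq> 0"
  shows "dim (span {u, J u, w, J w}) = 4"
proof -
  have comb: "r1 = 0 \<and> r2 = 0 \<and> r3 = 0 \<and> r4 = 0"
    if "r1 *\<^sub>R u + r2 *\<^sub>R J u + r3 *\<^sub>R w + r4 *\<^sub>R J w = 0" for r1 r2 r3 r4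
  proof -
    have "a i (r1 *\<^sub>R u + r2 *\<^sub>R J u + r3 *\<^sub>R w + r4 *\<^sub>R J w) = 0" for i
      using that by simp
    then have 0: "Complex r1 r2 * a i u + Complex r3 r4 * a i w = 0" for i
      by (simp add: scaleR_conv_of_real[where 'a=complex] Complex_eq algebra_simps)
    have "Complex r1 r2 * minor a k u w = (Complex r1 r2 * a (k + 1) u + Complex r3 r4 * a (k + 1) w) * a (k + 2) w
        - (Complex r1 r2 * a (k + 2) u + Complex r3 r4 * a (k + 2) w) * a (k + 1) w"
      by (simp add: minor_def cross_fun_def algebra_simps)
    moreover have "Complex r3 r4 * minor a k u w = (Complex r1 r2 * a (k + 2) u + Complex r3 r4 * a (k + 2) w) * a (k + 1) u
        - (Complex r1 r2 * a (k + 1) u + Complex r3 r4 * a (k + 1) w) * a (k + 2) u"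
      by (simp add: minor_def cross_fun_def algebra_simps)
    ultimately have "Complex r1 r2 * minor a k u w = 0" "Complex r3 r4 * minor a k u w = 0"
      unfolding 0 by simp_all
    then have "Complex r1 r2 = 0" "Complex r3 r4 = 0" using nz by simp_all
    then show ?thesis by (simp add: complex_eq_iff)
  qed
  have distinct: "u \<noteq> J u" "u \<noteq> w" "u \<noteq> J w" "J u \<noteq> w" "J u \<noteq> J w" "w \<noteq> J w"
    using comb[of 1 "- 1" 0 0] comb[of 1 0 "- 1" 0] comb[of 1 0 0 "- 1"] comb[of 0 1 "- 1" 0]
      comb[of 0 1 0 "- 1"] comb[of 0 0 1 "- 1"] by auto
  have "independent {u, J u, w, J w}"
    unfolding independent_explicit
  proof (intro conjI allI impI ballI)
    show "finite {u, J u, w, J w}" by simp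
    fix c v assume "(\<Sum>v\<in>{u, J u, w, J w}. c v *\<^sub>R v) = 0" and v: "v \<in> {u, J u, w, J w}"
    then have "c u *\<^sub>R u + c (J u) *\<^sub>R J u + c w *\<^sub>R w + c (J w) *\<^sub>R J w = 0"
      using distinct by (simp add: add.assoc)
    from comb[OF this] v show "c v = 0" by auto
  qed
  then have "dim (span {u, J u, w, J w}) = card {u, J u, w, J w}"
    by (simp add: dim_span dim_eq_card_independent)
  then show ?thesis using distinct by simp
qed

lemma positive_on_complex_planesD:
  assumes "positive_on_complex_planes J \<pi>" "minor a k u w \<noteq> 0"
  shows "\<pi> (vec4 u (J u) w (J w)) > 0"
proof -
  let ?W = "span {u, J u, w, J w}"
  have "J ` ?W = span (J ` {u, J u, w, J w})"
    by (rule linear_span_image[OF linear_J, symmetric])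
  also have "\<dots> \<subseteq> ?W"
    by (intro span_minimal) (auto intro: span_base span_neg)
  finally show ?thesis
    using assms complex_plane_dim[OF assms(2)] unfolding positive_on_complex_planes_def by blast
qed

end

lemma alternating4_diff:
  fixes P Q :: "V \<Rightarrow> V \<Rightarrow> V \<Rightarrow> V \<Rightarrow> real"
  assumes "alternating4 P" "alternating4 Q"
  shows "alternating4 (\<lambda>x y z w. P x y z w - Q x y z w)"
  unfolding alternating4_def
proof (intro allI conjI)
  fix x y z w
  note p = assms(1)[unfolded alternating4_def, rule_format, of x y z w]
  note q = assms(2)[unfolded alternating4_def, rule_format, of x y z w]
  show "P x y z w - Q x y z w + (P y x z w - Q y x z w) = 0" using p q by linarith
  show "P x y z w - Q x y z w + (P x z y w - Q x z y w) = 0" using p q by linarith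
  show "P x y z w - Q x y z w + (P x y w z - Q x y w z) = 0" using p q by linarith
  show "P (- x) y z w - Q (- x) y z w = - (P x y z w - Q x y z w)" using p q by linarith
qed

context complex_frame begin

text \<open>The contraction is complex linear in z and w, so up to a factor it is P at (0,1)-parts
  of x, y and (1,0)-parts of z, w. As P is real, conjugation exchanges these types, and moving a
  pair past a pair costs no sign.\<close>

lemma contract02_hermitian:
  fixes P :: "V \<Rightarrow> V \<Rightarrow> V \<Rightarrow> V \<Rightarrow> real"
  assumes P: "alternating4 P"
    and K: "\<And>x y z w. contract02 (\<lambda>x y z w. complex_of_real (P x y z w)) x y z w =
      4 * (\<Sum>i\<in>UNIV. (\<Sum>j\<in>UNIV. M i j * cnj (minor a j x y)) * minor a i z w)"
  shows "M l k = cnj (M k l)"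
proof -
  define K where "K = contract02 (\<lambda>x y z w. complex_of_real (P x y z w))"
  have s12: "P x y z w = - P y x z w" and s23: "P x y z w = - P x z y w" and s34: "P x y z w = - P x y w z"
    and neg: "P (- x) y z w = - P x y z w" for x y z w
    using P unfolding alternating4_def by (metis eq_neg_iff_add_eq_0)+
  have swap: "P z w x y = P x y z w" for x y z w
    using s23[of z w x y] s12[of z x w y] s34[of x z w y] s23[of x z y w] by simp
  have neg2: "P x (- y) z w = - P x y z w" for x y z w
    using s12[of x "- y" z w] s12[of x y z w] by (simp add: neg)
  have neg3: "P x y (- z) w = - P x y z w" "P x y z (- w) = - P x y z w" for x y z w
    using swap[of "- z" w x y] swap[of z w x y] swap[of z "- w" x y] by (simp_all add: neg neg2)
  have KJ: "K x y (J z) w = \<i> * K x y z w" "K x y z (J w) = \<i> * K x y z w" for x y z w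
    unfolding K_def K by (simp_all add: sum_distrib_left mult_ac)
  have KJJ: "K x y (J z) (J w) = - K x y z w" for x y z w by (simp add: KJ)
  \<comment> \<open>Over the reals this is a linear consequence of \<open>KJ\<close> and of the pair
    exchange at all 16 ways to apply J to some of the four arguments.\<close>
  have "cnj (K x y z w) = K z w x y" for x y z w
  proof (rule complex_eqI)
    note exp = K_def contract02_def
    note eqs = KJ(1)[of x y z w] KJ(2)[of x y z w] KJJ[of x y z w] KJ(1)[of z w x y] KJ(2)[of z w x y] KJJ[of z w x y]
    show "Re (cnj (K x y z w)) = Re (K z w x y)"
      using eqs[THEN arg_cong[of _ _ Re]] eqs[THEN arg_cong[of _ _ Im]]
        swap[of x y z w] swap[of "J x" y z w] swap[of x "J y" z w] swap[of x y "J z" w] swap[of x y z "J w"]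
        swap[of "J x" "J y" z w] swap[of "J x" y "J z" w] swap[of "J x" y z "J w"] swap[of x "J y" "J z" w]
        swap[of x "J y" z "J w"] swap[of x y "J z" "J w"]
        swap[of "J x" "J y" "J z" w] swap[of "J x" "J y" z "J w"] swap[of "J x" y "J z" "J w"]
        swap[of x "J y" "J z" "J w"] swap[of "J x" "J y" "J z" "J w"]
      unfolding exp by (simp add: neg neg2 neg3)
    show "Im (cnj (K x y z w)) = Im (K z w x y)"
      using eqs[THEN arg_cong[of _ _ Re]] eqs[THEN arg_cong[of _ _ Im]]
        swap[of x y z w] swap[of "J x" y z w] swap[of x "J y" z w] swap[of x y "J z" w] swap[of x y z "J w"]
        swap[of "J x" "J y" z w] swap[of "J x" y "J z" w] swap[of "J x" y z "J w"] swap[of x "J y" "J z" w]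
        swap[of x "J y" z "J w"] swap[of x y "J z" "J w"]
        swap[of "J x" "J y" "J z" w] swap[of "J x" "J y" z "J w"] swap[of "J x" y "J z" "J w"]
        swap[of x "J y" "J z" "J w"] swap[of "J x" "J y" "J z" "J w"]
      unfolding exp by (simp add: neg neg2 neg3)
  qed
  from this[of "e (k + 1)" "e (k + 2)" "e (l + 1)" "e (l + 2)"]
  have "cnj (4 * M l k) = 4 * M k l" unfolding K_def K minor_pairing_e .
  then have "cnj (cnj (4 * M l k)) = cnj (4 * M k l)" by simp
  then show ?thesis by simp
qed

text \<open>The other three terms have a repeated argument. This identifies the Hermitian form on
  the bivector of u and w with the value on the complex plane oriented by (u, J u, w, J w).\<close>

lemma contract02_complex_plane:
  fixes P :: "V \<Rightarrow> V \<Rightarrow> V \<Rightarrow> V \<Rightarrow> real"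
  assumes P: "alternating4 P"
  shows "contract02 (\<lambda>x y z w. complex_of_real (P x y z w)) u w u w = complex_of_real (P u (J u) w (J w))"
proof -
  have s12: "P x y z w = - P y x z w" and s23: "P x y z w = - P x z y w" and s34: "P x y z w = - P x y w z"
    for x y z w
    using P unfolding alternating4_def by (metis eq_neg_iff_add_eq_0)+
  have "P u w u w = 0" using s23[of u w u w] s12[of u u w w] by simp
  moreover have "P (J u) w u w = 0" using s34[of "J u" w u w] s23[of "J u" w w u] by simp
  moreover have "P u (J w) u w = 0" using s23[of u "J w" u w] s12[of u u "J w" w] by simp
  moreover have "P (J u) (J w) u w = - P u (J u) w (J w)"
    using s23[of "J u" "J w" u w] s12[of "J u" u "J w" w] s34[of u "J u" "J w" w] by simp
  ultimately show ?thesis by (simp add: contract02_def)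
qed

lemma herm_square_alternating4: "alternating4 (herm_square H)"
proof -
  have swap: "herm_eval H x y = - herm_eval H y x" for x y by (rule herm_eval_commute)
  show ?thesis
    unfolding alternating4_def
  proof (intro allI conjI)
    fix x y z w
    show "herm_square H x y z w + herm_square H y x z w = 0"
      unfolding herm_square_def swap[of y x] by (simp add: algebra_simps)
    show "herm_square H x y z w + herm_square H x z y w = 0"
      unfolding herm_square_def swap[of z y] by (simp add: algebra_simps)
    show "herm_square H x y z w + herm_square H x y w z = 0"
      unfolding herm_square_def swap[of w z] by (simp add: algebra_simps)
    show "herm_square H (- x) y z w = - herm_square H x y z w"
      unfolding herm_square_def herm_eval_minus by (simp add: algebra_simps)
  qed
qed

lemma herm_eval_real:
  assumes "\<And>i j. H j i = cnj (H i j)"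
  shows "cnj (herm_eval H x y) = herm_eval H x y"
proof -
  have "cnj (\<Sum>i\<in>UNIV. \<Sum>j\<in>UNIV. H i j * (a i x * cnj (a j y) - a i y * cnj (a j x))) =
     (\<Sum>i\<in>UNIV. \<Sum>j\<in>UNIV. H j i * (cnj (a i x) * a j y - cnj (a i y) * a j x))"
    by (simp add: assms[symmetric])
  also have "\<dots> = (\<Sum>i\<in>UNIV. \<Sum>j\<in>UNIV. H i j * (cnj (a j x) * a i y - cnj (a j y) * a i x))"
    by (rule sum.swap)
  also have "\<dots> = - (\<Sum>i\<in>UNIV. \<Sum>j\<in>UNIV. H i j * (a i x * cnj (a j y) - a i y * cnj (a j x)))"
    unfolding sum_negf[symmetric] by (simp add: algebra_simps)
  finally show ?thesis unfolding herm_eval_def complex_cnj_mult by simp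
qed

text \<open>Each nonzero c is the vector of minors of a complex plane, so positivity on planes makes
  M positive definite and hence the cofactor matrix of a positive definite H. The form of H has a
  square with the same contraction as \<pi>; \<open>alternating4_zero\<close> upgrades this to
  equality. Uniqueness up to sign comes from the cofactors, and positivity selects the sign.\<close>

lemma positive_square_root:
  fixes \<pi> :: "real form"
  assumes \<pi>: "\<And>v. \<pi> v = P (v 0) (v 1) (v 2) (v 3)" and P: "alternating4 P"
    and K: "\<And>x y z w. contract02 (\<lambda>x y z w. complex_of_real (P x y z w)) x y z w =
      4 * (\<Sum>i\<in>UNIV. (\<Sum>j\<in>UNIV. M i j * cnj (minor a j x y)) * minor a i z w)"
    and pos: "positive_on_complex_planes J \<pi>"
  shows "\<exists>!\<eta>. positive_11 J \<eta> \<and> \<pi> = (\<lambda>v. 2 * wedge 2 2 \<eta> \<eta> v)"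
proof -
  have herm: "M j i = cnj (M i j)" for i j by (rule contract02_hermitian[OF P K])
  have "posdef M"
    unfolding posdef_def
  proof (intro conjI allI impI)
    fix c :: "3 \<Rightarrow> complex" assume "c \<noteq> (\<lambda>_. 0)"
    then obtain k where k: "c k \<noteq> 0" by auto
    obtain u w where uw: "(\<lambda>i. minor a i u w) = c" using cross_surj[of c] by blast
    then have m: "minor a i u w = c i" for i by (metis (no_types))
    have "complex_of_real (P u (J u) w (J w)) = 4 * hermitian_form M c c"
      unfolding contract02_complex_plane[OF P, symmetric] K m hermitian_form_def
      by (simp add: sum_distrib_left sum_distrib_right mult_ac)
    from arg_cong[OF this, of Re] have "P u (J u) w (J w) = 4 * Re (hermitian_form M c c)" by simp
    moreover have "P u (J u) w (J w) > 0"
      using positive_on_complex_planesD[OF pos, of k u w] k m \<pi>[of "vec4 u (J u) w (J w)"] by (simp add: vec4_def)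
    ultimately show "Re (hermitian_form M c c) > 0" by simp
  qed (rule herm)
  then obtain H where H: "posdef H" "cofac H = M" by (rule posdef_eq_cofac)
  define \<eta> :: "real form" where "\<eta> = (\<lambda>v. Re (herm_eval H (v 0) (v 1)))"
  have Hherm: "H j i = cnj (H i j)" for i j using H(1) unfolding posdef_def by blast
  have "Im (herm_eval H x y) = 0" for x y
    using arg_cong[OF herm_eval_real[of H x y, OF Hherm], of Im] by simp
  then have \<eta>: "has_matrix \<eta> H"
    by (simp add: has_matrix_def \<eta>_def complex_eq_iff)
  have nz: "(\<lambda>i. a i x) \<noteq> (\<lambda>_. 0)" if "x \<noteq> 0" for x
    using that eq_0[of x] by (metis (full_types))
  have positive: "positive_11 J \<eta>"
    using has_matrix_real_11[OF \<eta>] has_matrix_diagonal[OF \<eta>] nz conjunct2[OF H(1)[unfolded posdef_def]]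
    by (simp add: positive_11_def)
  define Q where "Q = (\<lambda>x y z w. 2 * wedge 2 2 \<eta> \<eta> (vec4 x y z w))"
  have Q: "complex_of_real (Q x y z w) = herm_square H x y z w" for x y z w
    unfolding Q_def has_matrix_wedge_square[OF \<eta>] by (simp add: vec4_def)
  have sq: "\<pi> = (\<lambda>v. 2 * wedge 2 2 \<eta> \<eta> v)"
  proof
    fix v :: "nat \<Rightarrow> V"
    have altQ: "Q x y z w + Q y x z w = 0" "Q x y z w + Q x z y w = 0" "Q x y z w + Q x y w z = 0"
      "Q (- x) y z w = - Q x y z w" for x y z w
    proof -
      have "complex_of_real (Q x y z w + Q y x z w) = 0" "complex_of_real (Q x y z w + Q x z y w) = 0"
        "complex_of_real (Q x y z w + Q x y w z) = 0" "complex_of_real (Q (- x) y z w + Q x y z w) = 0"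
        using herm_square_alternating4[of H] unfolding alternating4_def of_real_add Q by auto
      then show "Q x y z w + Q y x z w = 0" "Q x y z w + Q x z y w = 0" "Q x y z w + Q x y w z = 0"
        "Q (- x) y z w = - Q x y z w"
        unfolding of_real_eq_0_iff by (simp_all add: eq_neg_iff_add_eq_0)
    qed
    have "alternating4 (\<lambda>x y z w. P x y z w - Q x y z w)"
      by (rule alternating4_diff[OF P]) (unfold alternating4_def, intro allI conjI altQ)
    moreover have "contract02 (\<lambda>x y z w. complex_of_real (P x y z w - Q x y z w)) x y z w = 0" for x y z w
    proof -
      have "contract02 (\<lambda>x y z w. complex_of_real (P x y z w - Q x y z w)) x y z w =
          contract02 (\<lambda>x y z w. complex_of_real (P x y z w)) x y z w - contract02 (herm_square H) x y z w"
        by (simp add: contract02_def Q algebra_simps)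
      then show ?thesis by (simp add: K contract02_herm_square H(2))
    qed
    ultimately have "P (v 0) (v 1) (v 2) (v 3) - Q (v 0) (v 1) (v 2) (v 3) = 0"
      by (rule alternating4_zero)
    moreover have "complex_of_real (Q (v 0) (v 1) (v 2) (v 3)) = complex_of_real (2 * wedge 2 2 \<eta> \<eta> v)"
      unfolding Q has_matrix_wedge_square[OF \<eta>] ..
    ultimately show "\<pi> v = 2 * wedge 2 2 \<eta> \<eta> v"
      unfolding \<pi> of_real_eq_iff by simp
  qed
  show ?thesis
  proof (rule ex1I)
    show "positive_11 J \<eta> \<and> \<pi> = (\<lambda>v. 2 * wedge 2 2 \<eta> \<eta> v)" using positive sq by blast
    fix \<eta>' assume \<eta>': "positive_11 J \<eta>' \<and> \<pi> = (\<lambda>v. 2 * wedge 2 2 \<eta>' \<eta>' v)"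
    have "det_fun H \<noteq> 0" using posdef_det[OF H(1)] by auto
    then have "\<eta>' = \<eta> \<or> \<eta>' = (\<lambda>v. - \<eta> v)"
      using wedge_square_inject_up_to_sign[OF \<eta>] \<eta>' sq by (auto simp: positive_11_def)
    moreover have "\<eta>' \<noteq> (\<lambda>v. - \<eta> v)"
    proof
      assume "\<eta>' = (\<lambda>v. - \<eta> v)"
      moreover have "e 1 \<noteq> 0" using dual[of 1 1] by auto
      ultimately show False using positive \<eta>' unfolding positive_11_def by fastforce
    qed
    ultimately show "\<eta>' = \<eta>" by blast
  qed
qed

end

text \<open>Existence is the rescaling \<beta>^2 / 2 = 2 (\<beta>/2)^2. Of the two possible roots,
  the opposite one is excluded by Sylvester's law of inertia, proved here by a common vector of two
  subspaces.\<close>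

lemma indefinite_square_root:
  fixes \<pi> :: "real form"
  assumes J: "complex_structure J" and \<beta>: "signature12_11 J \<beta>" "\<pi> = (\<lambda>v. 1 / 2 * wedge 2 2 \<beta> \<beta> v)"
  shows "\<exists>!\<eta>. signature12_11 J \<eta> \<and> \<pi> = (\<lambda>v. 2 * wedge 2 2 \<eta> \<eta> v)"
proof -
  obtain \<beta>\<^sub>0 where \<beta>\<^sub>0: "coframe J \<beta>\<^sub>0" "diagonalizes (- 1) \<beta>\<^sub>0 \<beta>" using \<beta>(1) by (auto simp: signature12_11_def)
  obtain b f where b: "complex_frame J b f" "\<And>i. \<beta>\<^sub>0 i = covector (b i)"
    using coframe_complex_frame[OF J \<beta>\<^sub>0(1)] by blast
  interpret b: complex_frame J b f by (rule b(1))
  \<comment> \<open>A diagonal form is quadratic in the coframe, so halving the form multiplies the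
    covectors by the root of 1/2.\<close>
  define r where "r = sqrt (1 / 2)"
  have r: "r \<noteq> 0" "complex_of_real r * complex_of_real r = 1 / 2"
    by (simp_all add: r_def of_real_mult[symmetric] del: of_real_mult)
  define \<eta> :: "real form" where "\<eta> = (\<lambda>v. \<beta> v / 2)"
  define \<alpha> where "\<alpha> = (\<lambda>i. covector (\<lambda>x. complex_of_real r * b i x))"
  have "coframe J \<alpha>"
    unfolding coframe_def
  proof (intro conjI allI impI)
    show "\<exists>a. covector10 J a \<and> \<alpha> i = covector a" for i
      using covector10_scale[OF b.covector10] by (auto simp: \<alpha>_def)
    fix c i assume "\<forall>v. (\<Sum>i\<in>UNIV. c i * \<alpha> i v) = 0"
    from spec[OF this, of "\<lambda>_. f i"] have "(\<Sum>k\<in>UNIV. c k * (complex_of_real r * b k (f i))) = 0"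
      by (simp add: \<alpha>_def covector_def)
    moreover have "(\<Sum>k\<in>UNIV. c k * (complex_of_real r * b k (f i))) = (\<Sum>k\<in>UNIV. if k = i then c k * r else 0)"
      by (intro sum.cong) (auto simp: b.dual)
    ultimately show "c i = 0" using r by simp
  qed
  moreover have diag: "diagonalizes (- 1) \<alpha> \<eta>"
  proof -
    have "cnj_form (covector h) = covector (\<lambda>x. cnj (h x))" for h
      by (simp add: cnj_form_def covector_def)
    note c = this wedge_covector[unfolded One_nat_def]
    have *: "r * x * (r * y) = x * y / 2" for x y :: complex
      using r(2) by (metis mult.commute mult.left_commute times_divide_eq_left mult_1)
    have "complex_of_real (\<eta> v) = \<i> / 2 * (\<Sum>i\<in>UNIV. of_real (eps (- 1) i) * wedge 1 1 (\<alpha> i) (cnj_form (\<alpha> i)) v)" for v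
    proof -
      have "complex_of_real (\<eta> v) = complex_of_real (\<beta> v) / 2" by (simp add: \<eta>_def)
      also have "complex_of_real (\<beta> v) = \<i> / 2 * (\<Sum>i\<in>UNIV. of_real (eps (- 1) i) * wedge 1 1 (\<beta>\<^sub>0 i) (cnj_form (\<beta>\<^sub>0 i)) v)"
        using fun_cong[OF \<beta>\<^sub>0(2)[unfolded diagonalizes_def], of v] by (simp add: complex_form_def)
      also have "\<dots> / 2 = \<i> / 2 * (\<Sum>i\<in>UNIV. of_real (eps (- 1) i) * wedge 1 1 (\<alpha> i) (cnj_form (\<alpha> i)) v)"
        by (simp add: \<alpha>_def b(2) c *) (simp add: sum_3 field_simps)
      finally show ?thesis .
    qed
    then show ?thesis unfolding diagonalizes_def complex_form_def by (intro ext)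
  qed
  ultimately obtain a e where a: "complex_frame J a e" "\<And>i. \<alpha> i = covector (a i)"
    using coframe_complex_frame[OF J] by blast
  interpret a: complex_frame J a e by (rule a(1))
  have \<alpha>: "\<alpha> = (\<lambda>i. covector (a i))" using a(2) by blast
  define H :: "3 \<Rightarrow> 3 \<Rightarrow> complex" where "H = (\<lambda>i j. if i = j then of_real (eps (- 1) i) else 0)"
  have \<eta>: "a.has_matrix \<eta> H"
    unfolding H_def using a.diagonalizes_has_matrix diag unfolding \<alpha> by blast
  have signature: "signature12_11 J \<eta>"
    using \<open>coframe J \<alpha>\<close> diag a.has_matrix_real_11[OF \<eta>] by (auto simp: signature12_11_def)
  have sq: "\<pi> = (\<lambda>v. 2 * wedge 2 2 \<eta> \<eta> v)"
  proof
    fix v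
    have "wedge 2 2 \<eta> \<eta> v = wedge 2 2 \<beta> \<beta> v / 4"
      by (simp add: wedge_def \<eta>_def sum_divide_distrib)
    then show "\<pi> v = 2 * wedge 2 2 \<eta> \<eta> v" by (simp add: \<beta>(2))
  qed
  show ?thesis
  proof (rule ex1I)
    show "signature12_11 J \<eta> \<and> \<pi> = (\<lambda>v. 2 * wedge 2 2 \<eta> \<eta> v)" using signature sq by blast
    fix \<eta>' assume \<eta>': "signature12_11 J \<eta>' \<and> \<pi> = (\<lambda>v. 2 * wedge 2 2 \<eta>' \<eta>' v)"
    have "det_fun H = 1" by (simp add: det_fun_def cofac_def sum_3 H_def eps_def)
    then have "\<eta>' = \<eta> \<or> \<eta>' = (\<lambda>v. - \<eta> v)"
      using a.wedge_square_inject_up_to_sign[OF \<eta>] \<eta>' sq by (auto simp: signature12_11_def)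
    moreover have "\<eta>' \<noteq> (\<lambda>v. - \<eta> v)"
    proof
      assume minus: "\<eta>' = (\<lambda>v. - \<eta> v)"
      obtain \<gamma> where \<gamma>: "coframe J \<gamma>" "diagonalizes (- 1) \<gamma> \<eta>'" using \<eta>' by (auto simp: signature12_11_def)
      obtain g k where g: "complex_frame J g k" "\<And>i. \<gamma> i = covector (g i)"
        using coframe_complex_frame[OF J \<gamma>(1)] by blast
      interpret g: complex_frame J g k by (rule g(1))
      have \<gamma>': "\<gamma> = (\<lambda>i. covector (g i))" using g(2) by blast
      have \<eta>'m: "g.has_matrix \<eta>' H"
        unfolding H_def using g.diagonalizes_has_matrix \<gamma>(2) unfolding \<gamma>' by blast
      have form: "Re (hermitian_form H c c) = (cmod (c 1))\<^sup>2 - (cmod (c 2))\<^sup>2 - (cmod (c 3))\<^sup>2" for c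
        unfolding cmod_power2 by (simp add: hermitian_form_def H_def sum_3 eps_def power2_eq_square)
      \<comment> \<open>A nonzero vector of the plane a 1 = 0 on which g 1 vanishes too. There
        \<eta> is negative and \<eta>' is at most zero, which contradicts \<eta>' = -\<eta>.\<close>
      define c :: "3 \<Rightarrow> complex" where "c = (if g 1 (e 2) = 0 \<and> g 1 (e 3) = 0 then (\<lambda>i. if i = 2 then 1 else 0)
         else (\<lambda>i. if i = 1 then 0 else if i = 2 then - g 1 (e 3) else g 1 (e 2)))"
      define x where "x = a.point c"
      have "g 1 x = (\<Sum>i\<in>UNIV. a i x * g 1 (e i))"
        by (rule a.linear_expand[OF g.linear_a g.a_J])
      then have "g 1 x = 0" by (simp add: x_def sum_3 c_def)
      moreover have "a 1 x = 0" by (simp add: x_def c_def)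
      moreover have "a 2 x \<noteq> 0 \<or> a 3 x \<noteq> 0" by (auto simp: x_def c_def)
      then have "(cmod (a 2 x))\<^sup>2 + (cmod (a 3 x))\<^sup>2 > 0" by (auto simp: sum_power2_gt_zero_iff)
      moreover have "\<eta>' (vec2 x (J x)) = - \<eta> (vec2 x (J x))" using minus by simp
      ultimately show False
        using a.has_matrix_diagonal[OF \<eta>, of x] g.has_matrix_diagonal[OF \<eta>'m, of x]
        by (simp add: form) (smt (verit) zero_le_power2)
    qed
    ultimately show "\<eta>' = \<eta>" by blast
  qed
qed

section \<open>The exterior derivative of a (3,0)-form\<close>

lemma frechet_derivative_cong_open:
  assumes "open U" "x \<in> U" "\<And>y. y \<in> U \<Longrightarrow> f y = g y"
  shows "frechet_derivative f (at x) = frechet_derivative g (at x)"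
proof -
  have "(f has_derivative D) (at x) \<longleftrightarrow> (g has_derivative D) (at x)" for D
    using has_derivative_transform_within_open[of f D x UNIV U g]
      has_derivative_transform_within_open[of g D x UNIV U f] assms by auto
  then show ?thesis by (simp add: frechet_derivative_def)
qed

definition frame_deriv :: "V \<Rightarrow> (V \<Rightarrow> 3 \<Rightarrow> V \<Rightarrow> complex) \<Rightarrow> 3 \<Rightarrow> V \<Rightarrow> V \<Rightarrow> complex" where
  "frame_deriv x a i h w = frechet_derivative (\<lambda>y. a y i w) (at x) h"

definition curl :: "V \<Rightarrow> (V \<Rightarrow> 3 \<Rightarrow> V \<Rightarrow> complex) \<Rightarrow> 3 \<Rightarrow> V \<Rightarrow> V \<Rightarrow> complex" where
  "curl x a i v w = frame_deriv x a i v w - frame_deriv x a i w v"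

text \<open>The Leibniz rule for \<open>det3\<close>: its derivative in direction h at fixed
  arguments u, w, z, when the covectors vary.\<close>

definition d_det3 :: "V \<Rightarrow> (V \<Rightarrow> 3 \<Rightarrow> V \<Rightarrow> complex) \<Rightarrow> V \<Rightarrow> V \<Rightarrow> V \<Rightarrow> V \<Rightarrow> complex" where
  "d_det3 x a h u w z = (\<Sum>i\<in>UNIV. frame_deriv x a i h u * minor (a x) i w z
     - frame_deriv x a i h w * minor (a x) i u z + frame_deriv x a i h z * minor (a x) i u w)"

text \<open>Only the coframing and \<phi> come with differentiability. The frames e and the function
  f arise from pointwise choices; that f is differentiable is derived, and the derivative of \<psi>
  follows from it.\<close>

context
  fixes U :: "V set" and x\<^sub>0 :: V and J :: "V \<Rightarrow> V \<Rightarrow> V" and a :: "V \<Rightarrow> 3 \<Rightarrow> V \<Rightarrow> complex"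
    and f :: "V \<Rightarrow> complex" and \<phi> \<psi> :: "V \<Rightarrow> real form"
  assumes U: "open U" "x\<^sub>0 \<in> U"
    and frame: "\<And>x. x \<in> U \<Longrightarrow> \<exists>e. complex_frame (J x) (a x) e"
    and \<phi>: "\<And>x v. x \<in> U \<Longrightarrow> \<phi> x v = Re (f x * det3 (a x) (v 0) (v 1) (v 2))"
    and \<psi>: "\<And>x v. x \<in> U \<Longrightarrow> \<psi> x v = Im (f x * det3 (a x) (v 0) (v 1) (v 2))"
    and diff_a: "\<And>i w. (\<lambda>x. a x i w) differentiable (at x\<^sub>0)"
    and diff_\<phi>: "\<And>v. (\<lambda>x. \<phi> x v) differentiable (at x\<^sub>0)"
begin

lemma has_derivative_a: "((\<lambda>x. a x i w) has_derivative (\<lambda>h. frame_deriv x\<^sub>0 a i h w)) (at x\<^sub>0)"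
  using diff_a[of i w] by (simp add: frame_deriv_def frechet_derivative_works[symmetric])

lemma linear_frame_deriv: "linear (\<lambda>h. frame_deriv x\<^sub>0 a i h w)" "linear (frame_deriv x\<^sub>0 a i h)"
proof -
  show "linear (\<lambda>h. frame_deriv x\<^sub>0 a i h w)"
    using has_derivative_linear[OF has_derivative_a] .
  have lin: "linear (a x i)" if "x \<in> U" for x
    using frame[OF that] complex_frame.linear_a by blast
  show "linear (frame_deriv x\<^sub>0 a i h)"
  proof (rule linearI)
    fix w w'
    have "((\<lambda>x. a x i w + a x i w') has_derivative (\<lambda>h. frame_deriv x\<^sub>0 a i h w + frame_deriv x\<^sub>0 a i h w')) (at x\<^sub>0)"
      by (intro has_derivative_add has_derivative_a)
    then have "((\<lambda>x. a x i (w + w')) has_derivative (\<lambda>h. frame_deriv x\<^sub>0 a i h w + frame_deriv x\<^sub>0 a i h w')) (at x\<^sub>0)"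
      by (rule has_derivative_transform_within_open[OF _ U]) (simp add: linear_add[OF lin])
    from has_derivative_unique[OF this has_derivative_a] show "frame_deriv x\<^sub>0 a i h (w + w') = frame_deriv x\<^sub>0 a i h w + frame_deriv x\<^sub>0 a i h w'"
      by (metis)
  next
    fix r w
    have "((\<lambda>x. r *\<^sub>R a x i w) has_derivative (\<lambda>h. r *\<^sub>R frame_deriv x\<^sub>0 a i h w)) (at x\<^sub>0)"
      by (intro has_derivative_scaleR_right has_derivative_a)
    then have "((\<lambda>x. a x i (r *\<^sub>R w)) has_derivative (\<lambda>h. r *\<^sub>R frame_deriv x\<^sub>0 a i h w)) (at x\<^sub>0)"
      by (rule has_derivative_transform_within_open[OF _ U]) (simp add: linear_scale[OF lin])
    from has_derivative_unique[OF this has_derivative_a] show "frame_deriv x\<^sub>0 a i h (r *\<^sub>R w) = r *\<^sub>R frame_deriv x\<^sub>0 a i h w"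
      by (metis)
  qed
qed

lemma alternating2_curl: "alternating2 (curl x\<^sub>0 a i)"
  using linear_frame_deriv by (simp add: alternating2_def bilinear_def curl_def linear_iff algebra_simps)

lemma has_derivative_det3: "((\<lambda>x. det3 (a x) u w z) has_derivative (\<lambda>h. d_det3 x\<^sub>0 a h u w z)) (at x\<^sub>0)"
  unfolding det3_code
  by (rule derivative_eq_intros has_derivative_a refl)+
    (simp add: d_det3_def sum_3 minor_def cross_fun_def algebra_simps fun_eq_iff)

text \<open>f is recovered from \<open>\<phi>\<close> and the coframing by Cramer's rule.\<close>

lemma differentiable_f: "f differentiable (at x\<^sub>0)"
proof -
  obtain e where "complex_frame (J x\<^sub>0) (a x\<^sub>0) e" using frame U by blast
  then interpret complex_frame "J x\<^sub>0" "a x\<^sub>0" e .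
  define \<alpha> where "\<alpha> = (\<lambda>x. det3 (a x) (e 1) (e 2) (e 3))"
  define \<beta> where "\<beta> = (\<lambda>x. det3 (a x) (J x\<^sub>0 (e 1)) (e 2) (e 3))"
  define u where "u = (\<lambda>i::nat. if i = 0 then e 1 else if i = 1 then e 2 else e 3)"
  define w where "w = (\<lambda>i::nat. if i = 0 then J x\<^sub>0 (e 1) else if i = 1 then e 2 else e 3)"
  \<comment> \<open>The values of \<phi> at u and w are two linear equations for f and its
    conjugate. The arguments are frozen at the base point, where \<open>den\<close> is -2 i, so it
    stays nonzero nearby.\<close>
  define den where "den = (\<lambda>x. \<alpha> x * cnj (\<beta> x) - \<beta> x * cnj (\<alpha> x))"
  define g where "g = (\<lambda>x. 2 * (complex_of_real (\<phi> x u) * cnj (\<beta> x) - complex_of_real (\<phi> x w) * cnj (\<alpha> x)) / den x)"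
  have \<alpha>: "\<alpha> differentiable (at x\<^sub>0)" and \<beta>: "\<beta> differentiable (at x\<^sub>0)"
    using has_derivative_det3 unfolding \<alpha>_def \<beta>_def differentiable_def by blast+
  have cnj: "(\<lambda>x. cnj (h x)) differentiable (at x\<^sub>0)" if "h differentiable (at x\<^sub>0)" for h :: "V \<Rightarrow> complex"
    using bounded_linear.has_derivative[OF bounded_linear_cnj] that unfolding differentiable_def by blast
  have of_real: "(\<lambda>x. complex_of_real (h x)) differentiable (at x\<^sub>0)" if "h differentiable (at x\<^sub>0)" for h
    using bounded_linear.has_derivative[OF bounded_linear_of_real] that unfolding differentiable_def by blast
  have "\<alpha> x\<^sub>0 = 1" "\<beta> x\<^sub>0 = \<i>" by (simp_all add: \<alpha>_def \<beta>_def det3_e)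
  then have den0: "den x\<^sub>0 \<noteq> 0" by (simp add: den_def complex_eq_iff)
  have den: "den differentiable (at x\<^sub>0)"
    unfolding den_def by (intro differentiable_diff differentiable_mult cnj \<alpha> \<beta>)
  have "g differentiable (at x\<^sub>0)"
    unfolding g_def by (intro differentiable_divide differentiable_diff differentiable_mult cnj of_real \<alpha> \<beta> diff_\<phi> den den0 differentiable_const)
  then obtain g' where g': "(g has_derivative g') (at x\<^sub>0)" unfolding differentiable_def by blast
  have fg: "f x = g x" if "x \<in> U" "den x \<noteq> 0" for x
  proof -
    have "complex_of_real (\<phi> x u) = (f x * \<alpha> x + cnj (f x) * cnj (\<alpha> x)) / 2"
      "complex_of_real (\<phi> x w) = (f x * \<beta> x + cnj (f x) * cnj (\<beta> x)) / 2"
      using \<phi>[OF that(1), of u] \<phi>[OF that(1), of w] by (simp_all add: \<alpha>_def \<beta>_def u_def w_def complex_eq_iff)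
    then have "2 * (complex_of_real (\<phi> x u) * cnj (\<beta> x) - complex_of_real (\<phi> x w) * cnj (\<alpha> x)) = f x * den x"
      by (simp add: den_def algebra_simps)
    then show ?thesis using that(2) by (simp add: g_def)
  qed
  have "isCont den x\<^sub>0" using den by (rule differentiable_imp_continuous_within)
  then have "(den \<longlongrightarrow> den x\<^sub>0) (nhds x\<^sub>0)"
    by (simp add: continuous_at tendsto_nhds_iff isCont_def)
  then have "eventually (\<lambda>x. den x \<noteq> 0) (nhds x\<^sub>0)"
    using den0 by (rule tendsto_imp_eventually_ne)
  moreover have "eventually (\<lambda>x. x \<in> U) (nhds x\<^sub>0)" using U by (auto simp: eventually_nhds)
  ultimately have "eventually (\<lambda>x. g x = f x) (nhds x\<^sub>0)"
    by eventually_elim (simp add: fg)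
  then have "eventually (\<lambda>x. g x = f x) (at x\<^sub>0)" "g x\<^sub>0 = f x\<^sub>0"
    using fg U den0 by (auto simp: eventually_at_filter elim: eventually_mono)
  then have "(f has_derivative g') (at x\<^sub>0)"
    using has_derivative_transform_eventually[OF g'] by simp
  then show ?thesis unfolding differentiable_def by blast
qed

lemma has_derivative_f: "(f has_derivative frechet_derivative f (at x\<^sub>0)) (at x\<^sub>0)"
  using differentiable_f by (simp add: frechet_derivative_works[symmetric])

text \<open>The product rule for f times the volume form. The sign patterns of the alternating sum
  over omitted arguments assemble the derivatives of the covectors into their exterior derivatives
  \<open>curl\<close>.\<close>

lemma ext_deriv_complex:
  "complex_of_real (ext_deriv 3 \<phi> x\<^sub>0 v) + \<i> * complex_of_real (ext_deriv 3 \<psi> x\<^sub>0 v) =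
     wedge13 (frechet_derivative f (at x\<^sub>0)) (det3 (a x\<^sub>0)) (v 0) (v 1) (v 2) (v 3)
     + f x\<^sub>0 * (\<Sum>i\<in>UNIV. wedge22 (curl x\<^sub>0 a i) (minor (a x\<^sub>0) i) (v 0) (v 1) (v 2) (v 3))"
proof -
  define L where "L = (\<lambda>(u :: nat \<Rightarrow> V) h. frechet_derivative f (at x\<^sub>0) h * det3 (a x\<^sub>0) (u 0) (u 1) (u 2) + f x\<^sub>0 * d_det3 x\<^sub>0 a h (u 0) (u 1) (u 2))"
  have L: "((\<lambda>x. f x * det3 (a x) (u 0) (u 1) (u 2)) has_derivative L u) (at x\<^sub>0)" for u :: "nat \<Rightarrow> V"
    unfolding L_def using has_derivative_mult[OF has_derivative_f has_derivative_det3[of "u 0" "u 1" "u 2"]]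
    by (simp add: add.commute)
  have Re: "frechet_derivative (\<lambda>x. \<phi> x u) (at x\<^sub>0) h = Re (L u h)" for u h
  proof -
    have "((\<lambda>x. \<phi> x u) has_derivative (\<lambda>h. Re (L u h))) (at x\<^sub>0)"
      by (rule has_derivative_transform_within_open[OF bounded_linear.has_derivative[OF bounded_linear_Re L[of u]] U])
        (simp add: \<phi>)
    from frechet_derivative_at[OF this] show ?thesis by metis
  qed
  have Im: "frechet_derivative (\<lambda>x. \<psi> x u) (at x\<^sub>0) h = Im (L u h)" for u h
  proof -
    have "((\<lambda>x. \<psi> x u) has_derivative (\<lambda>h. Im (L u h))) (at x\<^sub>0)"
      by (rule has_derivative_transform_within_open[OF bounded_linear.has_derivative[OF bounded_linear_Im L[of u]] U])
        (simp add: \<psi>)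
    from frechet_derivative_at[OF this] show ?thesis by metis
  qed
  have sum4: "(\<Sum>i\<le>3. s i) = s 0 + s 1 + s 2 + s (3::nat)" for s :: "nat \<Rightarrow> 'b::comm_monoid_add"
    by (simp add: eval_nat_numeral)
  have "complex_of_real (ext_deriv 3 \<phi> x\<^sub>0 v) + \<i> * complex_of_real (ext_deriv 3 \<psi> x\<^sub>0 v) =
     L (omit 0 v) (v 0) - L (omit 1 v) (v 1) + L (omit 2 v) (v 2) - L (omit 3 v) (v 3)"
    by (simp add: ext_deriv_def sum4 Re Im complex_eq_iff)
  also have "\<dots> = wedge13 (frechet_derivative f (at x\<^sub>0)) (det3 (a x\<^sub>0)) (v 0) (v 1) (v 2) (v 3)
     + f x\<^sub>0 * (d_det3 x\<^sub>0 a (v 0) (v 1) (v 2) (v 3) - d_det3 x\<^sub>0 a (v 1) (v 0) (v 2) (v 3)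
        + d_det3 x\<^sub>0 a (v 2) (v 0) (v 1) (v 3) - d_det3 x\<^sub>0 a (v 3) (v 0) (v 1) (v 2))"
    by (simp add: L_def omit_def wedge13_def eval_nat_numeral algebra_simps)
  also have "d_det3 x\<^sub>0 a (v 0) (v 1) (v 2) (v 3) - d_det3 x\<^sub>0 a (v 1) (v 0) (v 2) (v 3)
        + d_det3 x\<^sub>0 a (v 2) (v 0) (v 1) (v 3) - d_det3 x\<^sub>0 a (v 3) (v 0) (v 1) (v 2) =
     (\<Sum>i\<in>UNIV. wedge22 (curl x\<^sub>0 a i) (minor (a x\<^sub>0) i) (v 0) (v 1) (v 2) (v 3))"
    unfolding d_det3_def sum.distrib[symmetric] sum_subtractf[symmetric]
    by (intro sum.cong refl) (simp add: wedge22_def curl_def algebra_simps)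
  finally show ?thesis .
qed

end

section \<open>The Nijenhuis matrix\<close>

context complex_frame begin

text \<open>The exterior derivative of \<open>f \<alpha>\<^sub>1 \<and> \<alpha>\<^sub>2 \<and> \<alpha>\<^sub>3\<close>, with q for \<open>df\<close> and \<open>D i\<close> for \<open>d\<alpha>\<^sub>i\<close>.\<close>

definition d_volume :: "(V \<Rightarrow> complex) \<Rightarrow> complex \<Rightarrow> (3 \<Rightarrow> V \<Rightarrow> V \<Rightarrow> complex) \<Rightarrow> V \<Rightarrow> V \<Rightarrow> V \<Rightarrow> V \<Rightarrow> complex" where
  "d_volume q f D x y z w = wedge13 q (det3 a) x y z w + f * (\<Sum>i\<in>UNIV. wedge22 (D i) (minor a i) x y z w)"

lemma contract02_d_volume:
  "contract02 (d_volume q f D) x y z w = 4 * (\<Sum>i\<in>UNIV. f * part02 (D i) x y * minor a i z w)"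
proof -
  have "contract02 (d_volume q f D) x y z w = contract02 (wedge13 q (det3 a)) x y z w
     + f * (\<Sum>i\<in>UNIV. contract02 (wedge22 (D i) (minor a i)) x y z w)"
    unfolding contract02_def d_volume_def
    by (simp add: sum_3) (simp add: algebra_simps)
  then show ?thesis
    unfolding contract02_wedge13 contract02_wedge22 by (simp add: sum_distrib_left mult_ac)
qed

lemma alternating4_d_volume:
  assumes q: "linear q" and D: "\<And>i. alternating2 (D i)"
  shows "alternating4 (d_volume q f D)"
proof -
  have Dc: "D i y x = - D i x y" for i x y by (rule alternating2_commute[OF D])
  have Dn: "D i (- x) y = - D i x y" "D i x (- y) = - D i x y" for i x y
    using D[of i] by (simp_all add: alternating2_def bilinear_lneg bilinear_rneg)
  have mc: "minor a i y x = - minor a i x y" for i x y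
    by (simp add: minor_def cross_fun_def)
  have mn: "minor a i (- x) y = - minor a i x y" for i x y
    by (simp add: minor_def cross_fun_def)
  have tc: "det3 a y x z = - det3 a x y z" "det3 a x z y = - det3 a x y z" "det3 a (- x) y z = - det3 a x y z" for x y z
    by (simp_all add: det3_code algebra_simps)
  have w13: "wedge13 q (det3 a) y x z w = - wedge13 q (det3 a) x y z w"
    "wedge13 q (det3 a) x z y w = - wedge13 q (det3 a) x y z w"
    "wedge13 q (det3 a) x y w z = - wedge13 q (det3 a) x y z w"
    "wedge13 q (det3 a) (- x) y z w = - wedge13 q (det3 a) x y z w" for x y z w
    unfolding wedge13_def linear_neg[OF q] tc(3)
    using tc(1)[of x y z] tc(1)[of x y w] tc(1)[of x z w] tc(1)[of y z w] tc(2)[of x y z] tc(2)[of x y w] tc(2)[of x z w] tc(2)[of y z w]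
      by (simp_all add: algebra_simps)
  have w22: "wedge22 (D i) (minor a i) y x z w = - wedge22 (D i) (minor a i) x y z w"
    "wedge22 (D i) (minor a i) x z y w = - wedge22 (D i) (minor a i) x y z w"
    "wedge22 (D i) (minor a i) x y w z = - wedge22 (D i) (minor a i) x y z w"
    "wedge22 (D i) (minor a i) (- x) y z w = - wedge22 (D i) (minor a i) x y z w" for i x y z w
    unfolding wedge22_def Dn mn
    using Dc[of i x y] Dc[of i y z] Dc[of i z w] mc[of i x y] mc[of i y z] mc[of i z w]
    by (simp_all add: algebra_simps)
  show ?thesis
    unfolding alternating4_def d_volume_def
  proof (intro allI conjI, goal_cases)
    case (1 x y z w)
    show ?case unfolding w13(1)[of x y z w] w22(1)[of _ x y z w] by (simp add: sum_negf)
  next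
    case (2 x y z w)
    show ?case unfolding w13(2)[of x y z w] w22(2)[of _ x y z w] by (simp add: sum_negf)
  next
    case (3 x y z w)
    show ?case unfolding w13(3)[of x y z w] w22(3)[of _ x y z w] by (simp add: sum_negf)
  next
    case (4 x y z w)
    show ?case unfolding w13(4) w22(4) by (simp add: sum_negf)
  qed
qed

text \<open>The first hypothesis encodes that the derivative of the complex form is real, which is
  where closedness of the imaginary part enters. The Hermitian matrix is made of f times the
  (0,2)-coefficients of D.\<close>

lemma d_volume_positive_square_root:
  assumes \<pi>: "\<And>v. complex_of_real (\<pi> v) = d_volume q f D (v 0) (v 1) (v 2) (v 3)"
    and q: "linear q" and D: "\<And>i. alternating2 (D i)" and pos: "positive_on_complex_planes J \<pi>"
  shows "\<exists>!\<eta>. positive_11 J \<eta> \<and> \<pi> = (\<lambda>v. 2 * wedge 2 2 \<eta> \<eta> v)"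
proof -
  define P where "P = (\<lambda>x y z w. \<pi> (vec4 x y z w))"
  have P: "complex_of_real (P x y z w) = d_volume q f D x y z w" for x y z w
    by (simp add: P_def \<pi> vec4_def)
  have 1: "\<pi> v = P (v 0) (v 1) (v 2) (v 3)" for v
  proof -
    have "complex_of_real (\<pi> v) = complex_of_real (P (v 0) (v 1) (v 2) (v 3))" unfolding P by (rule \<pi>)
    then show ?thesis by (simp only: of_real_eq_iff)
  qed
  have "complex_of_real (P x y z w + P y x z w) = 0 \<and> complex_of_real (P x y z w + P x z y w) = 0 \<and>
    complex_of_real (P x y z w + P x y w z) = 0 \<and> complex_of_real (P (- x) y z w + P x y z w) = 0" for x y z w
    using alternating4_d_volume[OF q D, of f] unfolding alternating4_def of_real_add P by auto
  then have 2: "alternating4 P"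
    unfolding alternating4_def of_real_eq_0_iff by (simp add: eq_neg_iff_add_eq_0)
  have 3: "contract02 (\<lambda>x y z w. complex_of_real (P x y z w)) x y z w =
      4 * (\<Sum>i\<in>UNIV. (\<Sum>j\<in>UNIV. f * part02 (D i) (e (j + 1)) (e (j + 2)) * cnj (minor a j x y)) * minor a i z w)" for x y z w
  proof -
    have "f * part02 (D i) x y = (\<Sum>j\<in>UNIV. f * part02 (D i) (e (j + 1)) (e (j + 2)) * cnj (minor a j x y))" for i
      by (subst alternating2_02_minor[OF alternating2_part02[OF D]]) (simp add: sum_distrib_left mult.assoc)
    then show ?thesis unfolding P contract02_d_volume by simp
  qed
  show ?thesis by (rule positive_square_root[OF 1 2 3 pos])
qed

text \<open>The diagonal matrix H of \<eta> has cofactors diag(s^2, s, s), which is H again. Both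
  contractions pair with the minors, and inserting dual vectors into the last two slots isolates one
  covector.\<close>

lemma d_volume_eq_square:
  assumes \<pi>: "\<And>v. complex_of_real (\<pi> v) = d_volume q f D (v 0) (v 1) (v 2) (v 3)"
    and sq: "\<pi> = (\<lambda>v. 2 * wedge 2 2 \<eta> \<eta> v)"
    and diag: "diagonalizes s (\<lambda>i. covector (a i)) \<eta>" and s: "s * s = 1" and f: "f \<noteq> 0"
  shows "part02 (D k) x y = of_real (eps s k) / f * cnj (minor a k x y)"
proof -
  define H :: "3 \<Rightarrow> 3 \<Rightarrow> complex" where "H = (\<lambda>i j. if i = j then of_real (eps s i) else 0)"
  have \<eta>: "has_matrix \<eta> H" unfolding H_def by (rule diagonalizes_has_matrix[OF diag])
  have "complex_of_real s * complex_of_real s = 1" using s by (metis of_real_1 of_real_mult)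
  then have "\<forall>i j. cofac H i j = H i j"
    by (simp add: forall_3 cofac_def H_def eps_def)
  then have cof: "cofac H = H" by blast
  have "d_volume q f D x y z w = herm_square H x y z w" for x y z w
    using \<pi>[of "vec4 x y z w"] has_matrix_wedge_square[OF \<eta>, of "vec4 x y z w"] sq by (simp add: vec4_def)
  then have "d_volume q f D = herm_square H" by blast
  then have eq: "(\<Sum>i\<in>UNIV. f * part02 (D i) x y * minor a i z w) =
      (\<Sum>i\<in>UNIV. (\<Sum>j\<in>UNIV. H i j * cnj (minor a j x y)) * minor a i z w)" for z w
    using contract02_d_volume[of q f D x y z w] contract02_herm_square[of H x y z w] by (simp add: cof)
  have pick: "(\<Sum>i\<in>UNIV. g i * minor a i (e (k + 1)) (e (k + 2))) = g k" for g :: "3 \<Rightarrow> complex"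
  proof -
    have "(\<Sum>i\<in>UNIV. g i * minor a i (e (k + 1)) (e (k + 2))) = (\<Sum>i\<in>UNIV. if i = k then g i else 0)"
      unfolding minor_e by (intro sum.cong) auto
    then show ?thesis by simp
  qed
  have "f * part02 (D k) x y = (\<Sum>j\<in>UNIV. H k j * cnj (minor a j x y))"
    using eq[of "e (k + 1)" "e (k + 2)"] unfolding pick .
  also have "\<dots> = (\<Sum>j\<in>UNIV. if k = j then of_real (eps s k) * cnj (minor a k x y) else 0)"
    unfolding H_def by (intro sum.cong) auto
  finally show ?thesis using f by (simp add: field_simps)
qed

lemma det3_change_frame:
  assumes "complex_frame J b e'"
  shows "det3 b x y z = det3 b (e 1) (e 2) (e 3) * det3 a x y z"
proof -
  interpret b: complex_frame J b e' by (rule assms)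
  have "b i x = a 1 x * b i (e 1) + a 2 x * b i (e 2) + a 3 x * b i (e 3)" for i x
    using linear_expand[OF b.linear_a b.a_J, of i x] by (simp add: sum_3)
  note exp = this
  show ?thesis
    unfolding det3_code exp[of _ x] exp[of _ y] exp[of _ z] by (simp add: algebra_simps)
qed

lemma cnj_form_wedge_covector:
  "cnj_form (wedge 1 1 (covector (a (j + 1))) (covector (a (j + 2)))) = (\<lambda>v. cnj (minor a j (v 0) (v 1)))"
  by (simp add: cnj_form_def wedge_covector[unfolded One_nat_def] minor_def cross_fun_def mult.commute)

end

section \<open>From charts to the pointwise computation\<close>

lemma smooth_form_differentiable:
  assumes "smooth_form A k W \<omega>" "c \<in> A" "x \<in> cmap c ` (W \<inter> cdom c)"
  shows "(\<lambda>y. local_rep \<omega> c y v) differentiable (at x)"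
proof -
  have "Ck_on (Suc 0) (\<lambda>y. local_rep \<omega> c y v) (cmap c ` (W \<inter> cdom c))"
    using assms unfolding smooth_form_def smooth_on_def by blast
  then show ?thesis using assms(3) unfolding Ck_on.simps by blast
qed

lemma chart_image_open:
  assumes "is_chart c" "open W"
  shows "open (cmap c ` (W \<inter> cdom c))"
proof -
  have "openin (top_of_set (cdom c)) (W \<inter> cdom c)"
    using assms(2) by (metis Int_commute openin_open_Int)
  then have "openin (top_of_set (cmap c ` cdom c)) (cmap c ` (W \<inter> cdom c))"
    using assms(1) homeomorphism_imp_open_map unfolding is_chart_def by blast
  then show ?thesis using assms(1) openin_open_trans unfolding is_chart_def by blast
qed

lemma chart_cinv: "is_chart c \<Longrightarrow> p \<in> cdom c \<Longrightarrow> cinv c (cmap c p) = p"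
  unfolding is_chart_def by (metis homeomorphism_apply1)

text \<open>Collects what one chart yields at one point. The factor f is chosen on the whole chart
  image of the coframing's domain, since its derivative enters, although only values at p are
  returned.\<close>

lemma local_structure:
  assumes A: "oriented_atlas A" and \<phi>: "\<phi> \<in> A3plus_fields A" and closed: "closed_form A 3 (star \<phi>)"
    and \<alpha>: "local_coframing A (J_of \<phi>) W \<alpha>" and c: "c \<in> A" and p: "p \<in> W" "p \<in> cdom c"
  obtains a e f D q where "complex_frame (J_of \<phi> c p) a e" "\<And>i. \<alpha> i c p = covector (a i)" "f \<noteq> 0"
    "\<And>v. \<phi> c p v = Re (f * det3 a (v 0) (v 1) (v 2))" "\<And>i. alternating2 (D i)" "linear q"
    "\<And>i. exterior_d 1 (\<alpha> i) c p = (\<lambda>v. D i (v 0) (v 1))"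
    "\<And>v. complex_of_real (exterior_d 3 \<phi> c p v) = complex_frame.d_volume a q f D (v 0) (v 1) (v 2) (v 3)"
proof -
  have chart: "is_chart c" using A c by (simp add: oriented_atlas_def)
  define U where "U = cmap c ` (W \<inter> cdom c)"
  have W: "open W" using \<alpha> by (simp add: local_coframing_def)
  have U: "open U" "cmap c p \<in> U" using chart_image_open[OF chart W] p by (auto simp: U_def)
  have inU: "cinv c x \<in> W \<and> cinv c x \<in> cdom c" if "x \<in> U" for x
    using that chart_cinv[OF chart] by (auto simp: U_def)
  \<comment> \<open>A one-form looks only at entry 0, so a constant sequence reads off the
    covector.\<close>
  define a where "a = (\<lambda>x i w. \<alpha> i c (cinv c x) (\<lambda>_. w))"
  have ex: "(\<exists>e. complex_frame (J_of \<phi> c (cinv c x)) (a x) e) \<and> (\<forall>i. \<alpha> i c (cinv c x) = covector (a x i)) \<and>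
     (\<exists>f. f \<noteq> 0 \<and> (\<forall>v. \<phi> c (cinv c x) v = Re (f * det3 (a x) (v 0) (v 1) (v 2)) \<and>
        star \<phi> c (cinv c x) v = Im (f * det3 (a x) (v 0) (v 1) (v 2))))" if x: "x \<in> U" for x
  proof -
    define r where "r = cinv c x"
    have r: "r \<in> W" "r \<in> cdom c" using inU[OF x] by (auto simp: r_def)
    have "\<phi> c r \<in> A3plus" using \<phi> c r by (auto simp: A3plus_fields_def)
    then obtain b e' where b: "complex_frame (J_form (\<phi> c r)) b e'"
      "\<And>v. \<phi> c r v = Re (det3 b (v 0) (v 1) (v 2))" "\<And>v. star_form (\<phi> c r) v = Im (det3 b (v 0) (v 1) (v 2))"
      using A3plus_frame by blast
    interpret b: complex_frame "J_form (\<phi> c r)" b e' by (rule b(1))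
    have "coframe (J_form (\<phi> c r)) (\<lambda>i. \<alpha> i c r)"
      using \<alpha> c r by (auto simp: local_coframing_def J_of_def)
    then obtain a' e where a': "complex_frame (J_form (\<phi> c r)) a' e" "\<And>i. \<alpha> i c r = covector (a' i)"
      using coframe_complex_frame[OF b.complex_structure] by blast
    interpret a': complex_frame "J_form (\<phi> c r)" a' e by (rule a'(1))
    have ax: "a x = a'" by (simp add: a_def r_def[symmetric] a'(2) covector_def)
    \<comment> \<open>The ratio of the volume form of the frame adapted to \<phi> to that of the
      coframing.\<close>
    define f where "f = det3 b (e 1) (e 2) (e 3)"
    have f: "det3 b x y z = f * det3 a' x y z" for x y z
      unfolding f_def by (rule a'.det3_change_frame[OF b(1)])
    have "f \<noteq> 0" using f[of "e' 1" "e' 2" "e' 3"] b.det3_e by auto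
    then show ?thesis
      using a' b(2,3) f unfolding r_def[symmetric] ax J_of_def star_def by auto
  qed
  then obtain f where f: "\<And>x. x \<in> U \<Longrightarrow> f x \<noteq> 0"
    "\<And>x v. x \<in> U \<Longrightarrow> local_rep \<phi> c x v = Re (f x * det3 (a x) (v 0) (v 1) (v 2))"
    "\<And>x v. x \<in> U \<Longrightarrow> local_rep (star \<phi>) c x v = Im (f x * det3 (a x) (v 0) (v 1) (v 2))"
    unfolding local_rep_def by metis
  have frame: "\<exists>e. complex_frame (J_of \<phi> c (cinv c x)) (a x) e" if "x \<in> U" for x using ex[OF that] by blast
  have cov: "local_rep (\<alpha> i) c x v = a x i (v 0)" if "x \<in> U" for i x v
    using ex[OF that] by (simp add: local_rep_def covector_def)
  have diff_a: "(\<lambda>x. a x i w) differentiable (at (cmap c p))" for i w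
    using smooth_form_differentiable[of A 1 W "\<alpha> i" c "cmap c p" "\<lambda>_. w"] \<alpha> c p
    by (auto simp: local_coframing_def local_rep_def a_def)
  have diff_\<phi>: "(\<lambda>x. local_rep \<phi> c x v) differentiable (at (cmap c p))" for v
    using smooth_form_differentiable[of A 3 UNIV \<phi> c "cmap c p" v] \<phi> c p by (auto simp: A3plus_fields_def)
  note ctx = U frame f(2,3) diff_a diff_\<phi>
  define q where "q = frechet_derivative f (at (cmap c p))"
  define D where "D = curl (cmap c p) a"
  have p': "cinv c (cmap c p) = p" by (rule chart_cinv[OF chart p(2)])
  obtain e where e: "complex_frame (J_of \<phi> c p) (a (cmap c p)) e" using frame[OF U(2)] p' by auto
  show ?thesis
  proof (rule that[OF e])
    show "\<alpha> i c p = covector (a (cmap c p) i)" for i using ex[OF U(2)] p' by simp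
    show "f (cmap c p) \<noteq> 0" using f(1) U by blast
    show "\<phi> c p v = Re (f (cmap c p) * det3 (a (cmap c p)) (v 0) (v 1) (v 2))" for v
      using f(2)[OF U(2), of v] by (simp add: local_rep_def p')
    show "alternating2 (D i)" for i
      unfolding D_def by (rule alternating2_curl[OF ctx])
    show "linear q"
      unfolding q_def by (rule has_derivative_linear[OF has_derivative_f[OF ctx]])
    show "exterior_d 1 (\<alpha> i) c p = (\<lambda>v. D i (v 0) (v 1))" for i
    proof
      fix v
      have "frechet_derivative (\<lambda>y. local_rep (\<alpha> i) c y u) (at (cmap c p)) h = frame_deriv (cmap c p) a i h (u 0)" for u h
        unfolding frame_deriv_def by (subst frechet_derivative_cong_open[OF U cov]) auto
      then show "exterior_d 1 (\<alpha> i) c p v = D i (v 0) (v 1)"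
        by (simp add: exterior_d_def ext_deriv_def D_def curl_def omit_def)
    qed
    show "complex_of_real (exterior_d 3 \<phi> c p v) = complex_frame.d_volume (a (cmap c p)) q (f (cmap c p)) D (v 0) (v 1) (v 2) (v 3)" for v
    proof -
      have "exterior_d 3 (star \<phi>) c p v = 0" using closed c p by (simp add: closed_form_def)
      then show ?thesis
        using ext_deriv_complex[OF ctx, of v]
        by (simp add: exterior_d_def complex_frame.d_volume_def[OF e] q_def D_def)
    qed
  qed
qed

definition eps_matrix :: "real \<Rightarrow> complex \<Rightarrow> complex ^ 3 ^ 3" where
  "eps_matrix s m = (\<chi> i j. if i = j then of_real (eps s i) * m else 0)"

text \<open>The description in \<open>N_matrix\<close> asks for one matrix that works in every chart
  around p, so existence needs f to be independent of the chart. Uniqueness is checked in a single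
  chart on dual pairs of vectors.\<close>

lemma N_matrix_eq:
  assumes A: "oriented_atlas A" and \<phi>: "\<phi> \<in> A3plus_fields A" and closed: "closed_form A 3 (star \<phi>)"
    and \<alpha>: "unitary_coframing s A (J_of \<phi>) \<eta> W \<alpha>" and p: "p \<in> W" and s: "s * s = 1"
    and \<eta>: "\<And>c. c \<in> A \<Longrightarrow> p \<in> cdom c \<Longrightarrow> exterior_d 3 \<phi> c p = (\<lambda>v. 2 * wedge 2 2 (\<eta> c p) (\<eta> c p) v)"
  shows "\<exists>m. m \<noteq> 0 \<and> N_matrix A (J_of \<phi>) \<alpha> p = eps_matrix s m"
proof -
  have \<alpha>': "local_coframing A (J_of \<phi>) W \<alpha>" using \<alpha> by (simp add: unitary_coframing_def)
  let ?a = "\<lambda>c i w. \<alpha> i c p (\<lambda>_. w)"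
  have loc: "\<exists>e f. complex_frame (J_of \<phi> c p) (?a c) e \<and> f \<noteq> 0 \<and>
      (\<forall>v. \<phi> c p v = Re (f * det3 (?a c) (v 0) (v 1) (v 2))) \<and> (\<forall>i. \<alpha> i c p = covector (?a c i)) \<and>
      (\<forall>i. type_component (J_of \<phi> c p) 0 2 (exterior_d 1 (\<alpha> i) c p) =
         (\<lambda>v. of_real (eps s i) / f * cnj (minor (?a c) i (v 0) (v 1))))"
    if c: "c \<in> A" "p \<in> cdom c" for c
  proof -
    obtain a e f D q where a: "complex_frame (J_of \<phi> c p) a e" "\<And>i. \<alpha> i c p = covector (a i)" "f \<noteq> 0"
      "\<And>v. \<phi> c p v = Re (f * det3 a (v 0) (v 1) (v 2))" "\<And>i. alternating2 (D i)" "linear q"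
      "\<And>i. exterior_d 1 (\<alpha> i) c p = (\<lambda>v. D i (v 0) (v 1))"
      "\<And>v. complex_of_real (exterior_d 3 \<phi> c p v) = complex_frame.d_volume a q f D (v 0) (v 1) (v 2) (v 3)"
      by (rule local_structure[OF A \<phi> closed \<alpha>' c(1) p c(2)]) blast
    interpret complex_frame "J_of \<phi> c p" a e by (rule a(1))
    have aa: "?a c = a" by (simp add: a(2) covector_def)
    have "diagonalizes s (\<lambda>i. \<alpha> i c p) (\<eta> c p)" using \<alpha> c p by (auto simp: unitary_coframing_def)
    then have diag: "diagonalizes s (\<lambda>i. covector (a i)) (\<eta> c p)" by (simp add: a(2))
    have "type_component (J_of \<phi> c p) 0 2 (exterior_d 1 (\<alpha> i) c p) =
         (\<lambda>v. of_real (eps s i) / f * cnj (minor a i (v 0) (v 1)))" for i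
      unfolding a(7) type_component_02[OF a(5)] d_volume_eq_square[OF a(8) \<eta>[OF c] diag s a(3)] ..
    moreover have "\<forall>i. \<alpha> i c p = covector (?a c i)" by (simp add: a(2) covector_def)
    ultimately show ?thesis using a(1,3,4) unfolding aa by blast
  qed
  obtain c\<^sub>0 where c\<^sub>0: "c\<^sub>0 \<in> A" "p \<in> cdom c\<^sub>0" using A unfolding oriented_atlas_def by blast
  obtain e f where e: "complex_frame (J_of \<phi> c\<^sub>0 p) (?a c\<^sub>0) e" and f: "f \<noteq> 0"
    "\<And>v. \<phi> c\<^sub>0 p v = Re (f * det3 (?a c\<^sub>0) (v 0) (v 1) (v 2))"
    using loc[OF c\<^sub>0] by blast
  interpret complex_frame "J_of \<phi> c\<^sub>0 p" "?a c\<^sub>0" e by (rule e)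
  \<comment> \<open>\<phi> and the coframing are pulled back by the same transition derivative, so
    both factors give the same real part of a multiple of one determinant; the arguments e 1 and J
    (e 1) compare real and imaginary parts of the factors.\<close>
  have same: "g = f" if c: "c \<in> A" "p \<in> cdom c" and g: "\<And>v. \<phi> c p v = Re (g * det3 (?a c) (v 0) (v 1) (v 2))" for c g
  proof -
    define T where "T = transition_deriv c\<^sub>0 c p"
    have \<phi>T: "\<phi> c\<^sub>0 p = pullback T (\<phi> c p)"
      using \<phi> c c\<^sub>0 unfolding A3plus_fields_def smooth_form_def T_def by blast
    have \<alpha>T: "\<alpha> i c\<^sub>0 p = pullback T (\<alpha> i c p)" for i
      using \<alpha>' c c\<^sub>0 p unfolding local_coframing_def smooth_form_def T_def by blast
    have eq: "Re (f * det3 (?a c\<^sub>0) (v 0) (v 1) (v 2)) = Re (g * det3 (?a c\<^sub>0) (v 0) (v 1) (v 2))" for v :: "nat \<Rightarrow> V"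
      unfolding f(2)[symmetric] \<phi>T by (simp add: pullback_def g det3_code \<alpha>T)
    have eq': "Re (f * det3 (?a c\<^sub>0) x y z) = Re (g * det3 (?a c\<^sub>0) x y z)" for x y z
      using eq[of "\<lambda>i. if i = 0 then x else if i = 1 then y else z"] by simp
    show "g = f"
      using eq'[of "e 1" "e 2" "e 3"] eq'[of "J_of \<phi> c\<^sub>0 p (e 1)" "e 2" "e 3"]
      unfolding det3_J1 det3_e by (simp add: complex_eq_iff)
  qed
  have "N_matrix A (J_of \<phi>) \<alpha> p = eps_matrix s (1 / f)"
    unfolding N_matrix_def
  proof (rule the_equality)
    show "\<forall>c\<in>A. p \<in> cdom c \<longrightarrow> (\<forall>i. type_component (J_of \<phi> c p) 0 2 (exterior_d 1 (\<alpha> i) c p) =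
      (\<lambda>v. \<Sum>j\<in>UNIV. eps_matrix s (1 / f) $ i $ j * cnj_form (wedge 1 1 (\<alpha> (j + 1) c p) (\<alpha> (j + 2) c p)) v))"
    proof (intro ballI impI allI)
      fix c i assume c: "c \<in> A" "p \<in> cdom c"
      obtain e' g where e': "complex_frame (J_of \<phi> c p) (?a c) e'" and g:
        "\<forall>v. \<phi> c p v = Re (g * det3 (?a c) (v 0) (v 1) (v 2))" and cov: "\<forall>i. \<alpha> i c p = covector (?a c i)" and
        tc: "\<forall>i. type_component (J_of \<phi> c p) 0 2 (exterior_d 1 (\<alpha> i) c p) =
         (\<lambda>v. of_real (eps s i) / g * cnj (minor (?a c) i (v 0) (v 1)))"
        using loc[OF c] by blast
      have "g = f" using same[OF c] g by blast
      have "(\<Sum>j\<in>UNIV. eps_matrix s (1 / f) $ i $ j * cnj_form (wedge 1 1 (\<alpha> (j + 1) c p) (\<alpha> (j + 2) c p)) v) =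
         of_real (eps s i) / f * cnj (minor (?a c) i (v 0) (v 1))" for v
      proof -
        have "cnj_form (wedge 1 1 (\<alpha> (j + 1) c p) (\<alpha> (j + 2) c p)) v = cnj (minor (?a c) j (v 0) (v 1))" for j
          using complex_frame.cnj_form_wedge_covector[OF e', of j] cov by metis
        then have "(\<Sum>j\<in>UNIV. eps_matrix s (1 / f) $ i $ j * cnj_form (wedge 1 1 (\<alpha> (j + 1) c p) (\<alpha> (j + 2) c p)) v) =
          (\<Sum>j\<in>UNIV. if i = j then of_real (eps s i) / f * cnj (minor (?a c) i (v 0) (v 1)) else 0)"
          by (intro sum.cong) (auto simp: eps_matrix_def)
        then show ?thesis by simp
      qed
      then show "type_component (J_of \<phi> c p) 0 2 (exterior_d 1 (\<alpha> i) c p) =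
        (\<lambda>v. \<Sum>j\<in>UNIV. eps_matrix s (1 / f) $ i $ j * cnj_form (wedge 1 1 (\<alpha> (j + 1) c p) (\<alpha> (j + 2) c p)) v)"
        using tc \<open>g = f\<close> by simp
    qed
    note exists = this
    fix N assume N: "\<forall>c\<in>A. p \<in> cdom c \<longrightarrow> (\<forall>i. type_component (J_of \<phi> c p) 0 2 (exterior_d 1 (\<alpha> i) c p) =
      (\<lambda>v. \<Sum>j\<in>UNIV. N $ i $ j * cnj_form (wedge 1 1 (\<alpha> (j + 1) c p) (\<alpha> (j + 2) c p)) v))"
    have cov: "\<alpha> i c\<^sub>0 p = covector (?a c\<^sub>0 i)" for i using loc[OF c\<^sub>0] by blast
    have m: "cnj_form (wedge 1 1 (\<alpha> (j + 1) c\<^sub>0 p) (\<alpha> (j + 2) c\<^sub>0 p)) v = cnj (minor (?a c\<^sub>0) j (v 0) (v 1))" for j v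
      using cnj_form_wedge_covector[of j] cov by metis
    have "N $ i $ k = eps_matrix s (1 / f) $ i $ k" for i k
    proof -
      have eq: "(\<Sum>j\<in>UNIV. N $ i $ j * cnj (minor (?a c\<^sub>0) j (v 0) (v 1))) =
          (\<Sum>j\<in>UNIV. eps_matrix s (1 / f) $ i $ j * cnj (minor (?a c\<^sub>0) j (v 0) (v 1)))" for v :: "nat \<Rightarrow> V"
        using N[rule_format, OF c\<^sub>0, of i] exists[rule_format, OF c\<^sub>0, of i] unfolding m by metis
      have pick: "(\<Sum>j\<in>UNIV. M $ i $ j * cnj (minor (?a c\<^sub>0) j (e (k + 1)) (e (k + 2)))) = M $ i $ k" for M :: "complex^3^3"
      proof -
        have "(\<Sum>j\<in>UNIV. M $ i $ j * cnj (minor (?a c\<^sub>0) j (e (k + 1)) (e (k + 2)))) = (\<Sum>j\<in>UNIV. if j = k then M $ i $ j else 0)"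
          unfolding minor_e by (intro sum.cong) auto
        then show ?thesis by simp
      qed
      show ?thesis using eq[of "vec2 (e (k + 1)) (e (k + 2))"] by (simp add: vec2_def pick)
    qed
    then show "N = eps_matrix s (1 / f)" by (simp add: vec_eq_iff)
  qed
  then show ?thesis using f(1) by (intro exI[of _ "1 / f"]) simp
qed

text \<open>The square equation is requested only where a unitary coframing exists: in the definite
  case it is derived from \<open>local_structure\<close>, which starts from a coframing.\<close>

lemma strictly_quasi_integrableI:
  assumes "oriented_atlas A" "\<phi> \<in> A3plus_fields A" "closed_form A 3 (star \<phi>)" "s * s = 1"
    and \<eta>: "\<And>W \<alpha> c p. unitary_coframing s A (J_of \<phi>) \<eta> W \<alpha> \<Longrightarrow> c \<in> A \<Longrightarrow> p \<in> W \<Longrightarrow> p \<in> cdom c \<Longrightarrow>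
      exterior_d 3 \<phi> c p = (\<lambda>v. 2 * wedge 2 2 (\<eta> c p) (\<eta> c p) v)"
  shows "strictly_quasi_integrable s A (J_of \<phi>) \<eta>"
proof -
  have N: "\<exists>m. m \<noteq> 0 \<and> N_matrix A (J_of \<phi>) \<alpha> p = eps_matrix s m"
    if "unitary_coframing s A (J_of \<phi>) \<eta> W \<alpha>" "p \<in> W" for W \<alpha> p
    using N_matrix_eq[OF assms(1-3) that assms(4)] \<eta>[OF that(1) _ that(2)] by blast
  show ?thesis
    unfolding strictly_quasi_integrable_def quasi_integrable_def
  proof (intro conjI allI impI ballI)
    fix W \<alpha> assume u: "unitary_coframing s A (J_of \<phi>) \<eta> W \<alpha>"
    then have "\<forall>p\<in>W. \<exists>m. N_matrix A (J_of \<phi>) \<alpha> p = eps_matrix s m" using N by blast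
    then show "\<exists>\<mu>. N_normal_form s A (J_of \<phi>) \<alpha> W \<mu>"
      unfolding N_normal_form_def eps_matrix_def by (rule bchoice)
  next
    fix W \<alpha> \<mu> p assume u: "unitary_coframing s A (J_of \<phi>) \<eta> W \<alpha>"
      and n: "N_normal_form s A (J_of \<phi>) \<alpha> W \<mu>" and p: "p \<in> W"
    obtain m where m: "m \<noteq> 0" "N_matrix A (J_of \<phi>) \<alpha> p = eps_matrix s m" using N[OF u p] by blast
    \<comment> \<open>The entry at (1, 1) carries the sign +1 for both values of s.\<close>
    have "N_matrix A (J_of \<phi>) \<alpha> p $ 1 $ 1 = \<mu> p"
      using n p by (simp add: N_normal_form_def eps_def)
    then show "\<mu> p \<noteq> 0" using m by (simp add: eps_matrix_def eps_def)
  qed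
qed

theorem proposition11:
  fixes A :: "'m::{t2_space, second_countable_topology} chart set"
    and \<phi> :: "('m, real) form_field"
  assumes "oriented_atlas A"
    and "\<phi> \<in> A3plus_fields A"
    and "closed_form A 3 (star \<phi>)"
  shows "(positive_definite A \<phi> \<longrightarrow>
            strictly_quasi_integrable 1 A (J_of \<phi>) (eta_definite \<phi>)) \<and>
         (positive_indefinite A \<phi> \<longrightarrow>
            strictly_quasi_integrable (-1) A (J_of \<phi>) (eta_indefinite \<phi>))"
proof (intro conjI impI)
  assume pos: "positive_definite A \<phi>"
  show "strictly_quasi_integrable 1 A (J_of \<phi>) (eta_definite \<phi>)"
  proof (rule strictly_quasi_integrableI[OF assms])
    fix W \<alpha> c p assume u: "unitary_coframing 1 A (J_of \<phi>) (eta_definite \<phi>) W \<alpha>"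
      and c: "c \<in> A" and p: "p \<in> W" "p \<in> cdom c"
    have \<alpha>: "local_coframing A (J_of \<phi>) W \<alpha>" using u by (simp add: unitary_coframing_def)
    obtain a e f D q where a: "complex_frame (J_of \<phi> c p) a e" and D: "\<And>i. alternating2 (D i)" and q: "linear q"
      and \<pi>: "\<And>v. complex_of_real (exterior_d 3 \<phi> c p v) = complex_frame.d_volume a q f D (v 0) (v 1) (v 2) (v 3)"
      by (rule local_structure[OF assms \<alpha> c p]) blast
    have "positive_on_complex_planes (J_of \<phi> c p) (exterior_d 3 \<phi> c p)"
      using pos c p by (simp add: positive_definite_def)
    \<comment> \<open>Unique existence of the positive root makes the description in
      \<open>eta_definite\<close> satisfy its defining equation.\<close>
    from theI'[OF complex_frame.d_volume_positive_square_root[OF a \<pi> q D this]]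
    show "exterior_d 3 \<phi> c p = (\<lambda>v. 2 * wedge 2 2 (eta_definite \<phi> c p) (eta_definite \<phi> c p) v)"
      unfolding eta_definite_def by blast
  qed simp
next
  assume pos: "positive_indefinite A \<phi>"
  show "strictly_quasi_integrable (- 1) A (J_of \<phi>) (eta_indefinite \<phi>)"
  proof (rule strictly_quasi_integrableI[OF assms])
    fix W \<alpha> c p assume c: "c \<in> A" and p: "p \<in> W" "p \<in> cdom c"
    obtain \<beta> where \<beta>: "signature12_11 (J_of \<phi> c p) \<beta>" "exterior_d 3 \<phi> c p = (\<lambda>v. 1 / 2 * wedge 2 2 \<beta> \<beta> v)"
      using pos c p unfolding positive_indefinite_def by blast
    have "\<phi> c p \<in> A3plus" using assms(2) c p by (simp add: A3plus_fields_def)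
    then have "complex_structure (J_of \<phi> c p)"
      unfolding J_of_def using A3plus_frame complex_frame.complex_structure by metis
    from theI'[OF indefinite_square_root[OF this \<beta>]]
    show "exterior_d 3 \<phi> c p = (\<lambda>v. 2 * wedge 2 2 (eta_indefinite \<phi> c p) (eta_indefinite \<phi> c p) v)"
      unfolding eta_indefinite_def by blast
  qed simp
qed

end
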